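(* For any $n\ge2$ and $c\ge0$, the quaternionic Kähler manifold $(\bar N_n,g_n^c,\mathcal Q)$ that arises from the (deformed) $c$-map applied to $\mathbb{C}H^{n-1}$ admits, besides the complex structures $J_1$ and $\tilde J_1$, a third complex structure $\hat J$, distinct from these two, such that $(g_n^c,\hat J)$ is a Hermitian structure; and the Hermitian structure $(g_n^c,\hat J)$ induces the same orientation as $\mathcal Q$ if and only if $n$ is even.
   Context: The hyper-Kähler data: let $M_n=\{(z_0,\dots,z_{n-1})\in\mathbb C^n:|z_0|^2>\sum_{j=1}^{n-1}|z_j|^2\}$ with the flat pseudo-Kähler structure $(g_M,J_M)$ given by the Hermitian form $h=-dz_0\otimes d\bar z_0+\sum_{j=1}^{n-1}dz_j\otimes d\bar z_j$, special Kähler connection equal to the flat Levi-Civita connection, and $\xi$ the Euler field of the standard $\mathbb C^*$-action; this is the conical affine special Kähler manifold over the projective special Kähler manifold $\mathbb CH^{n-1}$. Let $\omega_M=g_M(J_M\cdot,\cdot)$. On $N_n=T^*M_n\cong M_n\times\mathbb C^n$, with $TN_n=TM_n\oplus T^*M_n$ (horizontal and vertical parts), put $$g_N=\begin{pmatrix}g_M&0\\0&g_M^{-1}\end{pmatrix},\ I_1=\begin{pmatrix}J_M&0\\0&J_M^*\end{pmatrix},\ I_2=\begin{pmatrix}0&-\omega_M^{-1}\\ \omega_M&0\end{pmatrix},\ I_3=I_1I_2 ,$$ a flat pseudo-hyper-Kähler structure, with rotating Killing field $Z$ the horizontal lift of $-J_M\xi=-i\sum_j(z_j\partial_{z_j}-\bar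 z_j\partial_{\bar z_j})$ ($L_Zg_N=0$, $L_ZI_1=0$, $L_ZI_2=I_3$). HK/QK correspondence: with $\omega_k=g_N(I_k\cdot,\cdot)$ put $\omega_{\mathrm H}=\omega_1+d(g_N(Z,\cdot))$, $f_{\mathrm H}=\frac12(g_N(Z,Z)-c)$, $f_Z=f_{\mathrm H}-g_N(Z,Z)=-\frac12(g_N(Z,Z)+c)$, $c\ge0$ (so $df_{\mathrm H}=-\iota_Z\omega_{\mathrm H}$, $df_Z=-\iota_Z\omega_1$), restricting $N_n$ to the open set $f_Z>0$. Let $\pi_N\colon P\to N_n$ be a principal circle bundle with connection $\eta$ of curvature $\omega_{\mathrm H}$, $X_P$ its generator, $\tilde Z$ the horizontal lift of $Z$, $Z_P=\tilde Z+\pi_N^*f_{\mathrm H}X_P$, and $\bar N_n=P/\langle Z_P\rangle$ (with the standing assumption that $Z,Z_P$ act freely and properly), with projection $\pi_{\bar N}$. Twisting: a $Z$-invariant function twists to the function on $\bar N_n$ with the same pullback to $P$; a $Z$-invariant vector field $U$ twists to $d\pi_{\bar N}(\tilde U)$ ($\tilde U$ horizontal lift); this extends to all $Z$-invariant tensor fields by compatibility with tensor products and contractions. With $\mathbb HZ=\langle Z,I_1Z,I_2Z,I_3Z\rangle$ and $g_{\mathrm H}=\frac1{f_Z}g_N|_{(\mathbb HZ)^\perp}+\frac{f_{\mathrm H}}{f_Z^2}g_N|_{\mathbb HZ}$, the quaternionic Kähler metric $g_n^c$ is the twist of $g_{\mathrm H}$ and $\mathcal Q$ is the twist of $\langle I_1,I_2,I_3\rangle$.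 $X$ is the Killing field on $\bar N_n$ obtained by pushing down $X_P$; $J_1\in\Gamma(\mathcal Q)$ is the twist of $I_1$ (an integrable complex structure); $\tilde J_1$ (also integrable) equals $-J_1$ on $\langle X,J_1X\rangle$ and $J_1$ on its orthogonal complement. *)

theory Defs
  imports "HOL-Analysis.Analysis"
begin

section \<open>Smooth manifolds\<close>

text \<open>On an open subset of a Euclidean space this is the usual notion of a map of class
  \<open>C\<^sup>k\<close>.\<close>

primrec Ck_on :: "nat \<Rightarrow> 'a::real_normed_vector set \<Rightarrow> ('a \<Rightarrow> 'b::real_normed_vector) \<Rightarrow> bool" where
  "Ck_on 0 S f \<longleftrightarrow> continuous_on S f"
| "Ck_on (Suc k) S f \<longleftrightarrow>
     (\<forall>x\<in>S. f differentiable (at x)) \<and> (\<forall>v. Ck_on k S (\<lambda>x. frechet_derivative f (at x) v))"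

definition smooth_on :: "'a::real_normed_vector set \<Rightarrow> ('a \<Rightarrow> 'b::real_normed_vector) \<Rightarrow> bool" where
  "smooth_on S f \<longleftrightarrow> (\<forall>k. Ck_on k S f)"

text \<open>A chart is a pair of its domain and its coordinate map; the values of the coordinate map
  outside of the domain are irrelevant. Atlases need not be maximal. Manifolds are Hausdorff and
  second countable through the type class of the type of points.\<close>

type_synonym ('p, 'e) chart = "'p set \<times> ('p \<Rightarrow> 'e)"

definition chart_inv :: "('p, 'e) chart \<Rightarrow> 'e \<Rightarrow> 'p" where
  "chart_inv c = inv_into (fst c) (snd c)"

definition is_chart :: "('p::topological_space, 'e::euclidean_space) chart \<Rightarrow> bool" where
  "is_chart c \<longleftrightarrow> open (fst c) \<and> open (snd c ` fst c) \<and>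
     homeomorphism (fst c) (snd c ` fst c) (snd c) (chart_inv c)"

definition points :: "('p, 'e) chart set \<Rightarrow> 'p set" where
  "points A = (\<Union>c\<in>A. fst c)"

definition smooth_manifold ::
  "'p::{t2_space,second_countable_topology} set \<Rightarrow> ('p, 'e::euclidean_space) chart set \<Rightarrow> bool" where
  "smooth_manifold M A \<longleftrightarrow> points A = M \<and> (\<forall>c\<in>A. is_chart c) \<and>
     (\<forall>c\<in>A. \<forall>d\<in>A. smooth_on (snd c ` (fst c \<inter> fst d)) (snd d \<circ> chart_inv c))"

definition smooth_map ::
  "('p::topological_space, 'e::euclidean_space) chart set \<Rightarrow>
   ('q::topological_space, 'f::euclidean_space) chart set \<Rightarrow> ('p \<Rightarrow> 'q) \<Rightarrow> bool" where
  "smooth_map A B f \<longleftrightarrow> f ` points A \<subseteq> points B \<and> continuous_on (points A) f \<and>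
     (\<forall>c\<in>A. \<forall>d\<in>B. smooth_on (snd c ` (fst c \<inter> f -` fst d)) (snd d \<circ> f \<circ> chart_inv c))"

definition flat_atlas :: "'a set \<Rightarrow> ('a, 'a) chart set" where
  "flat_atlas S = {(S, \<lambda>x. x)}"

definition real_times :: "('p, 'e) chart set \<Rightarrow> (real \<times> 'p, real \<times> 'e) chart set" where
  "real_times A = {(UNIV \<times> fst c, \<lambda>(t, p). (t, snd c p)) | c. c \<in> A}"


section \<open>Tangent vectors and tensor fields\<close>

text \<open>Around every point one preferred chart is chosen, and the tangent space at \<open>p\<close> is
  the model space \<open>'e\<close>: a tangent vector is given by its components in the preferred
  chart at \<open>p\<close>. Thus a vector field is a map \<open>'p \<Rightarrow> 'e\<close>, a one-form a map
  \<open>'p \<Rightarrow> 'e \<Rightarrow> real\<close>, and a field of endomorphisms a map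
  \<open>'p \<Rightarrow> 'e \<Rightarrow> 'e\<close>. For the atlas \<^const>\<open>flat_atlas\<close> this is the
  usual identification of the tangent spaces with the ambient vector space.\<close>

definition chart_at :: "('p, 'e) chart set \<Rightarrow> 'p \<Rightarrow> ('p, 'e) chart" where
  "chart_at A p = (SOME c. c \<in> A \<and> p \<in> fst c)"

definition mderiv ::
  "('p, 'e::euclidean_space) chart set \<Rightarrow> ('q, 'f::euclidean_space) chart set \<Rightarrow>
   ('p \<Rightarrow> 'q) \<Rightarrow> 'p \<Rightarrow> 'e \<Rightarrow> 'f" where
  "mderiv A B f p =
     frechet_derivative (snd (chart_at B (f p)) \<circ> f \<circ> chart_inv (chart_at A p))
       (at (snd (chart_at A p) p))"

text \<open>\<open>tangent_of A c p\<close> turns components with respect to the chart \<open>c\<close> into a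
  tangent vector at \<open>p\<close>, and \<open>components A c p\<close> is the inverse of this map.\<close>

definition tangent_of ::
  "('p, 'e::euclidean_space) chart set \<Rightarrow> ('p, 'e) chart \<Rightarrow> 'p \<Rightarrow> 'e \<Rightarrow> 'e" where
  "tangent_of A c p = frechet_derivative (snd (chart_at A p) \<circ> chart_inv c) (at (snd c p))"

definition components ::
  "('p, 'e::euclidean_space) chart set \<Rightarrow> ('p, 'e) chart \<Rightarrow> 'p \<Rightarrow> 'e \<Rightarrow> 'e" where
  "components A c p =
     frechet_derivative (snd c \<circ> chart_inv (chart_at A p)) (at (snd (chart_at A p) p))"

definition one_form_in ::
  "('p, 'e::euclidean_space) chart set \<Rightarrow> ('p, 'e) chart \<Rightarrow> ('p \<Rightarrow> 'e \<Rightarrow> real) \<Rightarrow> 'e \<Rightarrow> 'e \<Rightarrow> real" where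
  "one_form_in A c \<alpha> x u = \<alpha> (chart_inv c x) (tangent_of A c (chart_inv c x) u)"

definition endo_in ::
  "('p, 'e::euclidean_space) chart set \<Rightarrow> ('p, 'e) chart \<Rightarrow> ('p \<Rightarrow> 'e \<Rightarrow> 'e) \<Rightarrow> 'e \<Rightarrow> 'e \<Rightarrow> 'e" where
  "endo_in A c J x u =
     components A c (chart_inv c x) (J (chart_inv c x) (tangent_of A c (chart_inv c x) u))"

definition smooth_one_form :: "('p, 'e::euclidean_space) chart set \<Rightarrow> ('p \<Rightarrow> 'e \<Rightarrow> real) \<Rightarrow> bool" where
  "smooth_one_form A \<alpha> \<longleftrightarrow> (\<forall>p\<in>points A. linear (\<alpha> p)) \<and>
     (\<forall>c\<in>A. \<forall>u. smooth_on (snd c ` fst c) (\<lambda>x. one_form_in A c \<alpha> x u))"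

definition smooth_endo :: "('p, 'e::euclidean_space) chart set \<Rightarrow> ('p \<Rightarrow> 'e \<Rightarrow> 'e) \<Rightarrow> bool" where
  "smooth_endo A J \<longleftrightarrow> (\<forall>p\<in>points A. linear (J p)) \<and>
     (\<forall>c\<in>A. \<forall>u. smooth_on (snd c ` fst c) (\<lambda>x. endo_in A c J x u))"

text \<open>Exterior derivative of a one-form, on a vector space and on a manifold (evaluated in the
  preferred chart at the point); the convention is
  \<open>d\<alpha>(U,V) = U(\<alpha>(V)) - V(\<alpha>(U)) - \<alpha>([U,V])\<close>.\<close>

definition ext_d :: "('a::real_normed_vector \<Rightarrow> 'a \<Rightarrow> real) \<Rightarrow> 'a \<Rightarrow> 'a \<Rightarrow> 'a \<Rightarrow> real" where
  "ext_d \<alpha> x u v = frechet_derivative (\<lambda>y. \<alpha> y v) (at x) u - frechet_derivative (\<lambda>y. \<alpha> y u) (at x) v"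

definition mext_d ::
  "('p, 'e::euclidean_space) chart set \<Rightarrow> ('p \<Rightarrow> 'e \<Rightarrow> real) \<Rightarrow> 'p \<Rightarrow> 'e \<Rightarrow> 'e \<Rightarrow> real" where
  "mext_d A \<alpha> p = ext_d (one_form_in A (chart_at A p) \<alpha>) (snd (chart_at A p) p)"

definition lie_bracket :: "('a::real_normed_vector \<Rightarrow> 'a) \<Rightarrow> ('a \<Rightarrow> 'a) \<Rightarrow> 'a \<Rightarrow> 'a" where
  "lie_bracket U V x = frechet_derivative V (at x) (U x) - frechet_derivative U (at x) (V x)"

text \<open>The Nijenhuis tensor \<open>[JU,JV] - J[JU,V] - J[U,JV] + J\<^sup>2[U,V]\<close> is tensorial, so
  that it is enough to evaluate it on vector fields which are constant in the preferred chart.\<close>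

definition nijenhuis ::
  "('p, 'e::euclidean_space) chart set \<Rightarrow> ('p \<Rightarrow> 'e \<Rightarrow> 'e) \<Rightarrow> 'p \<Rightarrow> 'e \<Rightarrow> 'e \<Rightarrow> 'e" where
  "nijenhuis A J p u v =
     (let K = endo_in A (chart_at A p) J; x = snd (chart_at A p) p;
          U = (\<lambda>_. u); V = (\<lambda>_. v); JU = (\<lambda>y. K y u); JV = (\<lambda>y. K y v)
      in lie_bracket JU JV x - K x (lie_bracket JU V x) - K x (lie_bracket U JV x)
         + K x (K x (lie_bracket U V x)))"

definition complex_structure :: "('p, 'e::euclidean_space) chart set \<Rightarrow> ('p \<Rightarrow> 'e \<Rightarrow> 'e) \<Rightarrow> bool" where
  "complex_structure A J \<longleftrightarrow> smooth_endo A J \<and> (\<forall>p\<in>points A. \<forall>u. J p (J p u) = - u) \<and>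
     (\<forall>p\<in>points A. \<forall>u v. nijenhuis A J p u v = 0)"

definition hermitian_structure ::
  "('p, 'e::euclidean_space) chart set \<Rightarrow> ('p \<Rightarrow> 'e \<Rightarrow> 'e \<Rightarrow> real) \<Rightarrow> ('p \<Rightarrow> 'e \<Rightarrow> 'e) \<Rightarrow> bool" where
  "hermitian_structure A g J \<longleftrightarrow> complex_structure A J \<and>
     (\<forall>p\<in>points A. \<forall>u v. g p (J p u) (J p v) = g p u v)"

text \<open>A linear complex structure \<open>J\<close> orients the vector space by declaring the bases
  \<open>e\<^sub>1, \<dots>, e\<^sub>m, Je\<^sub>1, \<dots>, Je\<^sub>m\<close> to be, say, positive; all of these
  have the same orientation. (The usual order \<open>e\<^sub>1, Je\<^sub>1, \<dots>\<close> differs by a sign which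
  depends on \<open>m\<close> only and cancels in the comparison of two complex structures.)\<close>

definition adapted_basis_det ::
  "(real^('m::finite + 'm) \<Rightarrow> real^('m + 'm)) \<Rightarrow> ('m \<Rightarrow> real^('m + 'm)) \<Rightarrow> real" where
  "adapted_basis_det J e = det (\<chi> i. case i of Inl j \<Rightarrow> e j | Inr j \<Rightarrow> J (e j))"

definition same_orientation ::
  "(real^('m::finite + 'm) \<Rightarrow> real^('m + 'm)) \<Rightarrow> (real^('m + 'm) \<Rightarrow> real^('m + 'm)) \<Rightarrow> bool" where
  "same_orientation J J' \<longleftrightarrow> (\<exists>e e'. adapted_basis_det J e * adapted_basis_det J' e' > 0)"

text \<open>The component of \<open>u\<close> in the span of \<open>S\<close>, along the \<open>B\<close>-orthogonal
  complement of \<open>S\<close>.\<close>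

definition orth_part :: "('a::real_vector \<Rightarrow> 'a \<Rightarrow> real) \<Rightarrow> 'a set \<Rightarrow> 'a \<Rightarrow> 'a" where
  "orth_part B S u = (THE v. v \<in> span S \<and> (\<forall>w\<in>span S. B (u - v) w = 0))"


section \<open>Flows, principal circle bundles and connections\<close>

definition smooth_flow ::
  "('p::topological_space, 'e::euclidean_space) chart set \<Rightarrow> (real \<Rightarrow> 'p \<Rightarrow> 'p) \<Rightarrow> bool" where
  "smooth_flow A \<Phi> \<longleftrightarrow> (\<forall>p. \<Phi> 0 p = p) \<and> (\<forall>s t p. \<Phi> (s + t) p = \<Phi> s (\<Phi> t p)) \<and>
     smooth_map (real_times A) A (\<lambda>(t, p). \<Phi> t p)"

definition generator :: "('p, 'e::euclidean_space) chart set \<Rightarrow> (real \<Rightarrow> 'p \<Rightarrow> 'p) \<Rightarrow> 'p \<Rightarrow> 'e" where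
  "generator A \<Phi> p = vector_derivative (\<lambda>t. snd (chart_at A p) (\<Phi> t p)) (at 0)"

text \<open>The one-parameter group of the flow is \<open>\<real>/T\<int>\<close>, where \<open>T = 0\<close> stands for
  the real line.\<close>

definition acts_freely_properly :: "(real \<Rightarrow> 'p::topological_space \<Rightarrow> 'p) \<Rightarrow> bool" where
  "acts_freely_properly \<Phi> \<longleftrightarrow> (\<exists>T\<ge>0.
     (\<forall>t p. \<Phi> t p = p \<longleftrightarrow> (\<exists>k::int. t = of_int k * T)) \<and>
     (\<forall>K. compact K \<longrightarrow>
        (\<exists>R. \<forall>t. \<Phi> t ` K \<inter> K \<noteq> {} \<longrightarrow> (\<exists>k::int. \<bar>t - of_int k * T\<bar> \<le> R))))"

text \<open>The circle \<open>\<real>/2\<pi>\<int>\<close> acts freely, with the fibres of \<open>\<pi>\<close> as orbits.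
  A smooth local section \<open>s\<close> is the same as the smooth local trivialization
  \<open>(x, t) \<mapsto> rot t (s x)\<close>.\<close>

definition principal_circle_bundle ::
  "('p::topological_space, 'e::euclidean_space) chart set \<Rightarrow> 'a::euclidean_space set \<Rightarrow>
   ('p \<Rightarrow> 'a) \<Rightarrow> (real \<Rightarrow> 'p \<Rightarrow> 'p) \<Rightarrow> bool" where
  "principal_circle_bundle A N \<pi> rot \<longleftrightarrow>
     smooth_flow A rot \<and>
     (\<forall>t p. rot t p = p \<longleftrightarrow> (\<exists>k::int. t = of_int k * (2 * pi))) \<and>
     smooth_map A (flat_atlas N) \<pi> \<and> range \<pi> = N \<and>
     (\<forall>p p'. \<pi> p = \<pi> p' \<longleftrightarrow> (\<exists>t. p' = rot t p)) \<and>
     (\<forall>x\<in>N. \<exists>V s. open V \<and> x \<in> V \<and> V \<subseteq> N \<and> smooth_map (flat_atlas V) A s \<and> (\<forall>y\<in>V. \<pi> (s y) = y))"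

definition principal_connection ::
  "('p, 'e::euclidean_space) chart set \<Rightarrow> (real \<Rightarrow> 'p \<Rightarrow> 'p) \<Rightarrow> ('p \<Rightarrow> 'e \<Rightarrow> real) \<Rightarrow> bool" where
  "principal_connection A rot \<eta> \<longleftrightarrow> smooth_one_form A \<eta> \<and>
     (\<forall>p. \<eta> p (generator A rot p) = 1) \<and>
     (\<forall>t p u. \<eta> (rot t p) (mderiv A A (rot t) p u) = \<eta> p u)"

definition has_curvature ::
  "('p, 'e::euclidean_space) chart set \<Rightarrow> 'a::euclidean_space set \<Rightarrow> ('p \<Rightarrow> 'a) \<Rightarrow>
   ('p \<Rightarrow> 'e \<Rightarrow> real) \<Rightarrow> ('a \<Rightarrow> 'a \<Rightarrow> 'a \<Rightarrow> real) \<Rightarrow> bool" where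
  "has_curvature A N \<pi> \<eta> \<omega> \<longleftrightarrow>
     (\<forall>p u v. mext_d A \<eta> p u v =
        \<omega> (\<pi> p) (mderiv A (flat_atlas N) \<pi> p u) (mderiv A (flat_atlas N) \<pi> p v))"

definition horizontal_lift ::
  "('p, 'e::euclidean_space) chart set \<Rightarrow> 'a::euclidean_space set \<Rightarrow> ('p \<Rightarrow> 'a) \<Rightarrow>
   ('p \<Rightarrow> 'e \<Rightarrow> real) \<Rightarrow> 'p \<Rightarrow> 'a \<Rightarrow> 'e" where
  "horizontal_lift A N \<pi> \<eta> p u = (THE v. \<eta> p v = 0 \<and> mderiv A (flat_atlas N) \<pi> p v = u)"

text \<open>The quotient of a manifold by a one-parameter group: a surjective submersion whose fibres
  are the orbits.\<close>

definition is_orbit_space ::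
  "('p::topological_space, 'e::euclidean_space) chart set \<Rightarrow> (real \<Rightarrow> 'p \<Rightarrow> 'p) \<Rightarrow>
   ('q::topological_space, 'f::euclidean_space) chart set \<Rightarrow> ('p \<Rightarrow> 'q) \<Rightarrow> bool" where
  "is_orbit_space A \<Phi> B \<pi> \<longleftrightarrow> smooth_map A B \<pi> \<and> surj \<pi> \<and> (\<forall>p. surj (mderiv A B \<pi> p)) \<and>
     (\<forall>p p'. \<pi> p = \<pi> p' \<longleftrightarrow> (\<exists>t. p' = \<Phi> t p))"


section \<open>The twist\<close>

text \<open>For \<open>p\<close> in \<open>P\<close> the twist identifies the tangent space of \<open>N\<close> at \<open>\<pi>\<^sub>N p\<close>
  with the tangent space of the quotient at \<open>\<pi>\<^sub>Q p\<close>; an invariant vector field on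
  \<open>N\<close> twists to its image under these maps. Twists of other tensors correspond to each other
  under these identifications, which is what compatibility with tensor products and contractions
  amounts to.\<close>

definition twist_map ::
  "('p, 'e::euclidean_space) chart set \<Rightarrow> 'a::euclidean_space set \<Rightarrow> ('p \<Rightarrow> 'a) \<Rightarrow>
   ('p \<Rightarrow> 'e \<Rightarrow> real) \<Rightarrow> ('q, 'f::euclidean_space) chart set \<Rightarrow> ('p \<Rightarrow> 'q) \<Rightarrow> 'p \<Rightarrow> 'a \<Rightarrow> 'f" where
  "twist_map A N \<pi>N \<eta> B \<pi>Q p u = mderiv A B \<pi>Q p (horizontal_lift A N \<pi>N \<eta> p u)"

definition is_twist_bilinear ::
  "('p \<Rightarrow> 'a) \<Rightarrow> ('p \<Rightarrow> 'q) \<Rightarrow> ('p \<Rightarrow> 'a \<Rightarrow> 'f) \<Rightarrow>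
   ('a \<Rightarrow> 'a \<Rightarrow> 'a \<Rightarrow> real) \<Rightarrow> ('q \<Rightarrow> 'f \<Rightarrow> 'f \<Rightarrow> real) \<Rightarrow> bool" where
  "is_twist_bilinear \<pi>N \<pi>Q tw b b' \<longleftrightarrow>
     (\<forall>p u v. b' (\<pi>Q p) (tw p u) (tw p v) = b (\<pi>N p) u v)"

definition is_twist_endo ::
  "('p \<Rightarrow> 'a) \<Rightarrow> ('p \<Rightarrow> 'q) \<Rightarrow> ('p \<Rightarrow> 'a \<Rightarrow> 'f) \<Rightarrow>
   ('a \<Rightarrow> 'a \<Rightarrow> 'a) \<Rightarrow> ('q \<Rightarrow> 'f \<Rightarrow> 'f) \<Rightarrow> bool" where
  "is_twist_endo \<pi>N \<pi>Q tw J J' \<longleftrightarrow> (\<forall>p u. J' (\<pi>Q p) (tw p u) = tw p (J (\<pi>N p) u))"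


section \<open>The hyper-Kaehler data of the c-map\<close>

text \<open>\<open>\<complex>\<^sup>n\<close> is \<open>complex^'n\<close>, with \<open>i0 :: 'n\<close> in the role of the index
  \<open>0\<close>.\<close>

type_synonym 'n cvec = "complex^'n"

definition h_M :: "'n::finite \<Rightarrow> 'n cvec \<Rightarrow> 'n cvec \<Rightarrow> complex" where
  "h_M i0 u v = - (u $ i0) * cnj (v $ i0) + (\<Sum>j\<in>-{i0}. u $ j * cnj (v $ j))"

definition g_M :: "'n::finite \<Rightarrow> 'n cvec \<Rightarrow> 'n cvec \<Rightarrow> real" where
  "g_M i0 u v = Re (h_M i0 u v)"

definition J_M :: "'n::finite cvec \<Rightarrow> 'n cvec" where
  "J_M u = \<i> *s u"

definition omega_M :: "'n::finite \<Rightarrow> 'n cvec \<Rightarrow> 'n cvec \<Rightarrow> real" where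
  "omega_M i0 u v = g_M i0 (J_M u) v"

definition M_dom :: "'n::finite \<Rightarrow> 'n cvec set" where
  "M_dom i0 = {z. (cmod (z $ i0))\<^sup>2 > (\<Sum>j\<in>-{i0}. (cmod (z $ j))\<^sup>2)}"

text \<open>A vector \<open>w\<close> of \<open>\<complex>\<^sup>n\<close> represents the real covector
  \<open>Re (\<Sum>\<^sub>j w\<^sub>j dz\<^sub>j)\<close>, and \<open>covec \<alpha>\<close> is the vector which represents
  \<open>\<alpha>\<close>.\<close>

definition pairing :: "'n::finite cvec \<Rightarrow> 'n cvec \<Rightarrow> real" where
  "pairing w u = Re (\<Sum>j\<in>UNIV. w $ j * u $ j)"

definition covec :: "('n::finite cvec \<Rightarrow> real) \<Rightarrow> 'n cvec" where
  "covec \<alpha> = (THE w. \<forall>u. pairing w u = \<alpha> u)"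

definition g_low :: "'n::finite \<Rightarrow> 'n cvec \<Rightarrow> 'n cvec" where
  "g_low i0 u = covec (\<lambda>v. g_M i0 u v)"

definition omega_low :: "'n::finite \<Rightarrow> 'n cvec \<Rightarrow> 'n cvec" where
  "omega_low i0 u = covec (\<lambda>v. omega_M i0 u v)"

definition g_M_dual :: "'n::finite \<Rightarrow> 'n cvec \<Rightarrow> 'n cvec \<Rightarrow> real" where
  "g_M_dual i0 w w' = g_M i0 (inv (g_low i0) w) (inv (g_low i0) w')"

definition J_M_dual :: "'n::finite cvec \<Rightarrow> 'n cvec" where
  "J_M_dual w = covec (\<lambda>u. pairing w (J_M u))"

text \<open>A point of \<open>T\<^sup>*M\<close>, and likewise a tangent vector, is a pair of its horizontal
  and its vertical part.\<close>

type_synonym 'n TM_dual = "'n cvec \<times> 'n cvec"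

definition g_N :: "'n::finite \<Rightarrow> 'n TM_dual \<Rightarrow> 'n TM_dual \<Rightarrow> real" where
  "g_N i0 u v = g_M i0 (fst u) (fst v) + g_M_dual i0 (snd u) (snd v)"

definition I_1 :: "'n::finite TM_dual \<Rightarrow> 'n TM_dual" where
  "I_1 u = (J_M (fst u), J_M_dual (snd u))"

definition I_2 :: "'n::finite \<Rightarrow> 'n TM_dual \<Rightarrow> 'n TM_dual" where
  "I_2 i0 u = (- inv (omega_low i0) (snd u), omega_low i0 (fst u))"

definition I_3 :: "'n::finite \<Rightarrow> 'n TM_dual \<Rightarrow> 'n TM_dual" where
  "I_3 i0 u = I_1 (I_2 i0 u)"

text \<open>The horizontal lift of \<open>-J\<xi>\<close>; the Euler field is \<open>\<xi>\<^sub>z = z\<close>.\<close>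

definition Z_field :: "'n::finite TM_dual \<Rightarrow> 'n TM_dual" where
  "Z_field x = (- J_M (fst x), 0)"

definition f_H :: "'n::finite \<Rightarrow> real \<Rightarrow> 'n TM_dual \<Rightarrow> real" where
  "f_H i0 c x = (g_N i0 (Z_field x) (Z_field x) - c) / 2"

definition f_Z :: "'n::finite \<Rightarrow> real \<Rightarrow> 'n TM_dual \<Rightarrow> real" where
  "f_Z i0 c x = f_H i0 c x - g_N i0 (Z_field x) (Z_field x)"

definition N_dom :: "'n::finite \<Rightarrow> real \<Rightarrow> 'n TM_dual set" where
  "N_dom i0 c = {x. fst x \<in> M_dom i0 \<and> f_Z i0 c x > 0}"

definition omega_H :: "'n::finite \<Rightarrow> 'n TM_dual \<Rightarrow> 'n TM_dual \<Rightarrow> 'n TM_dual \<Rightarrow> real" where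
  "omega_H i0 x u v = g_N i0 (I_1 u) v + ext_d (\<lambda>y. g_N i0 (Z_field y)) x u v"

definition HZ_span :: "'n::finite \<Rightarrow> 'n TM_dual \<Rightarrow> 'n TM_dual set" where
  "HZ_span i0 x = span {Z_field x, I_1 (Z_field x), I_2 i0 (Z_field x), I_3 i0 (Z_field x)}"

definition g_H :: "'n::finite \<Rightarrow> real \<Rightarrow> 'n TM_dual \<Rightarrow> 'n TM_dual \<Rightarrow> 'n TM_dual \<Rightarrow> real" where
  "g_H i0 c x u v =
     (let pr = orth_part (g_N i0) (HZ_span i0 x)
      in 1 / f_Z i0 c x * g_N i0 (u - pr u) (v - pr v)
         + f_H i0 c x / (f_Z i0 c x)\<^sup>2 * g_N i0 (pr u) (pr v))"

type_synonym 'n R4n = "real^(('n + 'n) + ('n + 'n))"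

definition Z_P ::
  "'n::finite \<Rightarrow> real \<Rightarrow> ('p, 'e::euclidean_space) chart set \<Rightarrow> ('p \<Rightarrow> 'n TM_dual) \<Rightarrow>
   ('p \<Rightarrow> 'e \<Rightarrow> real) \<Rightarrow> ('p \<Rightarrow> 'e) \<Rightarrow> 'p \<Rightarrow> 'e" where
  "Z_P i0 c A \<pi> \<eta> XP p =
     horizontal_lift A (N_dom i0 c) \<pi> \<eta> p (Z_field (\<pi> p)) + f_H i0 c (\<pi> p) *\<^sub>R XP p"

text \<open>The fibre at \<open>q\<close> of the twist of the bundle \<open>\<langle>I\<^sub>1, I\<^sub>2, I\<^sub>3\<rangle>\<close>; the bundle is
  invariant although \<open>I\<^sub>2\<close> and \<open>I\<^sub>3\<close> are not.\<close>

definition Q_bundle ::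
  "'n::finite \<Rightarrow> ('p \<Rightarrow> 'q) \<Rightarrow> ('p \<Rightarrow> 'n TM_dual \<Rightarrow> 'f) \<Rightarrow> 'q \<Rightarrow> ('f \<Rightarrow> 'f) set" where
  "Q_bundle i0 \<pi>Q tw q = {J. \<exists>p a b d. \<pi>Q p = q \<and>
     (\<forall>u. J (tw p u) = tw p (a *\<^sub>R I_1 u + b *\<^sub>R I_2 i0 u + d *\<^sub>R I_3 i0 u))}"

text \<open>The endomorphism field which is \<open>-J\<close> on the span of \<open>X\<close> and \<open>JX\<close>, and
  \<open>J\<close> on its orthogonal complement.\<close>

definition J_tilde ::
  "('q \<Rightarrow> 'f::real_vector \<Rightarrow> 'f \<Rightarrow> real) \<Rightarrow> ('q \<Rightarrow> 'f) \<Rightarrow> ('q \<Rightarrow> 'f \<Rightarrow> 'f) \<Rightarrow> 'q \<Rightarrow> 'f \<Rightarrow> 'f" where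
  "J_tilde g X J q u =
     (let v = orth_part (g q) {X q, J q (X q)} u in J q (u - v) - J q v)"

end

theory Submission
  imports Defs
begin

text \<open>
  The third complex structure is the twist of the constant endomorphism field
  \<open>I_hat = (J\<^sub>M, -J\<^sub>M\<^sup>*)\<close> on \<open>N\<close>. It is invariant under \<open>Z\<close>, orthogonal for
  \<open>g\<^sub>N\<close>, and preserves \<open>HZ\<close>, hence it is orthogonal for \<open>g\<^sub>H\<close>. Since
  \<open>\<omega>\<^sub>H = -g\<^sub>N(I_hat \<cdot>, \<cdot>)\<close>, the curvature of the twist is of type \<open>(1,1)\<close> with respect
  to it. Along a local section \<open>\<sigma>\<close> of \<open>P \<rightarrow> N_bar\<close> the twist is inverted by the coframe
  \<open>S = dp - \<sigma>\<^sup>*\<eta> \<otimes> Z/f\<^sub>H\<close> with \<open>p = \<pi>\<^sub>N \<circ> \<sigma>\<close>, for which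
  \<open>dS(\<xi>,\<zeta>) = (g\<^sub>N(I_hat S\<xi>, S\<zeta>) Z - \<sigma>\<^sup>*\<eta>(\<zeta>) Z(S\<xi>) + \<sigma>\<^sup>*\<eta>(\<xi>) Z(S\<zeta>))/f\<^sub>H\<close>;
  as \<open>Z\<close> is a linear vector field commuting with \<open>I_hat\<close>, this has no \<open>(0,2)\<close>-part with
  values in \<open>(1,0)\<close>-vectors and the twist is integrable.

  \<open>I_hat\<close> commutes with \<open>I\<^sub>1, I\<^sub>2, I\<^sub>3\<close>, equals \<open>I\<^sub>1\<close> on the horizontal and
  \<open>-I\<^sub>1\<close> on the vertical half of \<open>TN\<close>, both of complex dimension \<open>n\<close>. Thus the
  orientations of \<open>I_hat\<close> and \<open>I\<^sub>1\<close> differ by \<open>(-1)\<^sup>n\<close>, and the other elements of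
  the quaternionic structure are conjugate to \<open>I\<^sub>1\<close> by quaternions, which commute with
  \<open>I_hat\<close>.
\<close>

section \<open>Calculus of smooth maps\<close>

text \<open>\<open>I_hat\<close> is dictated by the curvature: passing from
  \<open>\<omega>\<close>_1 to \<open>omega_H\<close> reverses the sign on the horizontal half only,
  and the opposite of the resulting form is the fundamental form of \<open>I_hat\<close>. The main
  obstacle is the descent to the quotient: only the generator of \<open>Psi\<close> is prescribed,
  so it has to be proved that \<open>Psi\<close> covers the rotation flow of \<open>Z\<close> and
  preserves \<open>eta\<close>. A second obstacle is that tangent vectors are stored by components
  in a preferred chart which may jump from point to point; no such components can be differentiated
  directly, and each differential identity is first moved into one fixed chart. Coframes on the
  quotient come from local sections of a submersion, and the endomorphism is recovered from a
  coframe by solving linear equations; hence the inverse function theorem and Cramer's rule in the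
  calculus part. The orientation claim quantifies over all square roots of -1 in the twisted bundle,
  so the even case has to treat every one of them, while for odd \<open>n\<close> the single
  structure \<open>J1\<close> at a single point refutes it.\<close>

lemma Ck_on_Suc_imp: "Ck_on (Suc k) S f \<Longrightarrow> Ck_on k S f"
proof (induction k arbitrary: f)
  case 0 then show ?case
    by (auto intro!: continuous_at_imp_continuous_on differentiable_imp_continuous_within)
next
  case (Suc k) then show ?case by (metis Ck_on.simps(2))
qed

lemma has_derivative_cong_open:
  assumes "open S" "x \<in> S" "\<And>y. y \<in> S \<Longrightarrow> f y = g y"
  shows "(f has_derivative D) (at x) \<longleftrightarrow> (g has_derivative D) (at x)"
proof
  show "(f has_derivative D) (at x) \<Longrightarrow> (g has_derivative D) (at x)"
    by (erule has_derivative_transform_within_open[OF _ assms(1,2)]) (rule assms(3))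
  show "(g has_derivative D) (at x) \<Longrightarrow> (f has_derivative D) (at x)"
    by (erule has_derivative_transform_within_open[OF _ assms(1,2)]) (rule assms(3)[symmetric])
qed

lemma frechet_derivative_cong_open:
  assumes "open S" "x \<in> S" "\<And>y. y \<in> S \<Longrightarrow> f y = g y"
  shows "frechet_derivative f (at x) = frechet_derivative g (at x)"
  unfolding frechet_derivative_def by (simp add: has_derivative_cong_open[OF assms])

lemma Ck_on_cong:
  assumes "open S" "\<And>x. x \<in> S \<Longrightarrow> f x = g x" "Ck_on k S f"
  shows "Ck_on k S g"
  using assms(2,3)
proof (induction k arbitrary: f g)
  case 0
  then have "continuous_on S f" by simp
  with 0(1) have "continuous_on S g" by (rule continuous_on_eq[rotated])
  then show ?case by simp
next
  case (Suc k)
  have "g differentiable (at x)" if "x \<in> S" for x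
  proof -
    have "f differentiable (at x)" using Suc.prems(2) that by simp
    then obtain D where "(f has_derivative D) (at x)" unfolding differentiable_def ..
    then have "(g has_derivative D) (at x)"
      by (rule has_derivative_transform_within_open[OF _ assms(1) that Suc.prems(1)])
    then show ?thesis by (rule differentiableI)
  qed
  moreover have "Ck_on k S (\<lambda>x. frechet_derivative g (at x) v)" for v
  proof (rule Suc.IH)
    show "Ck_on k S (\<lambda>x. frechet_derivative f (at x) v)" using Suc.prems(2) by simp
    show "frechet_derivative f (at x) v = frechet_derivative g (at x) v" if "x \<in> S" for x
      using frechet_derivative_cong_open[of S x f g, OF assms(1) that Suc.prems(1)] by simp
  qed
  ultimately show ?case by simp
qed

text \<open>Derivatives in \<open>Ck_on\<close> are taken at points, without reference to the set,
  which makes the property local. It is needed because coframes exist only near each point.\<close>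

lemma Ck_on_local:
  assumes "\<And>x. x \<in> S \<Longrightarrow> \<exists>U. open U \<and> x \<in> U \<and> Ck_on k U f"
  shows "Ck_on k S f"
  using assms
proof (induction k arbitrary: f)
  case 0
  have "isCont f x" if "x \<in> S" for x
    using 0[OF that] by (auto simp: continuous_on_eq_continuous_at)
  then show ?case by (simp add: continuous_at_imp_continuous_on)
next
  case (Suc k)
  have "f differentiable at x" if "x \<in> S" for x using Suc.prems[OF that] by auto
  moreover have "Ck_on k S (\<lambda>x. frechet_derivative f (at x) v)" for v
    by (rule Suc.IH) (use Suc.prems in fastforce)
  ultimately show ?case by simp
qed

text \<open>\<open>frechet_derivative\<close> is a choice operator; on an open set any explicit
  derivative \<open>f'\<close> agrees with it, so the closure rules below can be read off from
  product and chain rule formulas.\<close>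

lemma Ck_on_SucI:
  assumes "open S" "\<And>x. x \<in> S \<Longrightarrow> (f has_derivative f' x) (at x)" "\<And>v. Ck_on k S (\<lambda>x. f' x v)"
  shows "Ck_on (Suc k) S f"
proof -
  have "f' x v = frechet_derivative f (at x) v" if "x \<in> S" for x v
    using frechet_derivative_at[OF assms(2)[OF that]] by simp
  then show ?thesis using assms Ck_on_cong[OF assms(1), of "\<lambda>x. f' x _"] by (auto simp: differentiable_def)
qed

lemma Ck_on_SucD:
  assumes "Ck_on (Suc k) S f"
  shows "x \<in> S \<Longrightarrow> (f has_derivative frechet_derivative f (at x)) (at x)"
    and "Ck_on k S (\<lambda>x. frechet_derivative f (at x) v)"
  using assms by (auto simp: frechet_derivative_works)

lemma Ck_on_const: "open S \<Longrightarrow> Ck_on k S (\<lambda>x. c)"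
proof (induction k arbitrary: c)
  case 0 then show ?case by simp
next
  case (Suc k) show ?case by (rule Ck_on_SucI[where f'="\<lambda>x v. 0"]) (simp_all add: Suc.prems Suc.IH)
qed

lemma Ck_on_bounded_linear:
  assumes "open S" "bounded_linear L" "Ck_on k S f"
  shows "Ck_on k S (\<lambda>x. L (f x))"
  using assms(3)
proof (induction k arbitrary: f)
  case 0 then show ?case using bounded_linear.continuous_on[OF assms(2)] by simp
next
  case (Suc k)
  note f = Ck_on_SucD[OF Suc.prems]
  show ?case
    by (rule Ck_on_SucI[OF assms(1) bounded_linear.has_derivative[OF assms(2) f(1)] Suc.IH[OF f(2)]])
qed

lemma Ck_on_id: "open S \<Longrightarrow> Ck_on k S (\<lambda>x. x)"
proof (cases k)
  case (Suc k')
  assume S: "open S"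
  show ?thesis unfolding Suc by (rule Ck_on_SucI[OF S has_derivative_ident Ck_on_const[OF S]])

qed simp

lemma Ck_on_linear: "open S \<Longrightarrow> bounded_linear L \<Longrightarrow> Ck_on k S L"
  using Ck_on_bounded_linear[OF _ _ Ck_on_id] .

lemma Ck_on_add:
  assumes "open S" "Ck_on k S f" "Ck_on k S g"
  shows "Ck_on k S (\<lambda>x. f x + g x)"
  using assms(2,3)
proof (induction k arbitrary: f g)
  case 0 then show ?case by (auto intro: continuous_on_add)
next
  case (Suc k)
  note f = Ck_on_SucD[OF Suc.prems(1)] and g = Ck_on_SucD[OF Suc.prems(2)]
  show ?case
    by (rule Ck_on_SucI[OF assms(1) has_derivative_add[OF f(1) g(1)] Suc.IH[OF f(2) g(2)]])
qed

lemma Ck_on_bilinear: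
  assumes "open S" "bounded_bilinear B" "Ck_on k S f" "Ck_on k S g"
  shows "Ck_on k S (\<lambda>x. B (f x) (g x))"
  using assms(3,4)
proof (induction k arbitrary: f g)
  case 0 then show ?case using bounded_bilinear.continuous_on[OF assms(2)] by simp
next
  case (Suc k)
  note f = Ck_on_SucD[OF Suc.prems(1)] and g = Ck_on_SucD[OF Suc.prems(2)]
  show ?case
    by (rule Ck_on_SucI[OF assms(1) bounded_bilinear.FDERIV[OF assms(2) f(1) g(1)]
          Ck_on_add[OF assms(1) Suc.IH[OF Ck_on_Suc_imp[OF Suc.prems(1)] g(2)]
            Suc.IH[OF f(2) Ck_on_Suc_imp[OF Suc.prems(2)]]]])
qed

lemmas Ck_on_scaleR = Ck_on_bilinear[OF _ bounded_bilinear_scaleR]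
lemmas Ck_on_mult = Ck_on_bilinear[OF _ bounded_bilinear_mult]
lemmas Ck_on_uminus = Ck_on_bounded_linear[OF _ bounded_linear_minus[OF bounded_linear_ident]]

lemma Ck_on_diff:
  assumes "open S" "Ck_on k S f" "Ck_on k S g"
  shows "Ck_on k S (\<lambda>x. f x - g x)"
  using Ck_on_add[OF assms(1,2) Ck_on_uminus[OF assms(1,3)]] by simp

lemma Ck_on_sum:
  assumes "open S" "\<And>i. i \<in> I \<Longrightarrow> Ck_on k S (f i)"
  shows "Ck_on k S (\<lambda>x. \<Sum>i\<in>I. f i x)"
  using assms(2)
  by (induction I rule: infinite_finite_induct) (auto intro!: Ck_on_const Ck_on_add assms(1))

lemma Ck_on_prod:
  fixes f :: "'i \<Rightarrow> 'a::real_normed_vector \<Rightarrow> real"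
  assumes "open S" "\<And>i. i \<in> I \<Longrightarrow> Ck_on k S (f i)"
  shows "Ck_on k S (\<lambda>x. \<Prod>i\<in>I. f i x)"
  using assms(2)
  by (induction I rule: infinite_finite_induct) (auto intro!: Ck_on_const Ck_on_mult assms(1))

lemma linear_sum_Basis:
  fixes L :: "'a::euclidean_space \<Rightarrow> 'b::real_vector"
  assumes "linear L"
  shows "L u = (\<Sum>b\<in>Basis. (u \<bullet> b) *\<^sub>R L b)"
  by (metis (no_types, lifting) assms euclidean_representation linear_scale linear_sum sum.cong)

lemma Ck_on_Pair:
  assumes "open S" "Ck_on k S f" "Ck_on k S g"
  shows "Ck_on k S (\<lambda>x. (f x, g x))"
proof -
  have "Ck_on k S (\<lambda>x. (f x, 0) + (0, g x))"
    by (rule Ck_on_add[OF assms(1) Ck_on_bounded_linear[OF assms(1) _ assms(2)] Ck_on_bounded_linear[OF assms(1) _ assms(3)]])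
       (auto intro!: bounded_linear_Pair bounded_linear_ident bounded_linear_zero)
  then show ?thesis by simp
qed

text \<open>Regularity of a family of linear maps is known only on fixed vectors \<open>u\<close>.
  Expanding the moving argument in a basis gives a finite sum of products with scalar
  coefficients.\<close>

lemma Ck_on_apply_linear:
  fixes w :: "'a::real_normed_vector \<Rightarrow> 'b::euclidean_space"
  assumes "open S" "\<And>u. Ck_on k S (\<lambda>x. A x u)" "\<And>x. x \<in> S \<Longrightarrow> linear (A x)" "Ck_on k S w"
  shows "Ck_on k S (\<lambda>x. A x (w x))"
proof (rule Ck_on_cong[OF assms(1)])
  show "Ck_on k S (\<lambda>x. \<Sum>b\<in>Basis. (w x \<bullet> b) *\<^sub>R A x b)"
    by (intro Ck_on_sum Ck_on_scaleR Ck_on_bounded_linear[OF _ bounded_linear_inner_left] assms)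
qed (use linear_sum_Basis assms(3) in metis)

text \<open>By the chain rule the derivative is a moving linear map applied to a moving vector. The
  induction generalizes \<open>f\<close>, because its hypothesis is applied to the directional
  derivatives of \<open>f\<close> with the same inner map.\<close>

lemma Ck_on_compose:
  fixes f :: "'a::euclidean_space \<Rightarrow> 'b::real_normed_vector"
    and g :: "'c::real_normed_vector \<Rightarrow> 'a"
  assumes "open S" "open T" "g ` S \<subseteq> T" "Ck_on k T f" "Ck_on k S g"
  shows "Ck_on k S (\<lambda>x. f (g x))"
  using assms(4,5)
proof (induction k arbitrary: f)
  case 0 then show ?case using continuous_on_compose2[OF _ _ assms(3)] by simp
next
  case (Suc k)
  note f = Ck_on_SucD[OF Suc.prems(1)] and g = Ck_on_SucD[OF Suc.prems(2)]
  have gT: "g x \<in> T" if "x \<in> S" for x using that assms(3) by auto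
  show ?case
  proof (rule Ck_on_SucI[OF assms(1), where f'="\<lambda>x v. frechet_derivative f (at (g x)) (frechet_derivative g (at x) v)"])
    fix x assume "x \<in> S"
    then show "((\<lambda>x. f (g x)) has_derivative (\<lambda>v. frechet_derivative f (at (g x)) (frechet_derivative g (at x) v))) (at x)"
      using diff_chain_at[OF g(1) f(1)[OF gT]] by (auto simp: o_def)
  next
    fix v
    show "Ck_on k S (\<lambda>x. frechet_derivative f (at (g x)) (frechet_derivative g (at x) v))"
    proof (rule Ck_on_apply_linear[OF assms(1) _ _ g(2)])
      show "Ck_on k S (\<lambda>x. frechet_derivative f (at (g x)) u)" for u
        by (rule Suc.IH[OF f(2) Ck_on_Suc_imp[OF Suc.prems(2)]])
      show "linear (frechet_derivative f (at (g x)))" if "x \<in> S" for x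
        using f(1)[OF gT[OF that]] has_derivative_linear by blast
    qed
  qed
qed

lemma Ck_on_inverse:
  fixes f :: "'a::real_normed_vector \<Rightarrow> real"
  assumes "open S" "\<And>x. x \<in> S \<Longrightarrow> f x \<noteq> 0" "Ck_on k S f"
  shows "Ck_on k S (\<lambda>x. inverse (f x))"
  using assms(3)
proof (induction k)
  case 0 then show ?case using assms by (auto intro!: continuous_intros)
next
  case (Suc k)
  note f = Ck_on_SucD[OF Suc.prems]
  have i: "Ck_on k S (\<lambda>x. inverse (f x))" by (rule Suc.IH[OF Ck_on_Suc_imp[OF Suc.prems]])
  show ?case
    by (rule Ck_on_SucI[OF assms(1) Deriv.has_derivative_inverse[OF assms(2) f(1)]
          Ck_on_uminus[OF assms(1) Ck_on_mult[OF assms(1) Ck_on_mult[OF assms(1) i f(2)] i]]])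
qed

lemma Ck_on_divide:
  fixes f g :: "'a::real_normed_vector \<Rightarrow> real"
  assumes "open S" "\<And>x. x \<in> S \<Longrightarrow> g x \<noteq> 0" "Ck_on k S f" "Ck_on k S g"
  shows "Ck_on k S (\<lambda>x. f x / g x)"
  unfolding divide_inverse by (intro Ck_on_mult Ck_on_inverse assms)

lemma Ck_on_vec_lambda:
  fixes f :: "'a::real_normed_vector \<Rightarrow> real^'n"
  assumes "open S" "\<And>i. Ck_on k S (\<lambda>x. f x $ i)"
  shows "Ck_on k S f"
proof (rule Ck_on_cong[OF assms(1)])
  show "Ck_on k S (\<lambda>x. \<Sum>i\<in>UNIV. (f x $ i) *\<^sub>R axis i 1)"
    by (intro Ck_on_sum Ck_on_scaleR Ck_on_const assms)
next
  show "(\<Sum>i\<in>UNIV. (f x $ i) *\<^sub>R axis i 1) = f x" for x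
    using basis_expansion[of "f x"] by (simp add: scalar_mult_eq_scaleR)
qed

lemma Ck_on_det:
  fixes M :: "'a::real_normed_vector \<Rightarrow> real^'n^'n"
  assumes "open S" "\<And>i j. Ck_on k S (\<lambda>x. M x $ i $ j)"
  shows "Ck_on k S (\<lambda>x. det (M x))"
  unfolding det_def by (intro Ck_on_sum Ck_on_mult Ck_on_prod Ck_on_const assms)

text \<open>Cramer's rule writes the solution as a quotient of determinants, so it inherits the
  regularity of the coefficients and of the right-hand side; nothing about \<open>x\<close> is
  presupposed, not even continuity. This serves both for the derivative of an inverse function and
  for an endomorphism given through a coframe.\<close>

lemma Ck_on_solve:
  fixes A :: "'a::real_normed_vector \<Rightarrow> real^'n \<Rightarrow> real^'n"
  assumes "open S" "\<And>u. Ck_on k S (\<lambda>y. A y u)" "\<And>y. y \<in> S \<Longrightarrow> linear (A y)" "\<And>y. y \<in> S \<Longrightarrow> inj (A y)"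
    "Ck_on k S w" "\<And>y. y \<in> S \<Longrightarrow> A y (x y) = w y"
  shows "Ck_on k S x"
proof (rule Ck_on_vec_lambda[OF assms(1)])
  fix j
  let ?M = "\<lambda>y. matrix (A y)"
  let ?D = "\<lambda>y. det (\<chi> i l. if l = j then w y $ i else ?M y $ i $ l)"
  have nz: "det (?M y) \<noteq> 0" if "y \<in> S" for y
    using assms(3,4)[OF that] by (simp add: det_nz_iff_inj)
  have comp: "Ck_on k S (\<lambda>y. f y $ i)" if "Ck_on k S f" for f :: "'a \<Rightarrow> real^'n" and i
    using Ck_on_bounded_linear[OF assms(1) bounded_linear_vec_nth that] .
  have M: "Ck_on k S (\<lambda>y. ?M y $ i $ l)" for i l
    unfolding matrix_def using comp[OF assms(2)] by simp
  have "Ck_on k S (\<lambda>y. ?D y / det (?M y))"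
  proof (intro Ck_on_divide[OF assms(1) nz] Ck_on_det[OF assms(1)] M)
    fix i l
    show "Ck_on k S (\<lambda>y. (\<chi> i l. if l = j then w y $ i else ?M y $ i $ l) $ i $ l)"
      using comp[OF assms(5), of i] M[of i l] by (cases "l = j") auto
  qed auto
  then show "Ck_on k S (\<lambda>y. x y $ j)"
  proof (rule Ck_on_cong[OF assms(1), rotated])
    fix y assume y: "y \<in> S"
    have "?M y *v x y = w y" using assms(3,6)[OF y] by (simp add: matrix_works)
    then have "x y = (\<chi> k. det (\<chi> i j. if j=k then w y$i else ?M y$i$j) / det (?M y))"
      using cramer[OF nz[OF y]] by blast
    then show "?D y / det (?M y) = x y $ j" by (metis (no_types, lifting) vec_lambda_beta)
  qed
qed

lemma smooth_on_frechet: "smooth_on S f \<Longrightarrow> smooth_on S (\<lambda>x. frechet_derivative f (at x) v)"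
  unfolding smooth_on_def using Ck_on_SucD(2) by blast

lemma smooth_on_has_derivative:
  "smooth_on S f \<Longrightarrow> x \<in> S \<Longrightarrow> (f has_derivative frechet_derivative f (at x)) (at x)"
  unfolding smooth_on_def using Ck_on_SucD(1) by blast

lemma smooth_on_linear_frechet:
  "smooth_on S f \<Longrightarrow> x \<in> S \<Longrightarrow> linear (frechet_derivative f (at x))"
  using smooth_on_has_derivative has_derivative_linear by blast

lemma smooth_on_continuous: "smooth_on S f \<Longrightarrow> continuous_on S f"
  unfolding smooth_on_def by (metis Ck_on.simps(1))

lemma smooth_on_cong: "open S \<Longrightarrow> (\<And>x. x \<in> S \<Longrightarrow> f x = g x) \<Longrightarrow> smooth_on S f \<Longrightarrow> smooth_on S g"
  unfolding smooth_on_def by (auto intro: Ck_on_cong[of S f g])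

lemma smooth_on_compose:
  fixes f :: "'a::euclidean_space \<Rightarrow> 'b::real_normed_vector" and g :: "'c::real_normed_vector \<Rightarrow> 'a"
  assumes "open S" "open T" "g ` S \<subseteq> T" "smooth_on T f" "smooth_on S g"
  shows "smooth_on S (\<lambda>x. f (g x))"
  using Ck_on_compose[OF assms(1-3)] assms(4,5) unfolding smooth_on_def by blast

section \<open>Symmetry of second derivatives\<close>

lemma has_derivative_along_line:
  assumes "(f has_derivative D) (at (x + s *\<^sub>R u))"
  shows "((\<lambda>s. f (x + s *\<^sub>R u)) has_vector_derivative D u) (at s)"
proof -
  have "((\<lambda>s. x + s *\<^sub>R u) has_derivative (\<lambda>s. s *\<^sub>R u)) (at s)"
    by (auto intro!: derivative_eq_intros)
  from diff_chain_at[OF this assms] show ?thesis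
    using has_derivative_linear[OF assms] by (simp add: o_def has_vector_derivative_def linear_scale)
qed

text \<open>The numerator is the increment over \<open>[0, h]\<close> of
  \<open>s \<mapsto> f (x + h v + s u) - f (x + s u)\<close>. The mean value theorem in
  \<open>s\<close> extracts the derivative along \<open>u\<close>, a second application in the
  direction \<open>v\<close> extracts the mixed derivative at a nearby point, and continuity
  finishes.\<close>

lemma second_difference_quotient:
  fixes f :: "'a::real_normed_vector \<Rightarrow> real"
  assumes S: "open S" "x \<in> S" and f: "Ck_on 2 S f"
  shows "((\<lambda>h. (f (x + h *\<^sub>R u + h *\<^sub>R v) - f (x + h *\<^sub>R u) - f (x + h *\<^sub>R v) + f x) / h\<^sup>2)
    \<longlongrightarrow> frechet_derivative (\<lambda>y. frechet_derivative f (at y) u) (at x) v) (at_right 0)"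
proof (rule tendstoI)
  fix e :: real assume e: "e > 0"
  let ?F = "\<lambda>y. frechet_derivative f (at y) u"
  let ?G = "\<lambda>y. frechet_derivative ?F (at y) v"
  have f': "Ck_on (Suc (Suc 0)) S f" using f by (simp add: numeral_2_eq_2)
  note d1 = Ck_on_SucD[OF f'] note d2 = Ck_on_SucD[OF d1(2)]
  have "continuous_on S ?G" using d2(2) by simp
  then have "isCont ?G x" using S by (simp add: continuous_on_eq_continuous_at)
  then have "\<forall>\<^sub>F y in at x. dist (?G y) (?G x) < e" using e by (auto simp: isCont_def tendsto_iff)
  then obtain r0 where r0: "r0 > 0" "\<And>y. y \<noteq> x \<Longrightarrow> dist y x < r0 \<Longrightarrow> dist (?G y) (?G x) < e"
    unfolding eventually_at by auto
  obtain r1 where r1: "r1 > 0" "ball x r1 \<subseteq> S" using S openE by blast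
  define r where "r = min r0 r1"
  have r: "r > 0" "\<And>y. dist y x < r \<Longrightarrow> y \<in> S" "\<And>y. dist y x < r \<Longrightarrow> dist (?G y) (?G x) < e"
    using r0 r1 e unfolding r_def by (auto simp: dist_commute subset_iff) (metis dist_self)
  \<comment> \<open>With this \<open>d\<close> the whole parallelogram of points
    \<open>x + s u + t v\<close>, \<open>0 \<le> s, t < d\<close>, lies in the ball of radius
    \<open>r\<close>; the summand 1 avoids division by zero.\<close>
  define d where "d = r / (norm u + norm v + 1)"
  have pos: "norm u + norm v + 1 > 0" by (smt (verit) norm_ge_zero)
  have d: "d > 0" using r pos by (simp add: d_def)
  have small: "dist (x + s *\<^sub>R u + t *\<^sub>R v) x < r" if "0 \<le> s" "s < d" "0 \<le> t" "t < d" for s t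
  proof -
    have "dist (x + s *\<^sub>R u + t *\<^sub>R v) x = norm (s *\<^sub>R u + t *\<^sub>R v)" by (simp add: dist_norm add.assoc)
    also have "\<dots> \<le> s * norm u + t * norm v" using norm_triangle_ineq[of "s *\<^sub>R u" "t *\<^sub>R v"] that by simp
    also have "\<dots> \<le> d * norm u + d * norm v" using that by (intro add_mono mult_right_mono) auto
    also have "\<dots> < d * (norm u + norm v + 1)" using d by (simp add: algebra_simps)
    also have "\<dots> = r" using pos by (simp add: d_def)
    finally show ?thesis .
  qed
  have "dist ((f (x + h *\<^sub>R u + h *\<^sub>R v) - f (x + h *\<^sub>R u) - f (x + h *\<^sub>R v) + f x) / h\<^sup>2) (?G x) < e"
    if h: "0 < h" "h < d" for h
  proof -
    let ?g = "\<lambda>s. f (x + h *\<^sub>R v + s *\<^sub>R u) - f (x + s *\<^sub>R u)"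
    have D: "(?g has_real_derivative ?F (x + h *\<^sub>R v + s *\<^sub>R u) - ?F (x + s *\<^sub>R u)) (at s)"
      if "0 \<le> s" "s \<le> h" for s
    proof -
      have "x + h *\<^sub>R v + s *\<^sub>R u \<in> S" "x + s *\<^sub>R u \<in> S"
        using r(2)[OF small[of s h]] r(2)[OF small[of s 0]] that h d by (auto simp: algebra_simps)
      then show ?thesis
        unfolding has_real_derivative_iff_has_vector_derivative
        by (intro has_vector_derivative_diff has_derivative_along_line d1)
    qed
    from MVT2[OF h(1) D] obtain s where s: "0 < s" "s < h"
      and sg: "?g h - ?g 0 = (h - 0) * (?F (x + h *\<^sub>R v + s *\<^sub>R u) - ?F (x + s *\<^sub>R u))" by blast
    have D': "((\<lambda>t. ?F (x + s *\<^sub>R u + t *\<^sub>R v)) has_real_derivative ?G (x + s *\<^sub>R u + t *\<^sub>R v)) (at t)"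
      if "0 \<le> t" "t \<le> h" for t
      unfolding has_real_derivative_iff_has_vector_derivative
      using r(2)[OF small[of s t]] that s h by (intro has_derivative_along_line d2) auto
    from MVT2[OF h(1) D'] obtain t where t: "0 < t" "t < h"
      and tg: "?F (x + s *\<^sub>R u + h *\<^sub>R v) - ?F (x + s *\<^sub>R u + 0 *\<^sub>R v) = (h - 0) * ?G (x + s *\<^sub>R u + t *\<^sub>R v)" by blast
    have "f (x + h *\<^sub>R u + h *\<^sub>R v) - f (x + h *\<^sub>R u) - f (x + h *\<^sub>R v) + f x = h\<^sup>2 * ?G (x + s *\<^sub>R u + t *\<^sub>R v)"
      using sg tg by (simp add: add.commute add.left_commute power2_eq_square)
    then show ?thesis using r(3)[OF small[of s t]] s t h by simp
  qed
  then show "\<forall>\<^sub>F h in at_right 0. dist ((f (x + h *\<^sub>R u + h *\<^sub>R v) - f (x + h *\<^sub>R u) - f (x + h *\<^sub>R v) + f x) / h\<^sup>2) (?G x) < e"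
    unfolding eventually_at_right[OF zero_less_one] using d by (auto intro!: exI[of _ d])
qed

text \<open>The difference quotient is symmetric in \<open>u\<close> and \<open>v\<close>, so both
  mixed derivatives are limits of the same function.\<close>

lemma second_derivative_symmetric_real:
  fixes f :: "'a::real_normed_vector \<Rightarrow> real"
  assumes "open S" "x \<in> S" "Ck_on 2 S f"
  shows "frechet_derivative (\<lambda>y. frechet_derivative f (at y) u) (at x) v =
    frechet_derivative (\<lambda>y. frechet_derivative f (at y) v) (at x) u"
  by (rule tendsto_unique[OF _ second_difference_quotient[OF assms, of u v]])
     (use second_difference_quotient[OF assms, of v u] in \<open>simp_all add: algebra_simps\<close>)

lemma frechet_derivative_bounded_linear:
  assumes "bounded_linear L" "f differentiable (at x)"
  shows "frechet_derivative (\<lambda>y. L (f y)) (at x) = (\<lambda>v. L (frechet_derivative f (at x) v))"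
  using frechet_derivative_at[OF bounded_linear.has_derivative[OF assms(1)]]
    assms(2) frechet_derivative_works by metis

lemma second_derivative_symmetric:
  fixes f :: "'a::real_normed_vector \<Rightarrow> 'b::euclidean_space"
  assumes S: "open S" "x \<in> S" and f: "smooth_on S f"
  shows "frechet_derivative (\<lambda>y. frechet_derivative f (at y) u) (at x) v =
    frechet_derivative (\<lambda>y. frechet_derivative f (at y) v) (at x) u"
proof (rule euclidean_eqI)
  fix b :: 'b
  have L: "bounded_linear (\<lambda>x. x \<bullet> b)" by (rule bounded_linear_inner_left)
  have diff: "smooth_on S g \<Longrightarrow> y \<in> S \<Longrightarrow> g differentiable (at y)" for y and g :: "'a \<Rightarrow> 'b"
    using smooth_on_has_derivative by (blast intro: differentiableI)
  have 1: "frechet_derivative (\<lambda>y. f y \<bullet> b) (at y) w = frechet_derivative f (at y) w \<bullet> b" if "y \<in> S" for y w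
    using frechet_derivative_bounded_linear[OF L diff[OF f that]] by simp
  have 2: "frechet_derivative (\<lambda>y. frechet_derivative (\<lambda>y. f y \<bullet> b) (at y) w) (at x) w'
    = frechet_derivative (\<lambda>y. frechet_derivative f (at y) w) (at x) w' \<bullet> b" for w w'
  proof -
    have "frechet_derivative (\<lambda>y. frechet_derivative (\<lambda>y. f y \<bullet> b) (at y) w) (at x)
      = frechet_derivative (\<lambda>y. frechet_derivative f (at y) w \<bullet> b) (at x)"
      by (rule frechet_derivative_cong_open[OF S 1])
    then show ?thesis
      using frechet_derivative_bounded_linear[OF L diff[OF smooth_on_frechet[OF f] S(2)]] by simp
  qed
  have "Ck_on 2 S (\<lambda>y. f y \<bullet> b)"
    using Ck_on_bounded_linear[OF S(1) L] f by (simp add: smooth_on_def)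
  from second_derivative_symmetric_real[OF S this, of u v]
  show "frechet_derivative (\<lambda>y. frechet_derivative f (at y) u) (at x) v \<bullet> b =
    frechet_derivative (\<lambda>y. frechet_derivative f (at y) v) (at x) u \<bullet> b" by (simp only: 2)
qed

section \<open>Exterior derivatives under pullback, and local sections of submersions\<close>

lemma has_derivative_apply_linear:
  fixes A :: "'a::real_normed_vector \<Rightarrow> 'b::euclidean_space \<Rightarrow> 'c::real_normed_vector"
  assumes "open W" "x \<in> W" "\<And>y. y \<in> W \<Longrightarrow> linear (A y)"
    and A: "\<And>u. ((\<lambda>y. A y u) has_derivative (\<lambda>h. A' h u)) (at x)" and w: "(w has_derivative w') (at x)"
  shows "((\<lambda>y. A y (w y)) has_derivative (\<lambda>h. A' h (w x) + A x (w' h))) (at x)"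
proof -
  have "((\<lambda>y. \<Sum>b\<in>Basis. (w y \<bullet> b) *\<^sub>R A y b) has_derivative
      (\<lambda>h. \<Sum>b\<in>Basis. (w x \<bullet> b) *\<^sub>R A' h b + (w' h \<bullet> b) *\<^sub>R A x b)) (at x)"
    by (intro has_derivative_sum bounded_bilinear.FDERIV[OF bounded_bilinear_scaleR]
          has_derivative_inner_left w A)
  then have *: "((\<lambda>y. A y (w y)) has_derivative
      (\<lambda>h. \<Sum>b\<in>Basis. (w x \<bullet> b) *\<^sub>R A' h b + (w' h \<bullet> b) *\<^sub>R A x b)) (at x)"
    by (rule has_derivative_transform_within_open[OF _ assms(1,2)]) (metis linear_sum_Basis assms(3))
  \<comment> \<open>Linearity of \<open>A' h\<close> in its second argument is not part of the
    hypotheses; it follows from linearity of each \<open>A y\<close> and uniqueness of derivatives,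
    and it is what reassembles the basis expansion.\<close>
  have lin: "linear (A' h)" for h
  proof (rule linearI)
    fix u v
    have "((\<lambda>y. A y u + A y v) has_derivative (\<lambda>h. A' h u + A' h v)) (at x)"
      by (intro has_derivative_add A)
    then have "((\<lambda>y. A y (u + v)) has_derivative (\<lambda>h. A' h u + A' h v)) (at x)"
      by (rule has_derivative_transform_within_open[OF _ assms(1,2)]) (metis linear_add assms(3))
    from has_derivative_unique[OF A this] show "A' h (u + v) = A' h u + A' h v" by meson
  next
    fix r u
    have "((\<lambda>y. r *\<^sub>R A y u) has_derivative (\<lambda>h. r *\<^sub>R A' h u)) (at x)"
      by (intro has_derivative_scaleR_right A)
    then have "((\<lambda>y. A y (r *\<^sub>R u)) has_derivative (\<lambda>h. r *\<^sub>R A' h u)) (at x)"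
      by (rule has_derivative_transform_within_open[OF _ assms(1,2)]) (metis linear_scale assms(3))
    from has_derivative_unique[OF A this] show "A' h (r *\<^sub>R u) = r *\<^sub>R A' h u" by meson
  qed
  show ?thesis
    using * by (simp add: sum.distrib flip: linear_sum_Basis[OF lin] linear_sum_Basis[OF assms(3)[OF assms(2)]])
qed

text \<open>The product rule leaves, besides the pulled-back derivative of \<open>\<alpha>\<close>,
  a term with the second derivative of \<open>\<sigma>\<close>; it is symmetric in the two arguments
  and drops out on antisymmetrization.\<close>

lemma ext_d_pullback:
  fixes \<sigma> :: "'c::real_normed_vector \<Rightarrow> 'a::euclidean_space" and \<alpha> :: "'a \<Rightarrow> 'a \<Rightarrow> real"
  assumes U: "open U" "y \<in> U" and W: "open W" and sW: "\<sigma> ` U \<subseteq> W" and s: "smooth_on U \<sigma>"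
    and lin: "\<And>x. x \<in> W \<Longrightarrow> linear (\<alpha> x)" and a: "\<And>u. smooth_on W (\<lambda>x. \<alpha> x u)"
  shows "ext_d (\<lambda>y \<xi>. \<alpha> (\<sigma> y) (frechet_derivative \<sigma> (at y) \<xi>)) y \<xi> \<zeta> =
    ext_d \<alpha> (\<sigma> y) (frechet_derivative \<sigma> (at y) \<xi>) (frechet_derivative \<sigma> (at y) \<zeta>)"
proof -
  let ?D = "\<lambda>y. frechet_derivative \<sigma> (at y)"
  have sy: "\<sigma> y \<in> W" using U sW by auto
  have "frechet_derivative (\<lambda>y. \<alpha> (\<sigma> y) (?D y \<zeta>)) (at y) =
     (\<lambda>h. frechet_derivative (\<lambda>x. \<alpha> x (?D y \<zeta>)) (at (\<sigma> y)) (?D y h)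
       + \<alpha> (\<sigma> y) (frechet_derivative (\<lambda>y. ?D y \<zeta>) (at y) h))" for \<zeta>
  proof (rule frechet_derivative_at[symmetric], rule has_derivative_apply_linear[OF U, where
        A'="\<lambda>h u. frechet_derivative (\<lambda>x. \<alpha> x u) (at (\<sigma> y)) (?D y h)"])
    fix u
    show "((\<lambda>y. \<alpha> (\<sigma> y) u) has_derivative (\<lambda>h. frechet_derivative (\<lambda>x. \<alpha> x u) (at (\<sigma> y)) (?D y h))) (at y)"
      using diff_chain_at[OF smooth_on_has_derivative[OF s U(2)] smooth_on_has_derivative[OF a sy, of u]]
      by (simp add: o_def)
  qed (use lin sW in \<open>auto intro!: smooth_on_has_derivative[OF smooth_on_frechet[OF s] U(2)]\<close>)
  then show ?thesis
    unfolding ext_d_def using second_derivative_symmetric[OF U s, of \<xi> \<zeta>] by simp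
qed

text \<open>A right inverse of the derivative at \<open>x0\<close> cuts out an affine slice on which
  \<open>f\<close> becomes a local diffeomorphism; the section is the inverse of that
  restriction.\<close>

lemma smooth_local_section:
  fixes f :: "'a::euclidean_space \<Rightarrow> real^'n"
  assumes W: "open W" "x0 \<in> W" and f: "smooth_on W f" and surj: "surj (frechet_derivative f (at x0))"
  obtains V \<sigma> where "open V" "f x0 \<in> V" "smooth_on V \<sigma>" "\<sigma> ` V \<subseteq> W" "\<sigma> (f x0) = x0"
    "\<And>y. y \<in> V \<Longrightarrow> f (\<sigma> y) = y"
proof -
  let ?D = "\<lambda>x. frechet_derivative f (at x)"
  have D: "(f has_derivative ?D x) (at x)" if "x \<in> W" for x
    using smooth_on_has_derivative[OF f that] .
  obtain s where s: "linear s" "?D x0 \<circ> s = id"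
    using linear_surjective_right_inverse[OF has_derivative_linear[OF D[OF W(2)]] surj] by blast
  have bs: "bounded_linear s" using s(1) by (simp add: linear_conv_bounded_linear)
  \<comment> \<open>\<open>T\<close> parametrizes the slice; since \<open>s\<close> is a right
    inverse of the derivative, \<open>f \<circ> T\<close> has the identity as derivative at
    0.\<close>
  define T where "T y = x0 + s y" for y
  define U where "U = T -` W"
  have sT: "smooth_on S T" if "open S" for S
    unfolding smooth_on_def T_def by (intro allI Ck_on_add Ck_on_const Ck_on_linear that bs)
  have dT: "(T has_derivative s) (at y)" for y
    unfolding T_def using bs by (auto intro!: derivative_eq_intros bounded_linear_imp_has_derivative)
  have U: "open U" "0 \<in> U" "T 0 = x0" "T ` U \<subseteq> W"
    unfolding U_def T_def using W continuous_on_add[OF continuous_on_const linear_continuous_on[OF bs]]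
      linear_0[OF s(1)] by (auto intro!: open_vimage)
  define \<psi> where "\<psi> y = f (T y)" for y
  define \<psi>' where "\<psi>' y = Blinfun (\<lambda>v. ?D (T y) (s v))" for y
  have bl: "bounded_linear (\<lambda>v. ?D (T y) (s v))" if "y \<in> U" for y
    using bounded_linear_compose[OF has_derivative_bounded_linear[OF D] bs] that U_def by auto
  have ap: "blinfun_apply (\<psi>' y) v = ?D (T y) (s v)" if "y \<in> U" for y v
    unfolding \<psi>'_def using bounded_linear_Blinfun_apply[OF bl[OF that]] by simp
  have sm: "smooth_on U (\<lambda>y. blinfun_apply (\<psi>' y) v)" for v
  proof -
    have "smooth_on U (\<lambda>y. ?D (T y) (s v))"
      by (rule smooth_on_compose[OF U(1) W(1) U(4) smooth_on_frechet[OF f] sT[OF U(1)]])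
    then show ?thesis by (rule smooth_on_cong[OF U(1), rotated]) (simp add: ap)
  qed
  have "\<exists>V g g' U'. open U' \<and> U' \<subseteq> U \<and> 0 \<in> U' \<and> open V \<and> \<psi> 0 \<in> V \<and> homeomorphism U' V \<psi> g \<and>
     (\<forall>y\<in>V. (g has_derivative (g' y)) (at y)) \<and> (\<forall>y\<in>V. g' y = inv (blinfun_apply (\<psi>' (g y)))) \<and>
     (\<forall>y\<in>V. bij (blinfun_apply (\<psi>' (g y))))"
  proof (rule inverse_function_theorem[of U \<psi> \<psi>' 0 id_blinfun])
    show "(\<psi> has_derivative blinfun_apply (\<psi>' y)) (at y)" if "y \<in> U" for y
    proof -
      have "T y \<in> W" using that U_def by auto
      from diff_chain_at[OF dT D[OF this]] show ?thesis
        unfolding \<psi>_def ext[OF ap[OF that]] by (simp add: o_def)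
    qed
    show "continuous_on U \<psi>'"
      by (rule continuous_on_blinfun_componentwise) (rule smooth_on_continuous[OF sm])
    show "id_blinfun o\<^sub>L \<psi>' 0 = id_blinfun"
      using s(2) U by (auto intro!: blinfun_eqI simp: ap o_def fun_eq_iff)
  qed (use U in blast)+
  then obtain V g g' U' where g: "open U'" "U' \<subseteq> U" "0 \<in> U'" "open V" "\<psi> 0 \<in> V" "homeomorphism U' V \<psi> g"
     "\<And>y. y \<in> V \<Longrightarrow> (g has_derivative (g' y)) (at y)" "\<And>y. y \<in> V \<Longrightarrow> g' y = inv (blinfun_apply (\<psi>' (g y)))"
     "\<And>y. y \<in> V \<Longrightarrow> bij (blinfun_apply (\<psi>' (g y)))" by blast
  have gU: "g ` V \<subseteq> U" using g(2,6) by (auto simp: homeomorphism_def)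
  \<comment> \<open>Bootstrapping: \<open>g' y v\<close> solves a linear equation whose coefficients
    are a smooth function of \<open>g y\<close>, so each order of regularity of \<open>g\<close>
    passes to \<open>g'\<close>, which is one order more for \<open>g\<close>.\<close>
  have Cg: "Ck_on k V g" for k
  proof (induction k)
    case 0 then show ?case using g(6) by (simp add: homeomorphism_def)
  next
    case (Suc k)
    show ?case
    proof (rule Ck_on_SucI[OF g(4,7)])
      fix v
      show "Ck_on k V (\<lambda>y. g' y v)"
      proof (rule Ck_on_solve[OF g(4), of k "\<lambda>y. blinfun_apply (\<psi>' (g y))" "\<lambda>_. v"])
        show "Ck_on k V (\<lambda>y. blinfun_apply (\<psi>' (g y)) u)" for u
          by (rule Ck_on_compose[OF g(4) U(1) gU _ Suc]) (use sm in \<open>simp add: smooth_on_def\<close>)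
        show "linear (blinfun_apply (\<psi>' (g y)))" for y
          by (simp add: blinfun.bounded_linear_right bounded_linear.linear)
        show "inj (blinfun_apply (\<psi>' (g y)))" if "y \<in> V" for y using g(9)[OF that] by (rule bij_is_inj)
        show "Ck_on k V (\<lambda>_. v)" by (rule Ck_on_const[OF g(4)])
        show "blinfun_apply (\<psi>' (g y)) (g' y v) = v" if "y \<in> V" for y
          using surj_f_inv_f[OF bij_is_surj[OF g(9)[OF that]]] g(8)[OF that] by simp
      qed
    qed
  qed
  show ?thesis
  proof (rule that[of V "\<lambda>y. T (g y)"])
    show "smooth_on V (\<lambda>y. T (g y))"
      by (rule smooth_on_compose[OF g(4) U(1) gU sT[OF U(1)]]) (use Cg smooth_on_def in blast)
    show "(\<lambda>y. T (g y)) ` V \<subseteq> W" using gU U(4) by auto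
    have "g (\<psi> 0) = 0" using g(3,6) by (simp add: homeomorphism_def)
    then show "T (g (f x0)) = x0" using U(3) by (simp add: \<psi>_def)
    show "f x0 \<in> V" using g(5) U(3) by (simp add: \<psi>_def)
    show "f (T (g y)) = y" if "y \<in> V" for y
      using g(6) that by (simp add: homeomorphism_def \<psi>_def)
  qed (use g in auto)
qed

section \<open>Derivatives in charts\<close>

text \<open>The constants \<^const>\<open>mderiv\<close>, \<^const>\<open>tangent_of\<close> and
  \<^const>\<open>components\<close> are all instances of \<open>chart_D\<close>, so that one chain rule serves all of
  them.\<close>

definition chart_D where
  "chart_D c d f p = frechet_derivative (snd d \<circ> f \<circ> chart_inv c) (at (snd c p))"

lemma chart_inv_left: "is_chart c \<Longrightarrow> p \<in> fst c \<Longrightarrow> chart_inv c (snd c p) = p"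
  unfolding is_chart_def homeomorphism_def by blast

lemma chart_inv_right: "x \<in> snd c ` fst c \<Longrightarrow> snd c (chart_inv c x) = x"
  unfolding chart_inv_def by (rule f_inv_into_f)

lemma chart_inv_mem: "x \<in> snd c ` fst c \<Longrightarrow> chart_inv c x \<in> fst c"
  unfolding chart_inv_def by (rule inv_into_into)

lemma chart_open_image:
  assumes c: "is_chart c" and U: "open U" "U \<subseteq> fst c"
  shows "open (snd c ` U)"
proof -
  have eq: "snd c ` U = (snd c ` fst c) \<inter> chart_inv c -` U"
    using U(2) chart_inv_left[OF c] chart_inv_right[of _ c] by (auto simp: image_iff)
  have "continuous_on (snd c ` fst c) (chart_inv c)" "open (snd c ` fst c)"
    using c unfolding is_chart_def homeomorphism_def by auto
  then show ?thesis unfolding eq using U(1) continuous_open_preimage by blast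
qed

lemma chart_at_mem: "p \<in> points A \<Longrightarrow> chart_at A p \<in> A" "p \<in> points A \<Longrightarrow> p \<in> fst (chart_at A p)"
  unfolding chart_at_def points_def by (metis (mono_tags, lifting) UN_E someI_ex)+

lemma flat_atlas_simps [simp]:
  "points (flat_atlas S) = S" "p \<in> S \<Longrightarrow> chart_at (flat_atlas S) p = (S, \<lambda>x. x)"
  "x \<in> S \<Longrightarrow> chart_inv (S, \<lambda>x. x) x = x"
  unfolding points_def flat_atlas_def chart_at_def chart_inv_def by (auto intro: inv_into_f_eq)

lemma smooth_on_ident: "open S \<Longrightarrow> smooth_on S (\<lambda>x. x)"
  unfolding smooth_on_def by (simp add: Ck_on_id)

lemma smooth_manifold_flat_atlas:
  fixes S :: "'a::euclidean_space set"
  assumes "open S" shows "smooth_manifold S (flat_atlas S)"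
proof -
  have "homeomorphism S S (\<lambda>x. x) (chart_inv (S, \<lambda>x. x))"
    by (rule homeomorphism_cong[OF homeomorphism_ident]) auto
  then have "is_chart (S, \<lambda>x. x)" using assms by (simp add: is_chart_def)
  moreover have "smooth_on S ((\<lambda>x. x) \<circ> chart_inv (S, \<lambda>x. x))"
    by (rule smooth_on_cong[OF assms _ smooth_on_ident[OF assms]]) auto
  ultimately show ?thesis
    unfolding smooth_manifold_def flat_atlas_simps(1) by (auto simp: flat_atlas_def)
qed

lemma manifold_chart: "smooth_manifold M A \<Longrightarrow> c \<in> A \<Longrightarrow> is_chart c"
  unfolding smooth_manifold_def by blast

lemma chart_open: "is_chart c \<Longrightarrow> open (fst c)" "is_chart c \<Longrightarrow> open (snd c ` fst c)"
  unfolding is_chart_def by auto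

lemma smooth_map_rep:
  assumes A: "smooth_manifold M A" and B: "smooth_manifold M' B" and f: "smooth_map A B f"
    and c: "c \<in> A" and d: "d \<in> B"
  shows "open (snd c ` (fst c \<inter> f -` fst d))"
    and "smooth_on (snd c ` (fst c \<inter> f -` fst d)) (snd d \<circ> f \<circ> chart_inv c)"
proof -
  note cc = manifold_chart[OF A c] and dd = manifold_chart[OF B d]
  have "continuous_on (fst c) f"
    by (rule continuous_on_subset[of "points A"]) (use f c in \<open>auto simp: smooth_map_def points_def\<close>)
  then have "open (fst c \<inter> f -` fst d)"
    using continuous_open_preimage chart_open(1)[OF cc] chart_open(1)[OF dd] by blast
  then show "open (snd c ` (fst c \<inter> f -` fst d))"
    by (rule chart_open_image[OF cc]) auto
  show "smooth_on (snd c ` (fst c \<inter> f -` fst d)) (snd d \<circ> f \<circ> chart_inv c)"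
    using f c d by (simp add: smooth_map_def)
qed

lemma smooth_map_ident: "smooth_manifold M A \<Longrightarrow> smooth_map A A (\<lambda>x. x)"
  unfolding smooth_map_def smooth_manifold_def by (auto simp: o_def vimage_def)

lemma chart_D_works:
  assumes A: "smooth_manifold M A" and B: "smooth_manifold M' B" and f: "smooth_map A B f"
    and c: "c \<in> A" "p \<in> fst c" and d: "d \<in> B" "f p \<in> fst d"
  shows "(snd d \<circ> f \<circ> chart_inv c has_derivative chart_D c d f p) (at (snd c p))"
  unfolding chart_D_def
  by (rule smooth_on_has_derivative[OF smooth_map_rep(2)[OF A B f c(1) d(1)]]) (use c d in auto)

lemma chart_D_linear:
  assumes A: "smooth_manifold M A" and B: "smooth_manifold M' B" and f: "smooth_map A B f"
    and c: "c \<in> A" "p \<in> fst c" and d: "d \<in> B" "f p \<in> fst d"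
  shows "linear (chart_D c d f p)"
  using has_derivative_linear[OF chart_D_works[OF assms]] .

lemma chart_D_compose:
  assumes A: "smooth_manifold M A" and B: "smooth_manifold M' B" and C: "smooth_manifold M'' C"
    and f: "smooth_map A B f" and g: "smooth_map B C g"
    and c: "c \<in> A" "p \<in> fst c" and d: "d \<in> B" "f p \<in> fst d" and e: "e \<in> C" "g (f p) \<in> fst e"
    and h: "\<And>q. q \<in> fst c \<Longrightarrow> h q = g (f q)"
  shows "chart_D c e h p u = chart_D d e g (f p) (chart_D c d f p u)"
proof -
  note cc = manifold_chart[OF A c(1)] and dd = manifold_chart[OF B d(1)]
  let ?F = "snd d \<circ> f \<circ> chart_inv c" and ?G = "snd e \<circ> g \<circ> chart_inv d"
  have Fp: "?F (snd c p) = snd d (f p)" using chart_inv_left[OF cc c(2)] by simp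
  have "(?G \<circ> ?F has_derivative chart_D d e g (f p) \<circ> chart_D c d f p) (at (snd c p))"
    by (rule diff_chain_at[OF chart_D_works[OF A B f c d]]) (simp only: Fp chart_D_works[OF B C g d e])
  then have "(snd e \<circ> h \<circ> chart_inv c has_derivative chart_D d e g (f p) \<circ> chart_D c d f p) (at (snd c p))"
  proof (rule has_derivative_transform_within_open[OF _ smooth_map_rep(1)[OF A B f c(1) d(1)]])
    show "snd c p \<in> snd c ` (fst c \<inter> f -` fst d)" using c d by auto
    fix x assume "x \<in> snd c ` (fst c \<inter> f -` fst d)"
    then obtain q where "q \<in> fst c" "f q \<in> fst d" "x = snd c q" by auto
    then show "(?G \<circ> ?F) x = (snd e \<circ> h \<circ> chart_inv c) x"
      using chart_inv_left[OF cc] chart_inv_left[OF dd] h by simp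
  qed
  from frechet_derivative_at[OF this] show ?thesis unfolding chart_D_def by (metis comp_apply)
qed

lemma chart_D_ident:
  assumes A: "smooth_manifold M A" and c: "c \<in> A" "p \<in> fst c"
  shows "chart_D c c (\<lambda>x. x) p u = u"
proof -
  note cc = manifold_chart[OF A c(1)]
  have "frechet_derivative (snd c \<circ> (\<lambda>x. x) \<circ> chart_inv c) (at (snd c p)) = frechet_derivative (\<lambda>x. x) (at (snd c p))"
    by (rule frechet_derivative_cong_open[OF chart_open(2)[OF cc]])
      (use c chart_inv_right[of _ c] in auto)
  then show ?thesis unfolding chart_D_def by simp
qed

lemma mderiv_eq: "mderiv A B f p = chart_D (chart_at A p) (chart_at B (f p)) f p"
  unfolding mderiv_def chart_D_def ..

lemma tangent_of_eq: "tangent_of A c p = chart_D c (chart_at A p) (\<lambda>x. x) p"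
  unfolding tangent_of_def chart_D_def by (simp add: o_def)

lemma components_eq: "components A c p = chart_D (chart_at A p) c (\<lambda>x. x) p"
  unfolding components_def chart_D_def by (simp add: o_def)

lemma smooth_manifold_points: "smooth_manifold M A \<Longrightarrow> points A = M"
  unfolding smooth_manifold_def by simp

context
  fixes A :: "('p::{t2_space,second_countable_topology}, 'e::euclidean_space) chart set" and M
  assumes A: "smooth_manifold M A"
begin

lemma chart_mem_points: "c \<in> A \<Longrightarrow> p \<in> fst c \<Longrightarrow> p \<in> M"
  using smooth_manifold_points[OF A] unfolding points_def by blast

lemma preferred_chart: "p \<in> M \<Longrightarrow> chart_at A p \<in> A" "p \<in> M \<Longrightarrow> p \<in> fst (chart_at A p)"
  using chart_at_mem smooth_manifold_points[OF A] by auto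

lemma tangent_of_components:
  assumes "c \<in> A" "p \<in> fst c"
  shows "tangent_of A c p (components A c p u) = u"
proof -
  note p = preferred_chart[OF chart_mem_points[OF assms]]
  show ?thesis unfolding tangent_of_eq components_eq
    using chart_D_compose[OF A A A smooth_map_ident[OF A] smooth_map_ident[OF A] p assms p, of "\<lambda>x. x" u]
      chart_D_ident[OF A p] by simp
qed

lemma components_tangent_of:
  assumes "c \<in> A" "p \<in> fst c"
  shows "components A c p (tangent_of A c p u) = u"
proof -
  note p = preferred_chart[OF chart_mem_points[OF assms]]
  show ?thesis unfolding tangent_of_eq components_eq
    using chart_D_compose[OF A A A smooth_map_ident[OF A] smooth_map_ident[OF A] assms p assms, of "\<lambda>x. x" u]
      chart_D_ident[OF A assms] by simp
qed

lemma linear_tangent_of: "c \<in> A \<Longrightarrow> p \<in> fst c \<Longrightarrow> linear (tangent_of A c p)"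
  unfolding tangent_of_eq
  by (rule chart_D_linear[OF A A smooth_map_ident[OF A]]) (use preferred_chart chart_mem_points in auto)

lemma linear_components: "c \<in> A \<Longrightarrow> p \<in> fst c \<Longrightarrow> linear (components A c p)"
  unfolding components_eq
  by (rule chart_D_linear[OF A A smooth_map_ident[OF A]]) (use preferred_chart chart_mem_points in auto)

lemma tangent_of_preferred: "p \<in> M \<Longrightarrow> tangent_of A (chart_at A p) p u = u"
  unfolding tangent_of_eq using chart_D_ident[OF A preferred_chart] by auto

lemma components_preferred: "p \<in> M \<Longrightarrow> components A (chart_at A p) p u = u"
  unfolding components_eq using chart_D_ident[OF A preferred_chart] by auto

end

lemma smooth_map_mem: "smooth_manifold M A \<Longrightarrow> smooth_manifold M' B \<Longrightarrow> smooth_map A B f \<Longrightarrow> p \<in> M \<Longrightarrow> f p \<in> M'"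
  unfolding smooth_map_def by (auto simp: smooth_manifold_points)

lemma linear_mderiv:
  assumes A: "smooth_manifold M A" and B: "smooth_manifold M' B" and f: "smooth_map A B f" and p: "p \<in> M"
  shows "linear (mderiv A B f p)"
  unfolding mderiv_eq
  by (rule chart_D_linear[OF A B f preferred_chart[OF A p] preferred_chart[OF B smooth_map_mem[OF A B f p]]])

text \<open>The composite is a separate function \<open>h\<close>, so that pointwise identities such
  as invariance of a projection along a flow can be supplied directly as the last premise.\<close>

lemma mderiv_compose:
  assumes A: "smooth_manifold M A" and B: "smooth_manifold M' B" and C: "smooth_manifold M'' C"
    and f: "smooth_map A B f" and g: "smooth_map B C g" and p: "p \<in> M" and h: "\<And>q. q \<in> M \<Longrightarrow> h q = g (f q)"
  shows "mderiv A C h p u = mderiv B C g (f p) (mderiv A B f p u)"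
proof -
  have "h p = g (f p)" using h p by blast
  then show ?thesis unfolding mderiv_eq
    using chart_D_compose[OF A B C f g preferred_chart[OF A p] preferred_chart[OF B smooth_map_mem[OF A B f p]]
      preferred_chart[OF C smooth_map_mem[OF B C g smooth_map_mem[OF A B f p]]], of h u] h
      chart_mem_points[OF A preferred_chart(1)[OF A p]] by simp
qed

text \<open>Naturality of the identification of components with tangent vectors. It lets a
  computation run in arbitrary charts of source and target and still conclude about
  \<open>mderiv\<close>, which uses preferred ones.\<close>

lemma tangent_of_chart_D:
  assumes A: "smooth_manifold M A" and B: "smooth_manifold M' B" and f: "smooth_map A B f"
    and c: "c \<in> A" "p \<in> fst c" and d: "d \<in> B" "f p \<in> fst d"
  shows "tangent_of B d (f p) (chart_D c d f p u) = mderiv A B f p (tangent_of A c p u)"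
proof -
  have p: "p \<in> M" by (rule chart_mem_points[OF A c])
  note fp = preferred_chart[OF B smooth_map_mem[OF A B f p]]
  have "tangent_of B d (f p) (chart_D c d f p u) = chart_D c (chart_at B (f p)) f p u"
    unfolding tangent_of_eq
    by (rule chart_D_compose[OF A B B f smooth_map_ident[OF B] c d fp, symmetric]) simp
  also have "\<dots> = mderiv A B f p (tangent_of A c p u)"
    unfolding tangent_of_eq mderiv_eq
    by (rule chart_D_compose[OF A A B smooth_map_ident[OF A] f c preferred_chart[OF A p] fp]) simp
  finally show ?thesis .
qed

lemma chart_D_eq:
  assumes A: "smooth_manifold M A" and B: "smooth_manifold M' B" and f: "smooth_map A B f"
    and c: "c \<in> A" "p \<in> fst c" and d: "d \<in> B" "f p \<in> fst d"
  shows "chart_D c d f p u = components B d (f p) (mderiv A B f p (tangent_of A c p u))"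
  using tangent_of_chart_D[OF assms, of u] components_tangent_of[OF B d] by metis

lemma mderiv_ident:
  "smooth_manifold M A \<Longrightarrow> p \<in> M \<Longrightarrow> mderiv A A (\<lambda>x. x) p u = u"
  unfolding mderiv_eq by (rule chart_D_ident) (auto intro: preferred_chart)

section \<open>Flows in charts\<close>

lemma points_real_times: "points (real_times A) = UNIV \<times> points A"
proof -
  have "real_times A = (\<lambda>c. (UNIV \<times> fst c, \<lambda>(t, p). (t, snd c p))) ` A"
    unfolding real_times_def by blast
  then show ?thesis unfolding points_def by auto
qed

text \<open>Smoothness with respect to the atlas \<open>real_times A\<close> becomes joint
  smoothness of an ordinary function on an open set of pairs of time and coordinates. Joint
  dependence is essential later, where a one-form is pulled back along the flow and differentiated
  in both variables.\<close>

lemma flow_rep: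
  assumes A: "smooth_manifold UNIV A" and F: "smooth_flow A \<Phi>" and c: "c \<in> A" and d: "d \<in> A"
  defines "S \<equiv> {(t, x). x \<in> snd c ` fst c \<and> \<Phi> t (chart_inv c x) \<in> fst d}"
  shows "open S" and "smooth_on S (\<lambda>(t, x). snd d (\<Phi> t (chart_inv c x)))"
proof -
  let ?F = "\<lambda>(t, p). \<Phi> t p" and ?c = "(UNIV \<times> fst c, \<lambda>(t, p). (t :: real, snd c p))"
  note cc = manifold_chart[OF A c] and dd = manifold_chart[OF A d]
  have F: "smooth_map (real_times A) A ?F" using F by (simp add: smooth_flow_def)
  have "points (real_times A) = UNIV"
    using smooth_manifold_points[OF A] points_real_times[of A] by simp_all
  then have cont: "continuous_on UNIV ?F" using F by (simp add: smooth_map_def)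
  have "continuous_on (UNIV \<times> snd c ` fst c) (\<lambda>x. ?F (fst x, chart_inv c (snd x)))"
  proof (rule continuous_on_compose2[OF cont])
    show "continuous_on (UNIV \<times> snd c ` fst c) (\<lambda>x. (fst x, chart_inv c (snd x)))"
    proof (intro continuous_on_Pair continuous_on_fst continuous_on_id)
      have "continuous_on (snd c ` fst c) (chart_inv c)"
        using cc by (simp add: is_chart_def homeomorphism_def)
      then show "continuous_on (UNIV \<times> snd c ` fst c) (\<lambda>x. chart_inv c (snd x))"
        by (rule continuous_on_compose2[OF _ continuous_on_snd[OF continuous_on_id]]) auto
    qed
  qed auto
  moreover have S: "S = (UNIV \<times> snd c ` fst c) \<inter> (\<lambda>x. ?F (fst x, chart_inv c (snd x))) -` fst d"
    unfolding S_def by auto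
  ultimately show "open S"
    unfolding S using chart_open(1)[OF dd] chart_open(2)[OF cc]
    by (intro continuous_open_preimage open_Times) auto
  have inv: "chart_inv ?c (t, x) = (t, chart_inv c x)" if "x \<in> snd c ` fst c" for t x
    unfolding chart_inv_def[of ?c]
  proof (rule inv_into_f_eq)
    show "inj_on (snd ?c) (fst ?c)"
      using inj_on_inverseI[of "fst c" "chart_inv c" "snd c", OF chart_inv_left[OF cc]]
      by (simp add: inj_on_def)
  qed (use that chart_inv_mem[of x c] chart_inv_right[of x c] in auto)
  have "S = snd ?c ` (fst ?c \<inter> ?F -` fst d)"
  proof (rule set_eqI, clarify)
    fix t x
    show "(t, x) \<in> S \<longleftrightarrow> (t, x) \<in> snd ?c ` (fst ?c \<inter> ?F -` fst d)"
    proof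
      assume x: "(t, x) \<in> S"
      then have "(t, x) = snd ?c (t, chart_inv c x)"
        unfolding S_def by (simp add: chart_inv_right)
      moreover have "(t, chart_inv c x) \<in> fst ?c \<inter> ?F -` fst d"
        using x unfolding S_def by (simp add: chart_inv_mem)
      ultimately show "(t, x) \<in> snd ?c ` (fst ?c \<inter> ?F -` fst d)" by (rule image_eqI)
    qed (auto simp: S_def chart_inv_left[OF cc])
  qed
  moreover have "smooth_on (snd ?c ` (fst ?c \<inter> ?F -` fst d)) (snd d \<circ> ?F \<circ> chart_inv ?c)"
  proof -
    have "?c \<in> real_times A" using c unfolding real_times_def by blast
    from F[unfolded smooth_map_def, THEN conjunct2, THEN conjunct2, THEN bspec, OF this, THEN bspec, OF d]
    show ?thesis by simp
  qed
  ultimately have "smooth_on S (snd d \<circ> ?F \<circ> chart_inv ?c)" by simp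
  then show "smooth_on S (\<lambda>(t, x). snd d (\<Phi> t (chart_inv c x)))"
    by (rule smooth_on_cong[OF \<open>open S\<close>, rotated]) (auto simp: S_def inv)
qed

lemma flow_smooth_map:
  assumes A: "smooth_manifold UNIV A" and F: "smooth_flow A \<Phi>"
  shows "smooth_map A A (\<Phi> t)"
  unfolding smooth_map_def
proof (intro conjI ballI)
  have pts: "points A = UNIV" "points (real_times A) = UNIV"
    using smooth_manifold_points[OF A] points_real_times[of A] by simp_all
  show "\<Phi> t ` points A \<subseteq> points A" using pts by simp
  have "continuous_on UNIV (\<lambda>(t, p). \<Phi> t p)"
    using F pts by (simp add: smooth_flow_def smooth_map_def)
  from continuous_on_compose2[OF this, of UNIV "\<lambda>p. (t, p)"]
  have cont: "continuous_on UNIV (\<Phi> t)" by (simp add: continuous_on_Pair)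
  then show "continuous_on (points A) (\<Phi> t)" using pts by simp
  fix c d assume cd: "c \<in> A" "d \<in> A"
  note cc = manifold_chart[OF A cd(1)] and dd = manifold_chart[OF A cd(2)]
  have "open (fst c \<inter> \<Phi> t -` fst d)"
    using continuous_open_preimage[OF continuous_on_subset[OF cont]] chart_open(1)[OF cc] chart_open(1)[OF dd] by blast
  then have op: "open (snd c ` (fst c \<inter> \<Phi> t -` fst d))"
    by (rule chart_open_image[OF cc]) auto
  have "smooth_on (snd c ` (fst c \<inter> \<Phi> t -` fst d)) (\<lambda>x. (\<lambda>(t, x). snd d (\<Phi> t (chart_inv c x))) (t, x))"
    by (rule smooth_on_compose[OF op flow_rep(1)[OF A F cd] _ flow_rep(2)[OF A F cd]])
       (use op chart_inv_left[OF cc] in \<open>auto simp: smooth_on_def intro!: Ck_on_Pair Ck_on_const Ck_on_id\<close>)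
  then show "smooth_on (snd c ` (fst c \<inter> \<Phi> t -` fst d)) (snd d \<circ> \<Phi> t \<circ> chart_inv c)"
    by (simp add: o_def)
qed

section \<open>Adapted bases of complex structures\<close>

lemma sum_UNIV_Plus:
  fixes f :: "'a::finite + 'b::finite \<Rightarrow> 'c::comm_monoid_add"
  shows "(\<Sum>k\<in>UNIV. f k) = (\<Sum>i\<in>UNIV. f (Inl i)) + (\<Sum>i\<in>UNIV. f (Inr i))"
  by (simp add: UNIV_Plus_UNIV[symmetric] sum.Plus del: UNIV_Plus_UNIV)

definition block_matrix :: "('m \<Rightarrow> 'm \<Rightarrow> 'a) \<Rightarrow> ('m \<Rightarrow> 'm \<Rightarrow> 'a) \<Rightarrow> ('m \<Rightarrow> 'm \<Rightarrow> 'a) \<Rightarrow> ('m \<Rightarrow> 'm \<Rightarrow> 'a) \<Rightarrow> 'a^('m::finite + 'm)^('m + 'm)" where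
  "block_matrix a b c d = (\<chi> i j. case i of
     Inl i \<Rightarrow> (case j of Inl j \<Rightarrow> a i j | Inr j \<Rightarrow> b i j)
   | Inr i \<Rightarrow> (case j of Inl j \<Rightarrow> c i j | Inr j \<Rightarrow> d i j))"

lemma block_matrix_nth [simp]:
  "block_matrix a b c d $ Inl i $ Inl j = a i j" "block_matrix a b c d $ Inl i $ Inr j = b i j"
  "block_matrix a b c d $ Inr i $ Inl j = c i j" "block_matrix a b c d $ Inr i $ Inr j = d i j"
  by (simp_all add: block_matrix_def)

lemma matrix_eq_blocks:
  fixes A B :: "'a^('m::finite + 'm)^('m + 'm)"
  assumes "\<And>i j. A $ Inl i $ Inl j = B $ Inl i $ Inl j" "\<And>i j. A $ Inl i $ Inr j = B $ Inl i $ Inr j"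
    "\<And>i j. A $ Inr i $ Inl j = B $ Inr i $ Inl j" "\<And>i j. A $ Inr i $ Inr j = B $ Inr i $ Inr j"
  shows "A = B"
  unfolding vec_eq_iff
proof (intro allI)
  fix i j show "A $ i $ j = B $ i $ j" by (cases i; cases j) (simp_all add: assms)
qed

lemma block_matrix_mult:
  fixes a b c d :: "'m::finite \<Rightarrow> 'm \<Rightarrow> 'a::semiring_1"
  shows "block_matrix a b c d ** block_matrix a' b' c' d' = block_matrix
    (\<lambda>i j. (\<Sum>k\<in>UNIV. a i k * a' k j) + (\<Sum>k\<in>UNIV. b i k * c' k j))
    (\<lambda>i j. (\<Sum>k\<in>UNIV. a i k * b' k j) + (\<Sum>k\<in>UNIV. b i k * d' k j))
    (\<lambda>i j. (\<Sum>k\<in>UNIV. c i k * a' k j) + (\<Sum>k\<in>UNIV. d i k * c' k j))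
    (\<lambda>i j. (\<Sum>k\<in>UNIV. c i k * b' k j) + (\<Sum>k\<in>UNIV. d i k * d' k j))"
  by (rule matrix_eq_blocks) (simp_all add: matrix_matrix_mult_def sum_UNIV_Plus)

definition scalar_entries :: "'a \<Rightarrow> 'm \<Rightarrow> 'm \<Rightarrow> 'a::zero" where
  "scalar_entries x i j = (if i = j then x else 0)"

lemma sum_scalar_entries [simp]:
  fixes f :: "'m::finite \<Rightarrow> 'a::semiring_1"
  shows "(\<Sum>k\<in>UNIV. scalar_entries x i k * f k) = x * f i" "(\<Sum>k\<in>UNIV. f k * scalar_entries x k j) = f j * x"
  by (simp_all add: scalar_entries_def if_distrib if_distribR sum.delta sum.delta' cong: if_cong)

lemma block_matrix_one: "block_matrix (scalar_entries 1) (\<lambda>_ _. 0) (\<lambda>_ _. 0) (scalar_entries 1) = (mat 1 :: 'a::semiring_1^('m::finite+'m)^('m+'m))"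
  by (rule matrix_eq_blocks) (simp_all add: mat_def scalar_entries_def)

text \<open>The same permutation is applied to rows and to columns, so its sign enters
  squared.\<close>

lemma det_block_diag_swap:
  fixes a d :: "'m::finite \<Rightarrow> 'm \<Rightarrow> 'a::comm_ring_1"
  shows "det (block_matrix a (\<lambda>_ _. 0) (\<lambda>_ _. 0) d) = det (block_matrix d (\<lambda>_ _. 0) (\<lambda>_ _. 0) a)"
proof -
  define p :: "'m + 'm \<Rightarrow> 'm + 'm" where "p = case_sum Inr Inl"
  have "p \<circ> p = id" by (auto simp: p_def fun_eq_iff split: sum.split)
  then have "bij p" using o_bij by blast
  then have p: "p permutes UNIV" by (intro bij_imp_permutes) auto
  let ?A = "block_matrix a (\<lambda>_ _. 0) (\<lambda>_ _. 0) d"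
  let ?B = "\<chi> i. ?A $ p i"
  have "det (\<chi> i j. ?B $ i $ p j) = of_int (sign p) * (of_int (sign p) * det ?A)"
    using det_permute_columns[OF p, of ?B] det_permute_rows[OF p, of ?A] by simp
  moreover have "(\<chi> i j. ?B $ i $ p j) = block_matrix d (\<lambda>_ _. 0) (\<lambda>_ _. 0) a"
    by (rule matrix_eq_blocks) (simp_all add: p_def)
  moreover have "of_int (sign p) * (of_int (sign p) * det ?A) = det ?A"
    by (simp add: mult.assoc[symmetric] of_int_mult[symmetric] sign_idempotent del: of_int_mult)
  ultimately show ?thesis by simp
qed

lemma det_cnj: "det (\<chi> i j. cnj (M $ i $ j)) = cnj (det (M :: complex^'m^'m))"
  by (simp add: det_def)

lemma det_of_real: "det (\<chi> i j. complex_of_real (M $ i $ j)) = of_real (det (M :: real^'m^'m))"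
  by (simp add: det_def)

text \<open>Over the complex numbers the matrix is conjugate to the block diagonal matrix with blocks
  \<open>a + \<i>b\<close> and \<open>a - \<i>b\<close>.\<close>

lemma det_complex_block_nonneg:
  fixes a b :: "'m::finite \<Rightarrow> 'm \<Rightarrow> real"
  shows "det (block_matrix a b (\<lambda>i j. - b i j) a) \<ge> 0"
proof -
  define C where "C i j = complex_of_real (a i j) + \<i> * of_real (b i j)" for i j
  let ?z = "\<lambda>_ _. 0" and ?A = "block_matrix a b (\<lambda>i j. - b i j) a"
  define A' where "A' = (\<chi> i j. complex_of_real (?A $ i $ j))"
  \<comment> \<open>The block columns \<open>(1, \<i>)\<close> and \<open>(1, -\<i>)\<close> of
    \<open>U\<close> are mapped by \<open>A'\<close> to their multiples by \<open>C\<close> and by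
    its conjugate; \<open>W\<close> is the inverse of \<open>U\<close>.\<close>
  define U :: "complex^('m+'m)^('m+'m)" where "U = block_matrix (scalar_entries 1) (scalar_entries 1) (scalar_entries \<i>) (scalar_entries (- \<i>))"
  define W :: "complex^('m+'m)^('m+'m)" where "W = block_matrix (scalar_entries (1/2)) (scalar_entries (-\<i>/2)) (scalar_entries (1/2)) (scalar_entries (\<i>/2))"
  have A'_block: "A' = block_matrix (\<lambda>i j. of_real (a i j)) (\<lambda>i j. of_real (b i j)) (\<lambda>i j. - of_real (b i j)) (\<lambda>i j. of_real (a i j))"
    unfolding A'_def by (rule matrix_eq_blocks) simp_all
  have "U ** W = mat 1"
    unfolding U_def W_def block_matrix_mult block_matrix_one[symmetric]
    by (rule matrix_eq_blocks) (simp_all, simp_all add: scalar_entries_def)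
  then have "det U * det W = 1" by (metis det_I det_mul)
  then have U0: "det U \<noteq> 0" by auto
  have "A' ** U = U ** block_matrix C ?z ?z (\<lambda>i j. cnj (C i j))"
    unfolding A'_block U_def block_matrix_mult
    by (rule matrix_eq_blocks) (simp_all add: sum_negf, simp_all add: C_def algebra_simps)
  then have "det A' = det (block_matrix C ?z ?z (\<lambda>i j. cnj (C i j)))"
    using U0 by (metis det_mul mult.commute mult_cancel_left)
  \<comment> \<open>Splitting off one block at a time avoids a formula for the determinant of a
    single block: after the swap the second factor is the entrywise conjugate of the first, and the
    product is a squared modulus.\<close>
  also have "block_matrix C ?z ?z (\<lambda>i j. cnj (C i j)) = block_matrix C ?z ?z (scalar_entries 1) ** block_matrix (scalar_entries 1) ?z ?z (\<lambda>i j. cnj (C i j))"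
    unfolding block_matrix_mult by (rule matrix_eq_blocks) simp_all
  also have "det \<dots> = det (block_matrix C ?z ?z (scalar_entries 1)) * det (block_matrix (\<lambda>i j. cnj (C i j)) ?z ?z (scalar_entries 1))"
    by (simp add: det_mul det_block_diag_swap[of "scalar_entries 1"])
  also have "block_matrix (\<lambda>i j. cnj (C i j)) ?z ?z (scalar_entries 1) = (\<chi> i j. cnj (block_matrix C ?z ?z (scalar_entries 1) $ i $ j))"
    by (rule matrix_eq_blocks) (simp_all add: scalar_entries_def)
  also have "det (block_matrix C ?z ?z (scalar_entries 1)) * det \<dots> = of_real ((cmod (det (block_matrix C ?z ?z (scalar_entries 1))))\<^sup>2)"
    unfolding det_cnj by (rule complex_norm_square[symmetric])
  finally have "of_real (det ?A) = complex_of_real ((cmod (det (block_matrix C ?z ?z (scalar_entries 1))))\<^sup>2)"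
    unfolding A'_def det_of_real .
  then show ?thesis unfolding of_real_eq_iff by simp
qed

text \<open>The transition between two adapted bases commutes with \<open>J\<close>, so it has the
  form of a complex matrix written in real blocks, whose determinant is nonnegative. Zero occurs
  when one of the families is not a basis.\<close>

lemma adapted_basis_det_mult_nonneg:
  fixes J :: "real^('m::finite + 'm) \<Rightarrow> real^('m + 'm)"
  assumes J: "linear J" "\<And>u. J (J u) = - u"
  shows "adapted_basis_det J e * adapted_basis_det J e' \<ge> 0"
proof (cases "adapted_basis_det J e = 0")
  case False
  define E where "E e = (\<chi> i. case i of Inl j \<Rightarrow> e j | Inr j \<Rightarrow> J (e j))" for e :: "'m \<Rightarrow> real^('m + 'm)"
  have E: "adapted_basis_det J e = det (E e)" for e unfolding adapted_basis_det_def E_def ..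
  have "invertible (E e)" using False by (simp add: E invertible_det_nz)
  then obtain F where F: "F ** E e = mat 1" unfolding invertible_def by blast
  define x where "x j = e' j v* F" for j
  have "e' j = x j v* E e" for j
    unfolding x_def by (simp add: vector_matrix_mul_assoc F)
  then have e': "e' j = (\<Sum>i\<in>UNIV. (x j $ Inl i) *\<^sub>R e i) + (\<Sum>i\<in>UNIV. (x j $ Inr i) *\<^sub>R J (e i))" for j
    unfolding vec_eq_iff by (simp add: vector_matrix_mult_def sum_UNIV_Plus E_def mult.commute)
  define a where "a j i = x j $ Inl i" for j i
  define b where "b j i = x j $ Inr i" for j i
  have Je': "J (e' j) = (\<Sum>i\<in>UNIV. (- b j i) *\<^sub>R e i) + (\<Sum>i\<in>UNIV. a j i *\<^sub>R J (e i))" for j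
    unfolding e' a_def b_def
    by (simp add: linear_add[OF J(1)] linear_sum[OF J(1)] linear_scale[OF J(1)] J(2) o_def)
  have "E e' = block_matrix a b (\<lambda>i j. - b i j) a ** E e"
    unfolding vec_eq_iff
  proof (intro allI)
    fix i k
    show "E e' $ i $ k = (block_matrix a b (\<lambda>i j. - b i j) a ** E e) $ i $ k"
    proof (cases i)
      case (Inl j)
      have "E e' $ i $ k = e' j $ k" by (simp add: E_def Inl)
      then show ?thesis unfolding e'[of j]
        by (simp add: matrix_matrix_mult_def sum_UNIV_Plus E_def Inl a_def b_def)
    next
      case (Inr j)
      have "E e' $ i $ k = J (e' j) $ k" by (simp add: E_def Inr)
      then show ?thesis unfolding Je'[of j]
        by (simp add: matrix_matrix_mult_def sum_UNIV_Plus E_def Inr)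
    qed
  qed
  then have "adapted_basis_det J e' = det (block_matrix a b (\<lambda>i j. - b i j) a) * adapted_basis_det J e"
    by (simp add: E det_mul)
  then show ?thesis using det_complex_block_nonneg[of a b]
    by (simp add: mult.left_commute[of "adapted_basis_det J e"])
qed simp

section \<open>Linear algebra of the c-map\<close>

text \<open>The coordinate form of lowering an index with \<open>g_M\<close>: the signature
  contributes the sign at \<open>i0\<close>, and the complex bilinear \<open>pairing\<close>
  contributes the conjugation. Being an involution, it is also the raising map.\<close>

definition herm_dual :: "'n::finite \<Rightarrow> 'n cvec \<Rightarrow> 'n cvec" where
  "herm_dual i0 u = (\<chi> j. (if j = i0 then - cnj (u $ j) else cnj (u $ j)))"

lemma h_M_sum: "h_M i0 u v = (\<Sum>j\<in>UNIV. cnj (herm_dual i0 u $ j) * cnj (v $ j))"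
proof -
  have "(\<Sum>j\<in>UNIV. cnj (herm_dual i0 u $ j) * cnj (v $ j)) =
    cnj (herm_dual i0 u $ i0) * cnj (v $ i0) + (\<Sum>j\<in>-{i0}. cnj (herm_dual i0 u $ j) * cnj (v $ j))"
    by (simp add: sum.remove[of UNIV i0] Compl_eq_Diff_UNIV)
  also have "\<dots> = h_M i0 u v" by (simp add: h_M_def herm_dual_def)
  finally show ?thesis ..
qed

lemma g_M_pairing: "g_M i0 u v = pairing (herm_dual i0 u) v"
  unfolding g_M_def h_M_sum pairing_def by (simp add: complex_cnj_mult[symmetric] del: complex_cnj_mult)

lemma J_M_J_M [simp]: "J_M (J_M u) = - u"
  unfolding J_M_def vec_eq_iff by simp

lemma linear_J_M: "linear J_M"
  by (rule linearI) (simp_all add: J_M_def vec_eq_iff algebra_simps)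

lemma linear_herm_dual: "linear (herm_dual i0)"
  by (rule linearI) (simp_all add: herm_dual_def vec_eq_iff)

lemmas J_M_linear_simps = linear_add[OF linear_J_M] linear_diff[OF linear_J_M] linear_neg[OF linear_J_M]
  linear_scale[OF linear_J_M] linear_0[OF linear_J_M]
lemmas herm_dual_linear_simps = linear_add[OF linear_herm_dual] linear_diff[OF linear_herm_dual]
  linear_neg[OF linear_herm_dual] linear_scale[OF linear_herm_dual] linear_0[OF linear_herm_dual]

lemma herm_dual_herm_dual [simp]: "herm_dual i0 (herm_dual i0 u) = u"
  by (simp add: herm_dual_def vec_eq_iff)

lemma herm_dual_J_M: "herm_dual i0 (J_M u) = - J_M (herm_dual i0 u)"
  by (simp add: herm_dual_def J_M_def vec_eq_iff)

lemma bilinear_pairing: "bilinear pairing"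
  unfolding bilinear_def pairing_def
  by (intro conjI allI linearI) (simp_all add: sum.distrib scaleR_sum_right sum_distrib_left algebra_simps)

lemma bilinear_g_M:
  fixes i0 :: "'n::finite"
  shows "bilinear (g_M i0)"
proof -
  have "linear (\<lambda>w. pairing w y)" for y :: "'n cvec"
    by (rule bilinear_pairing[unfolded bilinear_def, THEN conjunct2, rule_format])
  from linear_compose[OF linear_herm_dual this] have "linear (\<lambda>x. pairing (herm_dual i0 x) y)" for y
    by (simp add: o_def)
  moreover have "linear (pairing (herm_dual i0 x))" for x
    by (rule bilinear_pairing[unfolded bilinear_def, THEN conjunct1, rule_format])
  ultimately show ?thesis by (simp add: bilinear_def g_M_pairing)
qed

lemma g_M_commute: "g_M i0 u v = g_M i0 v u"
proof -
  have "h_M i0 u v = cnj (h_M i0 v u)"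
    unfolding h_M_def by (simp add: mult.commute)
  then show ?thesis by (simp add: g_M_def)
qed

lemma g_M_J_M [simp]: "g_M i0 (J_M u) (J_M v) = g_M i0 u v"
  by (simp add: g_M_def h_M_def J_M_def)

lemma g_M_herm_dual [simp]: "g_M i0 (herm_dual i0 u) (herm_dual i0 v) = g_M i0 u v"
proof -
  have "h_M i0 (herm_dual i0 u) (herm_dual i0 v) = cnj (h_M i0 u v)"
    unfolding h_M_def by (auto simp: herm_dual_def intro!: sum.cong)
  then show ?thesis by (simp add: g_M_def)
qed

lemmas g_M_linear_simps = bilinear_ladd[OF bilinear_g_M] bilinear_radd[OF bilinear_g_M]
  bilinear_lmul[OF bilinear_g_M] bilinear_rmul[OF bilinear_g_M] bilinear_lneg[OF bilinear_g_M]
  bilinear_rneg[OF bilinear_g_M] bilinear_lsub[OF bilinear_g_M] bilinear_rsub[OF bilinear_g_M]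
  bilinear_lzero[OF bilinear_g_M] bilinear_rzero[OF bilinear_g_M]

lemma g_M_J_M_left: "g_M i0 (J_M u) v = - g_M i0 u (J_M v)"
  using g_M_J_M[of i0 u "J_M v"] by (simp add: g_M_linear_simps)

lemma g_M_J_M_self [simp]: "g_M i0 (J_M u) u = 0" "g_M i0 u (J_M u) = 0"
  using g_M_J_M_left[of i0 u u] g_M_commute[of i0 u "J_M u"] by simp_all

lemma covec_eqI:
  fixes w :: "'n::finite cvec"
  assumes "\<And>u. pairing w u = \<alpha> u"
  shows "covec \<alpha> = w"
  unfolding covec_def
proof (rule the_equality)
  show "\<forall>u. pairing w u = \<alpha> u" using assms by simp
  fix w' assume "\<forall>u. pairing w' u = \<alpha> u"
  then have eq: "pairing w' u = pairing w u" for u using assms by simp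
  show "w' = w"
    unfolding vec_eq_iff
  proof
    fix j
    have "pairing w' (axis j z) = Re (w' $ j * z)" for w' :: "'n cvec" and z
      by (simp add: pairing_def axis_def if_distrib sum.delta cong: if_cong)
    \<comment> \<open>Testing on the conjugate of the difference of the coefficients turns the
      real-valued pairing into a squared modulus, which detects the whole complex
      coefficient.\<close>
    with eq[of "axis j (cnj (w' $ j - w $ j))"]
    have "Re ((w' $ j - w $ j) * cnj (w' $ j - w $ j)) = 0"
      by (simp add: algebra_simps)
    then show "w' $ j = w $ j" by (metis Re_complex_of_real complex_norm_square eq_iff_diff_eq_0 norm_eq_zero power_eq_0_iff)
  qed
qed

lemma g_low_eq: "g_low i0 = herm_dual i0"
  unfolding g_low_def g_M_pairing by (rule ext, rule covec_eqI) simp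

lemma omega_low_eq: "omega_low i0 u = - J_M (herm_dual i0 u)"
  unfolding omega_low_def omega_M_def g_M_pairing by (rule covec_eqI) (simp add: herm_dual_J_M)

text \<open>\<open>herm_dual\<close> is an antilinear involution, so its product with
  \<open>J_M\<close> squares to the identity: \<open>omega_low\<close> is its own inverse.\<close>

lemma inv_omega_low_eq: "inv (omega_low i0) u = - J_M (herm_dual i0 u)"
proof -
  have "inv (omega_low i0) = omega_low i0"
    by (rule inv_unique_comp) (simp_all add: fun_eq_iff omega_low_eq herm_dual_linear_simps J_M_linear_simps herm_dual_J_M)
  then show ?thesis by (simp add: omega_low_eq)
qed

lemma inv_g_low_eq: "inv (g_low i0) = herm_dual i0"
  unfolding g_low_eq by (rule inv_unique_comp) (simp_all add: fun_eq_iff)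

lemma g_N_eq: "g_N i0 u v = g_M i0 (fst u) (fst v) + g_M i0 (snd u) (snd v)"
  unfolding g_N_def g_M_dual_def inv_g_low_eq by simp

lemma J_M_dual_eq: "J_M_dual w = J_M w"
  unfolding J_M_dual_def by (rule covec_eqI) (simp add: pairing_def J_M_def mult.left_commute mult.assoc)

lemma I_1_eq: "I_1 u = (J_M (fst u), J_M (snd u))"
  unfolding I_1_def J_M_dual_eq ..

lemma I_2_eq: "I_2 i0 u = (J_M (herm_dual i0 (snd u)), - J_M (herm_dual i0 (fst u)))"
  unfolding I_2_def omega_low_eq inv_omega_low_eq by simp

lemmas c_map_linear_simps = J_M_linear_simps herm_dual_linear_simps herm_dual_J_M

lemma linear_I_1: "linear I_1"
  by (rule linearI) (simp_all add: I_1_eq c_map_linear_simps)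

lemma linear_I_2: "linear (I_2 i0)"
  by (rule linearI) (simp_all add: I_2_eq c_map_linear_simps)

lemma I_1_I_1 [simp]: "I_1 (I_1 u) = - u"
  by (simp add: I_1_eq prod_eq_iff)

lemma I_2_I_2 [simp]: "I_2 i0 (I_2 i0 u) = - u"
  by (simp add: I_2_eq prod_eq_iff c_map_linear_simps)

lemma I_2_I_1: "I_2 i0 (I_1 u) = - I_1 (I_2 i0 u)"
  by (simp add: I_1_eq I_2_eq prod_eq_iff c_map_linear_simps)

section \<open>The endomorphism \<open>I_hat\<close> and the curvature form\<close>

definition I_hat :: "'n::finite TM_dual \<Rightarrow> 'n TM_dual" where
  "I_hat u = (J_M (fst u), - J_M (snd u))"

lemma linear_I_hat: "linear I_hat"
  by (rule linearI) (simp_all add: I_hat_def c_map_linear_simps)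

lemma I_hat_I_hat [simp]: "I_hat (I_hat u) = - u"
  by (simp add: I_hat_def prod_eq_iff c_map_linear_simps)

lemma I_hat_I_1: "I_hat (I_1 u) = I_1 (I_hat u)"
  by (simp add: I_1_eq I_hat_def prod_eq_iff c_map_linear_simps)

lemma I_hat_I_2: "I_hat (I_2 i0 u) = I_2 i0 (I_hat u)"
  by (simp add: I_2_eq I_hat_def prod_eq_iff c_map_linear_simps)

lemma bilinear_g_N: "bilinear (g_N i0)"
  unfolding bilinear_def by (auto intro!: linearI simp: g_N_eq g_M_linear_simps algebra_simps)

lemmas g_N_linear_simps = bilinear_ladd[OF bilinear_g_N] bilinear_radd[OF bilinear_g_N]
  bilinear_lmul[OF bilinear_g_N] bilinear_rmul[OF bilinear_g_N] bilinear_lneg[OF bilinear_g_N]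
  bilinear_rneg[OF bilinear_g_N] bilinear_lsub[OF bilinear_g_N] bilinear_rsub[OF bilinear_g_N]

lemma g_N_commute: "g_N i0 u v = g_N i0 v u"
  by (simp add: g_N_eq g_M_commute)

lemma g_N_I_hat [simp]: "g_N i0 (I_hat u) (I_hat v) = g_N i0 u v"
  by (simp add: g_N_eq I_hat_def g_M_linear_simps)

lemma g_N_Z_field: "g_N i0 (Z_field x) (Z_field x) = g_M i0 (fst x) (fst x)"
  by (simp add: g_N_eq Z_field_def g_M_linear_simps)

lemma linear_imp_has_derivative:
  fixes L :: "'a::euclidean_space \<Rightarrow> 'b::real_normed_vector"
  assumes "linear L" shows "(L has_derivative L) (at x)"
  using assms by (simp add: linear_conv_bounded_linear bounded_linear_imp_has_derivative)

text \<open>\<open>Z\<close> is a linear field with \<open>g_M\<close>-skew coefficient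
  \<open>-J_M\<close>, so the exterior derivative of its dual form is
  \<open>-2 g_M (J_M u) v\<close> on the horizontal half and zero on the vertical half. Added to the
  form of \<open>I_1\<close>, it flips exactly the horizontal sign.\<close>

lemma omega_H_eq: "omega_H i0 x u v = - g_N i0 (I_hat u) v"
proof -
  have "linear (\<lambda>y. g_N i0 (Z_field y) v)" for v
    by (rule linearI) (simp_all add: g_N_eq Z_field_def c_map_linear_simps g_M_linear_simps algebra_simps)
  from frechet_derivative_at[OF linear_imp_has_derivative[OF this], symmetric]
  have "omega_H i0 x u v = g_N i0 (I_1 u) v + (g_N i0 (Z_field u) v - g_N i0 (Z_field v) u)"
    unfolding omega_H_def ext_d_def by simp
  also have "\<dots> = - g_N i0 (I_hat u) v"
    using g_M_J_M_left[of i0 "fst v" "fst u"] g_M_commute[of i0 "fst v"]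
    by (simp add: g_N_eq Z_field_def I_1_eq I_hat_def g_M_linear_simps)
  finally show ?thesis .
qed

section \<open>The function \<open>f_H\<close> and the domain of the twist\<close>

lemma f_H_eq: "f_H i0 c x = (g_M i0 (fst x) (fst x) - c) / 2"
  by (simp add: f_H_def g_N_Z_field)

lemma f_H_has_derivative:
  fixes i0 :: "'n::finite"
  shows "(f_H i0 c has_derivative (\<lambda>v. g_M i0 (fst x) (fst v))) (at x)"
proof -
  have bb: "bounded_bilinear (g_M i0)"
    using bilinear_g_M by (simp add: bilinear_conv_bounded_bilinear)
  have "((\<lambda>y :: 'n TM_dual. 1/2 * (g_M i0 (fst y) (fst y) - c)) has_derivative
     (\<lambda>v. 1/2 * (g_M i0 (fst x) (fst v) + g_M i0 (fst v) (fst x) - 0))) (at x)"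
    by (intro has_derivative_mult_right has_derivative_diff has_derivative_const
       bounded_bilinear.FDERIV[OF bb] has_derivative_fst has_derivative_ident)
  moreover have "(\<lambda>v :: 'n TM_dual. 1/2 * (g_M i0 (fst x) (fst v) + g_M i0 (fst v) (fst x) - 0)) = (\<lambda>v. g_M i0 (fst x) (fst v))"
    using g_M_commute[of i0 _ "fst x"] by (intro ext) simp
  moreover have "f_H i0 c = (\<lambda>y. 1/2 * (g_M i0 (fst y) (fst y) - c))"
    by (intro ext) (simp add: f_H_eq)
  ultimately show ?thesis by (simp only:)
qed

lemma g_M_neg_on_M_dom: "z \<in> M_dom i0 \<Longrightarrow> g_M i0 z z < 0"
proof -
  have "h_M i0 z z = of_real (- (cmod (z $ i0))\<^sup>2 + (\<Sum>j\<in>-{i0}. (cmod (z $ j))\<^sup>2))"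
    by (simp add: h_M_def complex_norm_square[symmetric] flip: of_real_power)
  then have "g_M i0 z z = - (cmod (z $ i0))\<^sup>2 + (\<Sum>j\<in>-{i0}. (cmod (z $ j))\<^sup>2)"
    unfolding g_M_def by (metis Re_complex_of_real)
  then show "z \<in> M_dom i0 \<Longrightarrow> g_M i0 z z < 0" by (simp add: M_dom_def)
qed

lemma N_dom_g_M: "x \<in> N_dom i0 c \<Longrightarrow> g_M i0 (fst x) (fst x) < 0"
  unfolding N_dom_def using g_M_neg_on_M_dom by auto

text \<open>Here \<open>c \<ge> 0\<close> is used: it keeps \<open>f_H\<close> away from zero, which
  makes \<open>Z_P\<close> transverse to the horizontal distribution and the twist
  invertible.\<close>

lemma N_dom_f_H: "x \<in> N_dom i0 c \<Longrightarrow> c \<ge> 0 \<Longrightarrow> f_H i0 c x < 0"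
  using N_dom_g_M[of x i0 c] by (simp add: f_H_eq)

lemma N_dom_f_Z: "x \<in> N_dom i0 c \<Longrightarrow> f_Z i0 c x > 0"
  unfolding N_dom_def by auto

lemma open_N_dom:
  fixes i0 :: "'n::finite"
  shows "open (N_dom i0 c)"
proof -
  have c1: "continuous_on UNIV (f_H i0 c)"
    by (rule has_derivative_continuous_on) (rule has_derivative_at_withinI[OF f_H_has_derivative])
  have eq: "N_dom i0 c = {x. (\<Sum>j\<in>-{i0}. (cmod (fst x $ j))\<^sup>2) < (cmod (fst x $ i0))\<^sup>2} \<inter>
      {x. 0 < - f_H i0 c x - c}"
  proof (rule set_eqI)
    fix x :: "'n TM_dual"
    have "f_Z i0 c x = - f_H i0 c x - c" by (simp add: f_Z_def g_N_Z_field f_H_eq field_simps)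
    then show "x \<in> N_dom i0 c \<longleftrightarrow> x \<in> {x. (\<Sum>j\<in>-{i0}. (cmod (fst x $ j))\<^sup>2) < (cmod (fst x $ i0))\<^sup>2} \<inter>
      {x. 0 < - f_H i0 c x - c}" by (simp add: N_dom_def M_dom_def)
  qed
  show ?thesis unfolding eq
    by (intro open_Int open_Collect_less continuous_on_sum continuous_on_power continuous_on_norm
        continuous_on_component continuous_on_fst continuous_on_id continuous_on_diff continuous_on_minus continuous_on_const c1)
qed

section \<open>Orthogonal projections\<close>

text \<open>The form is indefinite, so the usual projection formula rests on a spanning set of
  mutually orthogonal vectors with nonzero squares. Uniqueness is included because
  \<open>orth_part\<close> is a definite description.\<close>

lemma orth_part_expansion:
  assumes B: "bilinear B" and S: "finite S"
    and orth: "\<And>b b'. b \<in> S \<Longrightarrow> b' \<in> S \<Longrightarrow> b \<noteq> b' \<Longrightarrow> B b b' = 0" and nz: "\<And>b. b \<in> S \<Longrightarrow> B b b \<noteq> 0"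
  defines "v u \<equiv> (\<Sum>b\<in>S. (B u b / B b b) *\<^sub>R b)"
  shows "v u \<in> span S" and "w \<in> span S \<Longrightarrow> B (u - v u) w = 0"
    and "v' \<in> span S \<Longrightarrow> \<forall>w\<in>span S. B (u - v') w = 0 \<Longrightarrow> v' = v u"
    and "orth_part B S u = v u"
proof -
  have lin: "linear (B u)" "linear (\<lambda>u. B u w)" for u w using B by (simp_all add: bilinear_def)
  have coef: "B (\<Sum>b\<in>S. a b *\<^sub>R b) b' = a b' * B b' b'" if "b' \<in> S" for a b'
  proof -
    have "B (\<Sum>b\<in>S. a b *\<^sub>R b) b' = (\<Sum>b\<in>S. a b * B b b')"
      by (simp add: linear_sum[OF lin(2)] linear_scale[OF lin(2)])
    also have "\<dots> = (\<Sum>b\<in>S. if b = b' then a b' * B b' b' else 0)"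
      by (rule sum.cong) (use orth that in auto)
    also have "\<dots> = a b' * B b' b'" using S that by simp
    finally show ?thesis .
  qed
  show v: "v u \<in> span S" for u
    unfolding v_def by (intro span_sum span_scale span_base)
  show o: "B (u - v u) w = 0" if "w \<in> span S" for u w
    using that
  proof (induction rule: span_induct_alt)
    case base then show ?case using lin(1) linear_0 by blast
  next
    case (step c x y)
    have "B (u - v u) x = 0"
      using coef[OF step(1), of "\<lambda>b. B u b / B b b"] nz[OF step(1)]
      by (simp add: bilinear_lsub[OF B] v_def)
    then show ?case using step by (simp add: linear_add[OF lin(1)] linear_scale[OF lin(1)])
  qed
  show uniq: "v' = v u" if v': "v' \<in> span S" "\<forall>w\<in>span S. B (u - v') w = 0" for u v'
  proof -
    have d: "v' - v u \<in> span S" by (intro span_diff v' v)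
    then obtain a where a: "v' - v u = (\<Sum>b\<in>S. a b *\<^sub>R b)"
      using span_finite[OF S] by auto
    have "a b = 0" if "b \<in> S" for b
    proof -
      have "B (v' - v u) b = B (u - v u) b - B (u - v') b"
        by (simp add: bilinear_lsub[OF B])
      also have "\<dots> = 0" using o[OF span_base[OF that]] v'(2) span_base[OF that] by simp
      finally show ?thesis using coef[OF that, of a] nz[OF that] unfolding a by simp
    qed
    then have "(\<Sum>b\<in>S. a b *\<^sub>R b) = 0" by simp
    then show ?thesis using a by simp
  qed
  show "orth_part B S u = v u"
    unfolding orth_part_def
    by (rule the_equality) (use v o uniq in blast)+
qed

context
  fixes i0 :: "'n::finite" and x :: "'n TM_dual"
  assumes x: "g_M i0 (fst x) (fst x) \<noteq> 0"
begin

abbreviation (input) HZ_basis :: "'n TM_dual set" where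
  "HZ_basis \<equiv> {Z_field x, I_1 (Z_field x), I_2 i0 (Z_field x), I_3 i0 (Z_field x)}"

lemma HZ_basis_eq:
  "Z_field x = (- J_M (fst x), 0)" "I_1 (Z_field x) = (fst x, 0)"
  "I_2 i0 (Z_field x) = (0, herm_dual i0 (fst x))" "I_3 i0 (Z_field x) = (0, J_M (herm_dual i0 (fst x)))"
  by (simp_all add: I_1_eq I_2_eq I_3_def Z_field_def c_map_linear_simps)

text \<open>Each of the four vectors has \<open>g_N\<close>-square
  \<open>g_M i0 (fst x) (fst x)\<close>, and they are pairwise orthogonal because \<open>J_M\<close>
  is skew for \<open>g_M\<close>.\<close>

lemma HZ_basis_orth:
  "b \<in> HZ_basis \<Longrightarrow> b' \<in> HZ_basis \<Longrightarrow> b \<noteq> b' \<Longrightarrow> g_N i0 b b' = 0"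
  "b \<in> HZ_basis \<Longrightarrow> g_N i0 b b \<noteq> 0"
  using x unfolding HZ_basis_eq(2-4) unfolding HZ_basis_eq(1) by (auto simp: g_N_eq g_M_linear_simps)

lemmas HZ_expansion = orth_part_expansion[of "g_N i0" HZ_basis, OF bilinear_g_N _ HZ_basis_orth]

lemma span_HZ_span: "span (HZ_span i0 x) = HZ_span i0 x"
  unfolding HZ_span_def by (rule span_span)

lemma orth_part_HZ_span: "orth_part (g_N i0) (HZ_span i0 x) = orth_part (g_N i0) HZ_basis"
  unfolding orth_part_def span_HZ_span by (simp add: HZ_span_def)

lemma linear_orth_part_HZ: "linear (orth_part (g_N i0) (HZ_span i0 x))"
proof -
  have eq: "orth_part (g_N i0) HZ_basis = (\<lambda>u. \<Sum>b\<in>HZ_basis. (g_N i0 u b / g_N i0 b b) *\<^sub>R b)"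
    by (rule ext, rule HZ_expansion(4)) blast
  have "linear (\<lambda>u. \<Sum>b\<in>HZ_basis. (g_N i0 u b / g_N i0 b b) *\<^sub>R b)"
    by (intro linear_compose_sum ballI linearI)
      (simp_all add: g_N_linear_simps add_divide_distrib scaleR_add_left)
  then show ?thesis by (simp only: orth_part_HZ_span eq)
qed

lemma orth_part_HZ_eqI:
  assumes "v \<in> HZ_span i0 x" "\<And>w. w \<in> HZ_span i0 x \<Longrightarrow> g_N i0 (u - v) w = 0"
  shows "orth_part (g_N i0) (HZ_span i0 x) u = v"
proof -
  have "v = (\<Sum>b\<in>HZ_basis. (g_N i0 u b / g_N i0 b b) *\<^sub>R b)"
    by (rule HZ_expansion(3)) (use assms in \<open>auto simp: HZ_span_def\<close>)
  moreover have "orth_part (g_N i0) HZ_basis u = (\<Sum>b\<in>HZ_basis. (g_N i0 u b / g_N i0 b b) *\<^sub>R b)"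
    by (rule HZ_expansion(4)) blast
  ultimately show ?thesis by (simp only: orth_part_HZ_span)
qed

lemma orth_part_HZ:
  "orth_part (g_N i0) (HZ_span i0 x) u \<in> HZ_span i0 x"
  "w \<in> HZ_span i0 x \<Longrightarrow> g_N i0 (u - orth_part (g_N i0) (HZ_span i0 x) u) w = 0"
proof -
  have eq: "orth_part (g_N i0) HZ_basis u = (\<Sum>b\<in>HZ_basis. (g_N i0 u b / g_N i0 b b) *\<^sub>R b)"
    by (rule HZ_expansion(4)) blast
  show "orth_part (g_N i0) (HZ_span i0 x) u \<in> HZ_span i0 x"
    unfolding orth_part_HZ_span eq unfolding HZ_span_def by (rule HZ_expansion(1)) blast
  show "w \<in> HZ_span i0 x \<Longrightarrow> g_N i0 (u - orth_part (g_N i0) (HZ_span i0 x) u) w = 0"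
    unfolding orth_part_HZ_span eq unfolding HZ_span_def by (rule HZ_expansion(2)) blast
qed

text \<open>Up to sign \<open>I_hat\<close> exchanges \<open>Z\<close> with \<open>I_1 Z\<close> and
  \<open>I_2 Z\<close> with \<open>I_3 Z\<close>.\<close>

lemma I_hat_HZ: "w \<in> HZ_span i0 x \<Longrightarrow> I_hat w \<in> HZ_span i0 x"
proof -
  assume "w \<in> HZ_span i0 x"
  then have "I_hat w \<in> span (I_hat ` HZ_basis)"
    using linear_span_image[OF linear_I_hat, of HZ_basis] by (auto simp: HZ_span_def)
  moreover have "I_hat ` HZ_basis \<subseteq> span HZ_basis"
  proof -
    have "I_hat ` HZ_basis = {I_1 (Z_field x), - Z_field x, - I_3 i0 (Z_field x), I_2 i0 (Z_field x)}"
      unfolding HZ_basis_eq(2-4) unfolding HZ_basis_eq(1) by (simp add: I_hat_def c_map_linear_simps)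
    also have "\<dots> \<subseteq> span HZ_basis" by (auto intro: span_base span_neg)
    finally show ?thesis .
  qed
  ultimately show ?thesis
    unfolding HZ_span_def using span_minimal[OF _ subspace_span] by blast
qed

text \<open>An isometry which preserves a nondegenerate subspace commutes with the projection onto
  it. Hence both summands of \<open>g_H\<close> are preserved, whatever their factors.\<close>

lemma orth_part_I_hat:
  "orth_part (g_N i0) (HZ_span i0 x) (I_hat u) = I_hat (orth_part (g_N i0) (HZ_span i0 x) u)"
proof (rule orth_part_HZ_eqI)
  let ?p = "orth_part (g_N i0) (HZ_span i0 x) u"
  show "I_hat ?p \<in> HZ_span i0 x" by (intro I_hat_HZ orth_part_HZ)
  fix w assume "w \<in> HZ_span i0 x"
  then have "g_N i0 (u - ?p) (I_hat w) = 0" by (intro orth_part_HZ I_hat_HZ)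
  moreover have "g_N i0 (I_hat u - I_hat ?p) w = - g_N i0 (u - ?p) (I_hat w)"
    using g_N_I_hat[of i0 "u - ?p" "I_hat w"] by (simp add: linear_diff[OF linear_I_hat] g_N_linear_simps)
  ultimately show "g_N i0 (I_hat u - I_hat ?p) w = 0" by simp
qed

lemma g_H_I_hat: "g_H i0 c x (I_hat u) (I_hat v) = g_H i0 c x u v"
  unfolding g_H_def Let_def orth_part_I_hat linear_diff[OF linear_I_hat, symmetric] g_N_I_hat ..

lemma bilinear_g_H: "bilinear (g_H i0 c x)"
proof -
  note l = linear_orth_part_HZ
  show ?thesis
    unfolding bilinear_def g_H_def Let_def
    by (intro conjI allI linearI)
      (simp_all add: linear_add[OF l] linear_scale[OF l] g_N_linear_simps algebra_simps)
qed

lemma g_H_HZ: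
  assumes "u \<in> HZ_span i0 x" "v \<in> HZ_span i0 x"
  shows "g_H i0 c x u v = f_H i0 c x / (f_Z i0 c x)\<^sup>2 * g_N i0 u v"
proof -
  have "g_N i0 0 w = 0" for w by (rule bilinear_lzero[OF bilinear_g_N])
  then have "orth_part (g_N i0) (HZ_span i0 x) u = u" "orth_part (g_N i0) (HZ_span i0 x) v = v"
    using assms by (auto intro!: orth_part_HZ_eqI)
  then show ?thesis by (simp add: g_H_def bilinear_lzero[OF bilinear_g_N])
qed

text \<open>Up to a factor \<open>X\<close> is the image of \<open>Z\<close> under the twist map, so
  these values provide the orthogonal non-null basis needed for the projection inside
  \<open>J_tilde\<close>.\<close>

lemma g_H_Z:
  "g_H i0 c x (Z_field x) (Z_field x) = f_H i0 c x / (f_Z i0 c x)\<^sup>2 * g_M i0 (fst x) (fst x)"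
  "g_H i0 c x (I_1 (Z_field x)) (I_1 (Z_field x)) = f_H i0 c x / (f_Z i0 c x)\<^sup>2 * g_M i0 (fst x) (fst x)"
  "g_H i0 c x (Z_field x) (I_1 (Z_field x)) = 0" "g_H i0 c x (I_1 (Z_field x)) (Z_field x) = 0"
proof -
  have "Z_field x \<in> HZ_span i0 x" "I_1 (Z_field x) \<in> HZ_span i0 x"
    unfolding HZ_span_def by (auto intro: span_base)
  note m = g_H_HZ[OF this(1,1), of c] g_H_HZ[OF this(2,2), of c] g_H_HZ[OF this, of c] g_H_HZ[OF this(2,1), of c]
  show "g_H i0 c x (Z_field x) (Z_field x) = f_H i0 c x / (f_Z i0 c x)\<^sup>2 * g_M i0 (fst x) (fst x)"
    "g_H i0 c x (I_1 (Z_field x)) (I_1 (Z_field x)) = f_H i0 c x / (f_Z i0 c x)\<^sup>2 * g_M i0 (fst x) (fst x)"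
    "g_H i0 c x (Z_field x) (I_1 (Z_field x)) = 0" "g_H i0 c x (I_1 (Z_field x)) (Z_field x) = 0"
    unfolding m unfolding HZ_basis_eq(2-4) unfolding HZ_basis_eq(1) by (simp_all add: g_N_eq g_M_linear_simps)
qed

end

section \<open>Orientations\<close>

definition flat_basis :: "'n::finite + 'n \<Rightarrow> 'n TM_dual" where
  "flat_basis m = (case m of Inl k \<Rightarrow> (axis k 1, 0) | Inr k \<Rightarrow> (0, axis k 1))"

text \<open>\<open>I_hat\<close> and \<open>I_1\<close> agree on the horizontal half of the basis and differ by a sign
  on the \<open>n\<close> vectors of the vertical half.\<close>

lemma orientation_I_hat_I_1:
  fixes L :: "'n::finite TM_dual \<Rightarrow> 'n R4n"
  assumes L: "linear L" "inj L" and K: "\<And>u. K (L u) = L (I_hat u)" and J: "\<And>u. J (L u) = L (I_1 u)"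
  shows "adapted_basis_det J (L \<circ> flat_basis) = (-1) ^ CARD('n) * adapted_basis_det K (L \<circ> flat_basis)"
    and "adapted_basis_det K (L \<circ> flat_basis) \<noteq> 0"
proof -
  define E where "E J = (\<chi> i. case i of Inl j \<Rightarrow> (L \<circ> flat_basis) j | Inr j \<Rightarrow> J ((L \<circ> flat_basis) j))"
    for J :: "'n R4n \<Rightarrow> 'n R4n"
  have E: "adapted_basis_det J (L \<circ> flat_basis) = det (E J)" for J unfolding adapted_basis_det_def E_def ..
  \<comment> \<open>The sign is -1 exactly on the rows that hold the image of a vertical basis
    vector under the complex structure; there are \<open>CARD('n)\<close> of them.\<close>
  define d :: "('n + 'n) + ('n + 'n) \<Rightarrow> real" where
    "d i = (case i of Inr (Inr k) \<Rightarrow> -1 | _ \<Rightarrow> 1)" for i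
  have J_eq: "J (L (flat_basis (Inl k))) = K (L (flat_basis (Inl k)))"
    "J (L (flat_basis (Inr k))) = - K (L (flat_basis (Inr k)))" for k
    unfolding J K by (simp_all add: flat_basis_def I_1_eq I_hat_def c_map_linear_simps linear_neg[OF L(1), symmetric])
  have "E J = (\<chi> i. d i *s E K $ i)"
    unfolding vec_eq_iff
  proof (intro allI)
    fix i j show "E J $ i $ j = (\<chi> i. d i *s E K $ i) $ i $ j"
      by (cases i rule: sum.exhaust; simp add: E_def d_def split: sum.split)
        (auto simp: J_eq split: sum.split)
  qed
  then have "det (E J) = prod d UNIV * det (E K)" using det_rows_mul[of d "\<lambda>i. E K $ i"] by simp
  also have "prod d UNIV = (-1) ^ CARD('n)"
    by (simp add: d_def UNIV_Plus_UNIV[symmetric] prod.Plus del: UNIV_Plus_UNIV)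
  finally show "adapted_basis_det J (L \<circ> flat_basis) = (-1) ^ CARD('n) * adapted_basis_det K (L \<circ> flat_basis)"
    unfolding E .
  \<comment> \<open>The determinant is nonzero because the rows are independent: a combination of
    them is the image under \<open>L\<close> of a vector whose complex coordinates have the
    coefficients, up to sign, as real and imaginary parts.\<close>
  let ?f = "\<lambda>x::'n R4n. \<Sum>i\<in>UNIV. (x $ i) *\<^sub>R (E K $ i)"
  let ?g = "\<lambda>x::'n R4n. (\<Sum>m\<in>UNIV. (x $ Inl m) *\<^sub>R flat_basis m + (x $ Inr m) *\<^sub>R I_hat (flat_basis m))"
  have linf: "linear ?f"
    by (intro linear_compose_sum ballI linearI) (simp_all add: scaleR_add_left)
  have fg: "?f x = L (?g x)" for x
  proof -
    have "?f x = (\<Sum>m\<in>UNIV. (x $ Inl m) *\<^sub>R (E K $ Inl m)) + (\<Sum>m\<in>UNIV. (x $ Inr m) *\<^sub>R (E K $ Inr m))"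
      by (rule sum_UNIV_Plus)
    then show ?thesis
      by (simp add: E_def K linear_sum[OF L(1)] linear_add[OF L(1)] linear_scale[OF L(1)] sum.distrib)
  qed
  have "x = 0" if "?f x = 0" for x
  proof -
    have "L (?g x) = 0" using that by (simp only: fg)
    then have "L (?g x) = L 0" by (simp only: linear_0[OF L(1)])
    then have g0: "?g x = 0" by (rule injD[OF L(2)])
    have g: "fst (?g x) $ k = Complex (x $ Inl (Inl k)) (x $ Inr (Inl k))"
      "snd (?g x) $ k = Complex (x $ Inl (Inr k)) (- x $ Inr (Inr k))" for k
      by (simp_all add: sum_UNIV_Plus fst_sum snd_sum flat_basis_def I_hat_def J_M_def axis_def c_map_linear_simps
        sum.distrib if_distrib if_distribR sum.delta sum.delta' complex_eq_iff cong: if_cong)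
    have "Complex (x $ Inl (Inl k)) (x $ Inr (Inl k)) = 0" "Complex (x $ Inl (Inr k)) (- x $ Inr (Inr k)) = 0" for k
      unfolding g[symmetric] g0 by simp_all
    then have z: "x $ Inl (Inl k) = 0" "x $ Inr (Inl k) = 0" "x $ Inl (Inr k) = 0" "x $ Inr (Inr k) = 0" for k
      by (simp_all add: complex_eq_iff)
    have "x $ i = 0" for i
    proof (cases i)
      case (Inl m) then show ?thesis using z by (cases m) auto
    next
      case (Inr m) then show ?thesis using z by (cases m) auto
    qed
    then show ?thesis by (simp add: vec_eq_iff)
  qed
  then have "inj ?f" using linear_injective_0[OF linf] by blast
  then have "det (matrix ?f) \<noteq> 0" using det_nz_iff_inj[OF linf] by blast
  moreover have "matrix ?f = transpose (E K)"
    by (simp add: matrix_def transpose_def vec_eq_iff axis_def if_distrib if_distribR sum.delta' cong: if_cong)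
  ultimately show "adapted_basis_det K (L \<circ> flat_basis) \<noteq> 0" unfolding E by simp
qed

text \<open>With \<open>I'\<close> the given imaginary unit, the witness is \<open>Q = I' + I\<^sub>1\<close>, which is invertible
  unless \<open>I' = -I\<^sub>1\<close>; in that case \<open>Q = I\<^sub>2\<close>.\<close>

lemma imaginary_unit_conjugate:
  fixes i0 :: "'n::finite"
  defines "I' a b d u \<equiv> a *\<^sub>R I_1 u + b *\<^sub>R I_2 i0 u + d *\<^sub>R I_3 i0 u"
  assumes I': "\<And>u. I' a b d (I' a b d u) = - u"
  obtains Q :: "'n TM_dual \<Rightarrow> 'n TM_dual" where "linear Q" "inj Q" "\<And>u. Q (I_1 u) = I' a b d (Q u)" "\<And>u. Q (I_hat u) = I_hat (Q u)"
proof -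
  let ?I = "I' a b d"
  note lin = linear_add[OF linear_I_1] linear_add[OF linear_I_2] linear_scale[OF linear_I_1] linear_scale[OF linear_I_2]
    linear_neg[OF linear_I_1] linear_neg[OF linear_I_2] linear_diff[OF linear_I_1] linear_diff[OF linear_I_2]
  have l: "linear ?I"
    unfolding I'_def by (rule linearI) (simp_all add: I_3_def lin scaleR_add_right algebra_simps)
  have sq: "?I (?I u) = - ((a\<^sup>2 + b\<^sup>2 + d\<^sup>2) *\<^sub>R u)" for u
    unfolding I'_def by (simp add: I_3_def lin I_2_I_1 algebra_simps power2_eq_square)
  have "(a\<^sup>2 + b\<^sup>2 + d\<^sup>2) *\<^sub>R (axis i0 1, 0 :: 'n cvec) = (axis i0 1 :: 'n cvec, 0)"
    using sq[of "(axis i0 1, 0)"] I'[of "(axis i0 1, 0)"] by (metis neg_equal_iff_equal)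
  then have "(a\<^sup>2 + b\<^sup>2 + d\<^sup>2) *\<^sub>R (axis i0 1 :: 'n cvec) $ i0 = (axis i0 1 :: 'n cvec) $ i0"
    by (metis fst_conv fst_scaleR vector_scaleR_component)
  then have norm: "a\<^sup>2 + b\<^sup>2 + d\<^sup>2 = 1" by (simp add: axis_def complex_eq_iff)
  have hat: "?I (I_hat u) = I_hat (?I u)" for u
    unfolding I'_def by (simp add: I_3_def linear_add[OF linear_I_hat] linear_scale[OF linear_I_hat] I_hat_I_1 I_hat_I_2)
  show ?thesis
  proof (cases "a = -1")
    case True
    then have "b\<^sup>2 + d\<^sup>2 = 0" using norm by simp
    then have "b = 0" "d = 0" by (simp_all add: sum_power2_eq_zero_iff)
    with True have I: "?I u = - I_1 u" for u by (simp add: I'_def)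
    show ?thesis
    proof (rule that[of "I_2 i0"])
      show "inj (I_2 i0)" by (rule inj_on_inverseI[of _ "\<lambda>u. - I_2 i0 u"]) simp
    qed (simp_all add: linear_I_2 I I_2_I_1 I_hat_I_2)
  next
    case False
    let ?Q = "\<lambda>u. ?I u + I_1 u"
    \<comment> \<open>Both units square to -1 and their anticommutator is \<open>-2 * a\<close>, so
      the square of the sum is the scalar \<open>-2 - 2 * a\<close>, nonzero in this case. The
      intertwining property is immediate, as \<open>I' I_1 - 1\<close> results on both
      sides.\<close>
    have QQ: "?Q (?Q u) = (- 2 - 2 * a) *\<^sub>R u" for u
    proof -
      have two: "(2 * a) *\<^sub>R u = a *\<^sub>R u + a *\<^sub>R u"
        using scaleR_2[of "a *\<^sub>R u"] by simp
      have "?I (I_1 u) + I_1 (?I u) = - (a *\<^sub>R u) - a *\<^sub>R u"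
        unfolding I'_def by (simp add: I_3_def lin I_2_I_1 algebra_simps)
      moreover have "?Q (?Q u) = (?I (I_1 u) + I_1 (?I u)) - u - u"
        using I'[of u] by (simp add: linear_add[OF l] linear_add[OF linear_I_1])
      moreover have "(- 2 - 2 * a) *\<^sub>R u = - (a *\<^sub>R u) - a *\<^sub>R u - u - u"
        by (simp only: scaleR_diff_left scaleR_minus_left two scaleR_2) simp
      ultimately show ?thesis by (simp only:)
    qed
    show ?thesis
    proof (rule that[of ?Q])
      show "linear ?Q" by (intro linear_compose_add l linear_I_1)
      show "inj ?Q"
        by (rule inj_on_inverseI[of _ "\<lambda>u. inverse (- 2 - 2 * a) *\<^sub>R ?Q u"])
          (use False in \<open>simp add: QQ del: scaleR_add_right\<close>)
      show "?Q (I_1 u) = ?I (?Q u)" for u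
        by (simp add: linear_add[OF l] I')
      show "?Q (I_hat u) = I_hat (?Q u)" for u
        by (simp add: hat linear_add[OF linear_I_hat] I_hat_I_1)
    qed
  qed
qed

section \<open>Flows and curves\<close>

lemma has_vector_derivative_partial_fst:
  assumes "(f has_derivative D) (at (t, x))"
  shows "((\<lambda>s. f (s, x)) has_vector_derivative D (1, 0)) (at t)"
proof -
  have "((\<lambda>s::real. (s, x)) has_derivative (\<lambda>s. (s, 0))) (at t)"
    by (intro has_derivative_Pair has_derivative_ident has_derivative_const)
  from diff_chain_at[OF this assms] have "((\<lambda>s. f (s, x)) has_derivative (\<lambda>s. D (s, 0))) (at t)"
    by (simp add: o_def)
  moreover have "(\<lambda>s. D (s, 0)) = (\<lambda>s. s *\<^sub>R D (1, 0))"
  proof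
    fix s
    have "D (s *\<^sub>R (1, 0)) = s *\<^sub>R D (1, 0)" by (rule linear_scale[OF has_derivative_linear[OF assms]])
    then show "D (s, 0) = s *\<^sub>R D (1, 0)" by (simp only: scaleR_Pair scaleR_zero_right real_scaleR_def mult_1_right)
  qed
  ultimately show ?thesis unfolding has_vector_derivative_def by (simp only:)
qed

lemma has_derivative_partial_snd:
  assumes "(f has_derivative D) (at (t, x))"
  shows "((\<lambda>y. f (t, y)) has_derivative (\<lambda>h. D (0, h))) (at x)"
proof -
  have "((\<lambda>y. (t, y)) has_derivative (\<lambda>h. (0, h))) (at x)"
    by (intro has_derivative_Pair has_derivative_ident has_derivative_const)
  from diff_chain_at[OF this assms] show ?thesis by (simp add: o_def)
qed

lemma has_vector_derivative_shift_0:
  assumes "((\<lambda>h. f (t + h)) has_vector_derivative d) (at 0)"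
  shows "(f has_vector_derivative d) (at t)"
proof -
  have "((\<lambda>s. s - t) has_vector_derivative 1) (at t)" by (auto intro!: derivative_eq_intros)
  from vector_diff_chain_at[OF this, of "\<lambda>h. f (t + h)" d] assms show ?thesis by (simp add: o_def)
qed

lemma has_vector_derivative_zero_imp_const:
  fixes f :: "real \<Rightarrow> 'a::real_normed_vector"
  assumes "\<And>t. (f has_vector_derivative 0) (at t)"
  shows "f t = f s"
proof -
  have "(f has_derivative (\<lambda>h. 0)) (at t within UNIV)" for t
    using assms[of t] by (simp add: has_vector_derivative_def)
  from has_derivative_zero_unique[OF convex_UNIV this] show ?thesis by blast
qed

lemma flow_continuous:
  assumes A: "smooth_manifold UNIV A" and F: "smooth_flow A \<Phi>"
  shows "continuous_on UNIV (\<lambda>t. \<Phi> t p)"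
proof -
  have "points (real_times A) = UNIV"
    using smooth_manifold_points[OF A] points_real_times[of A] by simp
  then have "continuous_on UNIV (\<lambda>(t, p). \<Phi> t p)"
    using F by (simp add: smooth_flow_def smooth_map_def)
  from continuous_on_compose2[OF this, of UNIV "\<lambda>t. (t, p)"]
  show ?thesis by (simp add: continuous_on_Pair)
qed

text \<open>\<open>generator\<close> is a \<open>vector_derivative\<close> and means something only
  for a differentiable curve; joint smoothness of the flow provides this. The chart \<open>d\<close>
  in the target is arbitrary, and the chart in the source is the preferred one in which the
  generator is expressed.\<close>

lemma flow_curve:
  assumes A: "smooth_manifold UNIV A" and B: "smooth_manifold M B" and F: "smooth_flow A \<Phi>"
    and f: "smooth_map A B f" and d: "d \<in> B" "f p \<in> fst d"
  shows "((\<lambda>t. snd d (f (\<Phi> t p))) has_vector_derivative chart_D (chart_at A p) d f p (generator A \<Phi> p)) (at 0)"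
proof -
  let ?b = "chart_at A p"
  have b: "?b \<in> A" "p \<in> fst ?b" using preferred_chart[OF A] by auto
  note bc = manifold_chart[OF A b(1)]
  note F0 = flow_rep[OF A F b(1) b(1)]
  have \<Phi>0: "\<Phi> 0 q = q" for q using F by (simp add: smooth_flow_def)
  have "((\<lambda>(t, x). snd ?b (\<Phi> t (chart_inv ?b x))) has_derivative
      frechet_derivative (\<lambda>(t, x). snd ?b (\<Phi> t (chart_inv ?b x))) (at (0, snd ?b p))) (at (0, snd ?b p))"
    by (rule smooth_on_has_derivative[OF F0(2)]) (use b \<Phi>0 chart_inv_left[OF bc b(2)] in auto)
  from has_vector_derivative_partial_fst[OF this]
  have "\<exists>D. ((\<lambda>t. snd ?b (\<Phi> t p)) has_vector_derivative D) (at 0)"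
    using chart_inv_left[OF bc b(2)] by auto
  then have gen: "((\<lambda>t. snd ?b (\<Phi> t p)) has_vector_derivative generator A \<Phi> p) (at 0)"
    unfolding generator_def using vector_derivative_works by (metis differentiableI_vector)
  have "((snd d \<circ> f \<circ> chart_inv ?b) \<circ> (\<lambda>t. snd ?b (\<Phi> t p)) has_vector_derivative
     chart_D ?b d f p (generator A \<Phi> p)) (at 0)"
  proof -
    have "(snd d \<circ> f \<circ> chart_inv ?b has_derivative chart_D ?b d f p) (at (snd ?b (\<Phi> 0 p)))"
      unfolding \<Phi>0 by (rule chart_D_works[OF A B f b d])
    from diff_chain_at[OF gen[unfolded has_vector_derivative_def] this]
    show ?thesis unfolding has_vector_derivative_def
      using linear_scale[OF chart_D_linear[OF A B f b d]] by (simp add: o_def)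
  qed
  moreover have "open ((\<lambda>t. \<Phi> t p) -` fst ?b)"
    by (rule open_vimage[OF chart_open(1)[OF bc] flow_continuous[OF A F]])
  ultimately show ?thesis
    by (rule has_vector_derivative_transform_within_open) (use \<Phi>0 b chart_inv_left[OF bc] in auto)
qed

lemma smooth_on_has_derivative_apply:
  fixes \<alpha> :: "'a::real_normed_vector \<Rightarrow> 'b::euclidean_space \<Rightarrow> 'c::real_normed_vector"
  assumes "open S" "\<And>u. smooth_on S (\<lambda>x. \<alpha> x u)" "\<And>x. x \<in> S \<Longrightarrow> linear (\<alpha> x)" "smooth_on S w"
  shows "smooth_on S (\<lambda>x. \<alpha> x (w x))"
  unfolding smooth_on_def
proof
  show "Ck_on k S (\<lambda>x. \<alpha> x (w x))" for k
    by (rule Ck_on_apply_linear[OF assms(1) _ assms(3)]) (use assms(2,4) in \<open>simp_all add: smooth_on_def\<close>)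
qed

lemma mderiv_flat:
  "f p \<in> N \<Longrightarrow> mderiv A (flat_atlas N) f p =
    frechet_derivative (\<lambda>x. f (chart_inv (chart_at A p) x)) (at (snd (chart_at A p) p))"
  by (simp add: mderiv_def o_def)

section \<open>The twist\<close>

text \<open>The flow of \<open>Z\<close>.\<close>

definition rotation :: "real \<Rightarrow> 'n::finite TM_dual \<Rightarrow> 'n TM_dual" where
  "rotation t u = (cos t *\<^sub>R fst u - sin t *\<^sub>R J_M (fst u), snd u)"

lemma linear_rotation: "linear (rotation t)"
  by (rule linearI) (simp_all add: rotation_def c_map_linear_simps algebra_simps)

lemma rotation_I_hat: "rotation t (I_hat u) = I_hat (rotation t u)"
  by (simp add: rotation_def I_hat_def c_map_linear_simps)

lemma rotation_inverse: "rotation t (rotation (- t) u) = u"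
proof -
  have "(cos t * cos t + sin t * sin t) *\<^sub>R fst u = fst u"
    by (simp only: sin_cos_squared_add3 scaleR_one)
  then have "(cos t * cos t) *\<^sub>R fst u + (sin t * sin t) *\<^sub>R fst u = fst u"
    by (simp only: scaleR_add_left)
  then show ?thesis
    by (simp add: rotation_def prod_eq_iff c_map_linear_simps algebra_simps)
qed

lemma Z_field_I_hat: "Z_field (I_hat u) = I_hat (Z_field u)"
  by (simp add: Z_field_def I_hat_def c_map_linear_simps)

lemma linear_Z_field: "linear Z_field"
  by (rule linearI) (simp_all add: Z_field_def c_map_linear_simps)

locale c_map_twist =
  fixes i0 :: "'n::finite" and c :: real
    and AP :: "('p::{t2_space,second_countable_topology}, 'n R4n \<times> real) chart set"
    and piN :: "'p \<Rightarrow> 'n TM_dual"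
    and rot :: "real \<Rightarrow> 'p \<Rightarrow> 'p"
    and eta :: "'p \<Rightarrow> 'n R4n \<times> real \<Rightarrow> real"
    and Psi :: "real \<Rightarrow> 'p \<Rightarrow> 'p"
    and AQ :: "('q::{t2_space,second_countable_topology}, 'n R4n) chart set"
    and piQ :: "'p \<Rightarrow> 'q"
  assumes c: "c \<ge> 0"
    and P: "smooth_manifold UNIV AP"
    and P_bundle: "principal_circle_bundle AP (N_dom i0 c) piN rot"
    and connection: "principal_connection AP rot eta"
    and curvature: "has_curvature AP (N_dom i0 c) piN eta (omega_H i0)"
    and Psi: "smooth_flow AP Psi" "generator AP Psi = Z_P i0 c AP piN eta (generator AP rot)"
    and Q: "smooth_manifold UNIV AQ"
    and Q_quotient: "is_orbit_space AP Psi AQ piQ"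
begin

abbreviation "N \<equiv> N_dom i0 c"
abbreviation "dN \<equiv> mderiv AP (flat_atlas N) piN"
abbreviation "dQ \<equiv> mderiv AP AQ piQ"
abbreviation "XP \<equiv> generator AP rot"
abbreviation "ZP \<equiv> generator AP Psi"
abbreviation "lift \<equiv> horizontal_lift AP N piN eta"
abbreviation "T \<equiv> twist_map AP N piN eta AQ piQ"

lemma rot: "smooth_flow AP rot" and piN_smooth: "smooth_map AP (flat_atlas N) piN"
  and range_piN: "range piN = N" and piN_fibre: "piN p = piN p' \<longleftrightarrow> (\<exists>t. p' = rot t p)"
  using P_bundle unfolding principal_circle_bundle_def by auto

lemma piN_mem: "piN p \<in> N"
  using range_piN by auto

lemma FN: "smooth_manifold N (flat_atlas N)"
  by (rule smooth_manifold_flat_atlas[OF open_N_dom])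

lemma N_chart: "(N, \<lambda>x. x) \<in> flat_atlas N"
  by (simp add: flat_atlas_def)

lemma piQ_smooth: "smooth_map AP AQ piQ" and surj_piQ: "surj piQ" and surj_dQ: "surj (dQ p)"
  and piQ_fibre: "piQ p = piQ p' \<longleftrightarrow> (\<exists>t. p' = Psi t p)"
  using Q_quotient unfolding is_orbit_space_def by auto

lemma f_H_piN: "f_H i0 c (piN p) < 0"
  by (rule N_dom_f_H[OF piN_mem c])

lemma eta_smooth: "smooth_one_form AP eta" and eta_XP: "eta p (XP p) = 1"
  using connection unfolding principal_connection_def by auto

lemma linear_eta: "linear (eta p)"
  using eta_smooth smooth_manifold_points[OF P] unfolding smooth_one_form_def by auto

lemma linear_dN: "linear (dN p)"
  by (rule linear_mderiv[OF P FN piN_smooth UNIV_I])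

lemma linear_dQ: "linear (dQ p)"
  by (rule linear_mderiv[OF P Q piQ_smooth UNIV_I])

text \<open>A local section gives a right inverse of the differential at the points it passes
  through; a rotation carries such a point to \<open>p\<close> and leaves \<open>piN\<close>
  unchanged.\<close>

lemma surj_dN: "surj (dN p)"
proof -
  obtain V s where V: "open V" "piN p \<in> V" "V \<subseteq> N" "smooth_map (flat_atlas V) AP s" "\<forall>y\<in>V. piN (s y) = y"
    using P_bundle piN_mem[of p] unfolding principal_circle_bundle_def by meson
  let ?x = "piN p"
  have FV: "smooth_manifold V (flat_atlas V)" by (rule smooth_manifold_flat_atlas[OF V(1)])
  have "piN (s ?x) = piN p" using V(2,5) by simp
  then obtain t where t: "p = rot t (s ?x)" using piN_fibre by blast
  have "piN (rot t q) = piN q" for q using piN_fibre[of q "rot t q"] by auto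
  then have "dN (s ?x) w = dN (rot t (s ?x)) (mderiv AP AP (rot t) (s ?x) w)" for w
    by (intro mderiv_compose[OF P P FN flow_smooth_map[OF P rot] piN_smooth]) auto
  moreover have "mderiv (flat_atlas V) (flat_atlas N) (\<lambda>y. y) ?x u = dN (s ?x) (mderiv (flat_atlas V) AP s ?x u)" for u
    by (rule mderiv_compose[OF FV P FN V(4) piN_smooth V(2)]) (use V(5) in simp)
  moreover have "mderiv (flat_atlas V) (flat_atlas N) (\<lambda>y. y) ?x u = u" for u
  proof -
    have "mderiv (flat_atlas V) (flat_atlas N) (\<lambda>y. y) ?x = frechet_derivative (chart_inv (V, \<lambda>x. x)) (at ?x)"
      using V piN_mem by (subst mderiv_flat) auto
    also have "\<dots> = frechet_derivative (\<lambda>x. x) (at ?x)"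
      by (rule frechet_derivative_cong_open[OF V(1,2)]) simp
    finally show ?thesis by simp
  qed
  ultimately have "u = dN p (mderiv AP AP (rot t) (s ?x) (mderiv (flat_atlas V) AP s ?x u))" for u
    using t by simp
  then show ?thesis by (rule surjI[OF sym])
qed

lemma dN_XP: "dN p (XP p) = 0"
proof -
  have "((\<lambda>t. piN (rot t p)) has_vector_derivative dN p (XP p)) (at 0)"
    using flow_curve[OF P FN rot piN_smooth N_chart, of p] piN_mem[of p]
    by (simp add: mderiv_eq)
  moreover have "piN (rot t p) = piN p" for t using piN_fibre[of p "rot t p"] by auto
  ultimately show ?thesis
    using vector_derivative_unique_at[OF _ has_vector_derivative_const] by simp
qed

lemma dQ_ZP: "dQ p (ZP p) = 0"
proof -
  have "((\<lambda>t. snd (chart_at AQ (piQ p)) (piQ (Psi t p))) has_vector_derivative dQ p (ZP p)) (at 0)"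
    unfolding mderiv_eq
    by (rule flow_curve[OF P Q Psi(1) piQ_smooth]) (use preferred_chart[OF Q] in auto)
  moreover have "piQ (Psi t p) = piQ p" for t using piQ_fibre[of p "Psi t p"] by auto
  ultimately show ?thesis
    using vector_derivative_unique_at[OF _ has_vector_derivative_const] by simp
qed

text \<open>The pair \<open>(dN, eta)\<close> is onto, by correcting a preimage under
  \<open>dN\<close> along \<open>XP\<close>, and both sides have real dimension
  \<open>4n + 1\<close>; so it is injective.\<close>

lemma horizontal_unique:
  assumes "eta p v = eta p w" "dN p v = dN p w"
  shows "v = w"
proof -
  let ?f = "\<lambda>v. (dN p v, eta p v)"
  have lin: "linear ?f"
    by (rule linearI) (simp_all add: linear_add[OF linear_dN] linear_scale[OF linear_dN] linear_add[OF linear_eta] linear_scale[OF linear_eta])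
  have "surj ?f"
  proof (rule surjI[where f = "\<lambda>(u, r). inv (dN p) u + (r - eta p (inv (dN p) u)) *\<^sub>R XP p"])
    fix z show "?f ((\<lambda>(u, r). inv (dN p) u + (r - eta p (inv (dN p) u)) *\<^sub>R XP p) z) = z"
      by (cases z) (simp add: linear_add[OF linear_dN] linear_scale[OF linear_dN] linear_add[OF linear_eta]
          linear_scale[OF linear_eta] dN_XP eta_XP surj_f_inv_f[OF surj_dN])
  qed
  then have "inj ?f"
    using linear_surjective_imp_injective[OF lin] by simp
  then show ?thesis using assms by (auto dest: injD)
qed

lemma lift_eq: "lift p (dN p v) = v - eta p v *\<^sub>R XP p"
  unfolding horizontal_lift_def
proof (rule the_equality)
  show h: "eta p (v - eta p v *\<^sub>R XP p) = 0 \<and> dN p (v - eta p v *\<^sub>R XP p) = dN p v"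
    by (simp add: linear_diff[OF linear_eta] linear_scale[OF linear_eta] eta_XP
      linear_diff[OF linear_dN] linear_scale[OF linear_dN] dN_XP)
  show "w = v - eta p v *\<^sub>R XP p" if "eta p w = 0 \<and> dN p w = dN p v" for w
    by (rule horizontal_unique[of p]) (use h that in simp_all)
qed

lemma lift: "eta p (lift p u) = 0" "dN p (lift p u) = u"
proof -
  obtain v where u: "u = dN p v" using surj_dN by (metis surjD)
  show "eta p (lift p u) = 0" "dN p (lift p u) = u"
    unfolding u lift_eq by (simp_all add: linear_diff[OF linear_eta] linear_scale[OF linear_eta] eta_XP
      linear_diff[OF linear_dN] linear_scale[OF linear_dN] dN_XP)
qed

lemma lift_eqI: "eta p v = 0 \<Longrightarrow> dN p v = u \<Longrightarrow> lift p u = v"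
  by (rule horizontal_unique[of p]) (simp_all add: lift)

lemma linear_lift: "linear (lift p)"
  by (rule linearI; rule lift_eqI)
    (simp_all add: lift linear_add[OF linear_dN] linear_scale[OF linear_dN] linear_add[OF linear_eta] linear_scale[OF linear_eta])

lemma ZP: "eta p (ZP p) = f_H i0 c (piN p)" "dN p (ZP p) = Z_field (piN p)"
  unfolding Psi(2) Z_P_def
  by (simp_all add: linear_add[OF linear_dN] linear_scale[OF linear_dN] linear_add[OF linear_eta]
    linear_scale[OF linear_eta] lift eta_XP dN_XP)

text \<open>\<open>ZP\<close> is vertical for \<open>piQ\<close>, so applying \<open>dQ\<close> to
  its decomposition into horizontal and fibre part relates the images of \<open>XP\<close> and of
  the lift of \<open>Z\<close>.\<close>

lemma dQ_XP: "dQ p (XP p) = - inverse (f_H i0 c (piN p)) *\<^sub>R T p (Z_field (piN p))"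
proof -
  have "0 = dQ p (lift p (Z_field (piN p)) + f_H i0 c (piN p) *\<^sub>R XP p)"
    using dQ_ZP[of p] unfolding Psi(2) Z_P_def by simp
  then have "f_H i0 c (piN p) *\<^sub>R dQ p (XP p) = - T p (Z_field (piN p))"
    unfolding twist_map_def by (simp add: linear_add[OF linear_dQ] linear_scale[OF linear_dQ] eq_neg_iff_add_eq_0 add.commute)
  then have "inverse (f_H i0 c (piN p)) *\<^sub>R f_H i0 c (piN p) *\<^sub>R dQ p (XP p) = - inverse (f_H i0 c (piN p)) *\<^sub>R T p (Z_field (piN p))"
    by simp
  then show ?thesis using f_H_piN[of p] by simp
qed

lemma linear_T: "linear (T p)"
  unfolding twist_map_def using linear_compose[OF linear_lift linear_dQ] by (simp add: o_def)

text \<open>Subtracting \<open>eta p v / f_H\<close> times \<open>ZP\<close> makes \<open>v\<close>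
  horizontal and leaves its image under \<open>dQ\<close> unchanged. The argument of
  \<open>T\<close> is therefore the inverse twist of \<open>dQ p v\<close>; this is the origin of
  the coframe used below.\<close>

lemma T_eq: "T p (dN p v - (eta p v / f_H i0 c (piN p)) *\<^sub>R Z_field (piN p)) = dQ p v"
proof -
  let ?k = "eta p v / f_H i0 c (piN p)"
  have "lift p (dN p v - ?k *\<^sub>R Z_field (piN p)) = v - ?k *\<^sub>R ZP p"
    by (rule lift_eqI) (use f_H_piN[of p] in \<open>simp_all add: linear_diff[OF linear_eta] linear_scale[OF linear_eta] ZP
      linear_diff[OF linear_dN] linear_scale[OF linear_dN]\<close>)
  then show ?thesis
    by (simp add: twist_map_def linear_diff[OF linear_dQ] linear_scale[OF linear_dQ] dQ_ZP)
qed

lemma surj_T: "surj (T p)"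
proof -
  have "\<xi> \<in> range (T p)" for \<xi>
    using T_eq[of p "inv (dQ p) \<xi>"] surj_f_inv_f[OF surj_dQ, of p \<xi>] by (metis rangeI)
  then show ?thesis by auto
qed

lemma inj_T: "inj (T p)"
  using linear_surjective_imp_injective[OF linear_T surj_T] by simp

text \<open>The projected curve solves the linear equation of \<open>Z\<close>. Undoing the rotation
  gives a curve with zero derivative, which settles uniqueness without a general theorem on
  differential equations.\<close>

lemma piN_Psi: "piN (Psi t p) = rotation t (piN p)"
proof -
  have Psi_add: "Psi (s + t) p = Psi s (Psi t p)" and Psi_0: "Psi 0 p = p" for s t p
    using Psi(1) unfolding smooth_flow_def by auto
  have d0: "((\<lambda>t. piN (Psi t p)) has_vector_derivative Z_field (piN p)) (at 0)" for p
    using flow_curve[OF P FN Psi(1) piN_smooth N_chart, of p] piN_mem[of p] ZP(2)[of p]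
    by (simp add: mderiv_eq)
  have d: "((\<lambda>t. piN (Psi t p)) has_vector_derivative Z_field (piN (Psi t p))) (at t)" for t
    by (rule has_vector_derivative_shift_0) (use d0[of "Psi t p"] in \<open>simp add: Psi_add[symmetric] add.commute\<close>)
  let ?v = "\<lambda>t. fst (piN (Psi t p))"
  have J: "bounded_linear J_M" using linear_J_M by (simp add: linear_conv_bounded_linear)
  have dv: "(?v has_vector_derivative - J_M (?v t)) (at t)" for t
    using bounded_linear.has_vector_derivative[OF bounded_linear_fst d] by (simp add: Z_field_def)
  have "((\<lambda>t. rotation (- t) (piN (Psi t p))) has_vector_derivative 0) (at t)" for t
  proof -
    have "((\<lambda>t. (cos t *\<^sub>R ?v t + sin t *\<^sub>R J_M (?v t), snd (piN (Psi t p)))) has_vector_derivative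
      ((cos t *\<^sub>R (- J_M (?v t)) + (- sin t) *\<^sub>R ?v t) + (sin t *\<^sub>R J_M (- J_M (?v t)) + cos t *\<^sub>R J_M (?v t)),
       snd (Z_field (piN (Psi t p))))) (at t)"
    proof (intro has_vector_derivative_Pair has_vector_derivative_add has_vector_derivative_scaleR dv
        bounded_linear.has_vector_derivative[OF bounded_linear_snd d] bounded_linear.has_vector_derivative[OF J dv])
      show "(cos has_field_derivative - sin t) (at t)" "(sin has_field_derivative cos t) (at t)"
        by (auto intro!: derivative_eq_intros)
    qed
    then show ?thesis by (simp add: rotation_def Z_field_def c_map_linear_simps zero_prod_def)
  qed
  from has_vector_derivative_zero_imp_const[OF this, of t 0]
  have "rotation (- t) (piN (Psi t p)) = piN p" by (simp add: Psi_0 rotation_def)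
  then show ?thesis using rotation_inverse[of t "piN (Psi t p)"] by simp
qed

lemma dN_Psi: "dN (Psi t p) (mderiv AP AP (Psi t) p \<xi>) = rotation t (dN p \<xi>)"
proof -
  let ?b = "chart_at AP p"
  have b: "?b \<in> AP" "p \<in> fst ?b" using preferred_chart[OF P] by auto
  let ?g = "\<lambda>x. piN (chart_inv ?b x)"
  have "dN (Psi t p) (mderiv AP AP (Psi t) p \<xi>) = mderiv AP (flat_atlas N) (\<lambda>p. piN (Psi t p)) p \<xi>"
    by (rule mderiv_compose[OF P P FN flow_smooth_map[OF P Psi(1)] piN_smooth, symmetric]) auto
  also have "\<dots> = frechet_derivative (\<lambda>x. rotation t (?g x)) (at (snd ?b p)) \<xi>"
    by (simp add: mderiv_flat piN_mem) (simp only: piN_Psi)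
  also have "\<dots> = rotation t (frechet_derivative ?g (at (snd ?b p)) \<xi>)"
  proof -
    have "(snd (N, \<lambda>x. x) \<circ> piN \<circ> chart_inv ?b) differentiable (at (snd ?b p))"
      by (rule differentiableI[OF chart_D_works[OF P FN piN_smooth b]]) (use piN_mem in \<open>auto simp: flat_atlas_def\<close>)
    then have "?g differentiable (at (snd ?b p))" by (simp add: o_def)
    moreover have "bounded_linear (rotation t :: 'n TM_dual \<Rightarrow> 'n TM_dual)"
      using linear_rotation by (simp add: linear_conv_bounded_linear)
    ultimately show ?thesis using frechet_derivative_bounded_linear by metis
  qed
  also have "frechet_derivative ?g (at (snd ?b p)) \<xi> = dN p \<xi>"
    by (simp add: mderiv_flat piN_mem)
  finally show ?thesis .
qed

end

section \<open>The third complex structure\<close>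

text \<open>For an almost complex structure which a coframe \<open>S\<close> turns into a constant one,
  the Nijenhuis tensor is expressed through \<open>E = dS\<close>.\<close>

lemma frame_torsion:
  fixes S :: "'e::euclidean_space \<Rightarrow> 'e \<Rightarrow> 'v::euclidean_space" and K :: "'e \<Rightarrow> 'e \<Rightarrow> 'e"
  assumes V: "open V" "y \<in> V"
    and S: "\<And>y. y \<in> V \<Longrightarrow> linear (S y)" "inj (S y)" "\<And>\<xi>. (\<lambda>y. S y \<xi>) differentiable (at y)"
    and K: "linear (K y)" "\<And>\<xi>. (\<lambda>y. K y \<xi>) differentiable (at y)"
    and I: "linear I" "\<And>u. I (I u) = - u" and rel: "\<And>y \<xi>. y \<in> V \<Longrightarrow> S y (K y \<xi>) = I (S y \<xi>)"
    and E_def: "\<And>\<xi> \<zeta>. E \<xi> \<zeta> = frechet_derivative (\<lambda>y. S y \<zeta>) (at y) \<xi> - frechet_derivative (\<lambda>y. S y \<xi>) (at y) \<zeta>"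
    and E: "E (K y u) (K y v) - I (E (K y u) v) - I (E u (K y v)) - E u v = 0"
  shows "lie_bracket (\<lambda>y. K y u) (\<lambda>y. K y v) y - K y (lie_bracket (\<lambda>y. K y u) (\<lambda>_. v) y)
    - K y (lie_bracket (\<lambda>_. u) (\<lambda>y. K y v) y) + K y (K y (lie_bracket (\<lambda>_. u) (\<lambda>_. v) y)) = 0"
    (is "?N = 0")
proof -
  define M where "M h \<xi> = frechet_derivative (\<lambda>y. S y \<xi>) (at y) h" for h \<xi>
  define D where "D h \<xi> = frechet_derivative (\<lambda>y. K y \<xi>) (at y) h" for h \<xi>
  have dS: "((\<lambda>y. S y \<xi>) has_derivative (\<lambda>h. M h \<xi>)) (at y)" for \<xi>
    using S(3) unfolding M_def frechet_derivative_works by simp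
  have dK: "((\<lambda>y. K y \<xi>) has_derivative (\<lambda>h. D h \<xi>)) (at y)" for \<xi>
    using K(2) unfolding D_def frechet_derivative_works by simp
  note lS = S(1)[OF V(2)]
  have bI: "bounded_linear I" using I(1) by (simp add: linear_conv_bounded_linear)
  \<comment> \<open>Differentiating the relation \<open>S (K \<xi>) = I (S \<xi>)\<close> expresses
    the derivative of \<open>K\<close> through that of \<open>S\<close>; only antisymmetrized
    derivatives of \<open>S\<close> survive in the Nijenhuis tensor.\<close>
  have key: "S y (D h \<xi>) = I (M h \<xi>) - M h (K y \<xi>)" for h \<xi>
  proof -
    have 1: "((\<lambda>y. S y (K y \<xi>)) has_derivative (\<lambda>h. M h (K y \<xi>) + S y (D h \<xi>))) (at y)"
      by (rule has_derivative_apply_linear[OF V S(1) dS dK])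
    have "((\<lambda>y. I (S y \<xi>)) has_derivative (\<lambda>h. I (M h \<xi>))) (at y)"
      by (rule bounded_linear.has_derivative[OF bI dS])
    then have "((\<lambda>y. S y (K y \<xi>)) has_derivative (\<lambda>h. I (M h \<xi>))) (at y)"
      by (rule has_derivative_transform_within_open[OF _ V]) (simp add: rel)
    from has_derivative_unique[OF 1 this] have "M h (K y \<xi>) + S y (D h \<xi>) = I (M h \<xi>)" by meson
    then show ?thesis by (simp add: algebra_simps)
  qed
  have N: "?N = D (K y u) v - D (K y v) u + K y (D v u) - K y (D u v)"
    unfolding lie_bracket_def D_def
    by (simp add: frechet_derivative_const linear_diff[OF K(1)] linear_0[OF K(1)] linear_neg[OF K(1)])
  have E': "E \<xi> \<zeta> = M \<xi> \<zeta> - M \<zeta> \<xi>" for \<xi> \<zeta> unfolding E_def M_def ..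
  have "S y ?N = - (E (K y u) (K y v) - I (E (K y u) v) - I (E u (K y v)) - E u v)"
    unfolding N E' by (simp add: linear_add[OF lS] linear_diff[OF lS] rel[OF V(2)] key linear_diff[OF I(1)] I(2))
  then have "S y ?N = S y 0" unfolding E by (simp add: linear_0[OF lS])
  then show ?thesis by (rule injD[OF S(2)])
qed

context c_map_twist
begin

lemma mext_d_eta: "mext_d AP eta p u v = omega_H i0 (piN p) (dN p u) (dN p v)"
  by (rule curvature[unfolded has_curvature_def, rule_format])

text \<open>The infinitesimal form \<open>L\<^bsub>Z_P\<^esub> \<eta> = 0\<close>. It is obtained by pulling \<open>d\<eta>\<close> back
  along the flow map \<open>(t, x) \<mapsto> \<Psi>\<^sub>t x\<close> and using \<open>\<eta>(Z_P) = f\<^sub>H\<close> and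
  \<open>df\<^sub>H = -\<iota>\<^sub>Z \<omega>\<^sub>H\<close>.\<close>

lemma eta_Psi_derivative_0:
  "((\<lambda>t. eta (Psi t p) (mderiv AP AP (Psi t) p \<xi>)) has_vector_derivative 0) (at 0)"
proof -
  let ?b = "chart_at AP p"
  have b: "?b \<in> AP" "p \<in> fst ?b" using preferred_chart[OF P] by auto
  note bc = manifold_chart[OF P b(1)]
  define x0 where "x0 = snd ?b p"
  define W where "W = snd ?b ` fst ?b"
  define S where "S = {(t, x). x \<in> snd ?b ` fst ?b \<and> Psi t (chart_inv ?b x) \<in> fst ?b}"
  define F where "F = (\<lambda>(t, x). snd ?b (Psi t (chart_inv ?b x)))"
  define \<alpha> where "\<alpha> = one_form_in AP ?b eta"
  define \<gamma> where "\<gamma> z \<zeta> = \<alpha> (F z) (frechet_derivative F (at z) \<zeta>)" for z \<zeta>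
  have Psi_0: "Psi 0 q = q" for q using Psi(1) unfolding smooth_flow_def by auto
  have S: "open S" "smooth_on S F"
    using flow_rep[OF P Psi(1) b(1) b(1)] unfolding S_def F_def by auto
  have W: "open W" "x0 \<in> W" unfolding W_def x0_def using chart_open(2)[OF bc] b by auto
  have inv: "chart_inv ?b x \<in> fst ?b" "snd ?b (chart_inv ?b x) = x" if "x \<in> W" for x
    using that chart_inv_mem[of x ?b] chart_inv_right[of x ?b] unfolding W_def by auto
  have S0: "(0, x) \<in> S" if "x \<in> W" for x
    using that inv[OF that] unfolding S_def W_def by (simp add: Psi_0)
  have F0: "F (0, x) = x" if "x \<in> W" for x
    using inv[OF that] by (simp add: F_def Psi_0)
  have FW: "F ` S \<subseteq> W" unfolding F_def S_def W_def by auto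
  have \<alpha>: "smooth_on W (\<lambda>x. \<alpha> x u)" for u
    using eta_smooth b(1) unfolding smooth_one_form_def \<alpha>_def W_def by blast
  have lin\<alpha>: "linear (\<alpha> x)" if "x \<in> W" for x
    unfolding \<alpha>_def one_form_in_def
    using linear_compose[OF linear_tangent_of[OF P b(1) inv(1)[OF that]] linear_eta] by (simp add: o_def)
  have dF: "(F has_derivative frechet_derivative F (at z)) (at z)" if "z \<in> S" for z
    by (rule smooth_on_has_derivative[OF S(2) that])
  have F_fst: "frechet_derivative F (at (0, x)) (1, 0) = components AP ?b (chart_inv ?b x) (ZP (chart_inv ?b x))"
    if "x \<in> W" for x
  proof -
    have "((\<lambda>t. snd ?b (Psi t (chart_inv ?b x))) has_vector_derivative
        components AP ?b (chart_inv ?b x) (ZP (chart_inv ?b x))) (at 0)"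
      unfolding components_eq
      by (rule flow_curve[OF P P Psi(1) smooth_map_ident[OF P] b(1) inv(1)[OF that]])
    moreover have "((\<lambda>t. snd ?b (Psi t (chart_inv ?b x))) has_vector_derivative
        frechet_derivative F (at (0, x)) (1, 0)) (at 0)"
      using has_vector_derivative_partial_fst[OF dF[OF S0[OF that]]] by (simp add: F_def)
    ultimately show ?thesis by (rule vector_derivative_unique_at[symmetric])
  qed
  have F_snd: "frechet_derivative F (at (t, x0)) (0, \<xi>) = chart_D ?b ?b (Psi t) p \<xi>" if "(t, x0) \<in> S" for t
    using fun_cong[OF frechet_derivative_at[OF has_derivative_partial_snd[OF dF[OF that]]], of \<xi>]
    by (simp add: F_def chart_D_def o_def x0_def)
  have ip: "chart_inv ?b x0 = p" unfolding x0_def by (rule chart_inv_left[OF bc b(2)])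
  have \<gamma>1: "\<gamma> (t, x0) (0, \<xi>) = eta (Psi t p) (mderiv AP AP (Psi t) p \<xi>)" if "(t, x0) \<in> S" for t
  proof -
    have m: "Psi t p \<in> fst ?b" using that ip by (simp add: S_def)
    have "F (t, x0) = snd ?b (Psi t p)" by (simp add: F_def ip)
    then have "\<gamma> (t, x0) (0, \<xi>) = eta (Psi t p) (tangent_of AP ?b (Psi t p) (chart_D ?b ?b (Psi t) p \<xi>))"
      unfolding \<gamma>_def F_snd[OF that] by (simp add: \<alpha>_def one_form_in_def chart_inv_left[OF bc m])
    also have "\<dots> = eta (Psi t p) (mderiv AP AP (Psi t) p \<xi>)"
      using tangent_of_chart_D[OF P P flow_smooth_map[OF P Psi(1)] b b(1) m] tangent_of_preferred[OF P] by simp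
    finally show ?thesis .
  qed
  have \<gamma>2: "\<gamma> (0, x) (1, 0) = f_H i0 c (piN (chart_inv ?b x))" if "x \<in> W" for x
    unfolding \<gamma>_def F0[OF that] F_fst[OF that]
    by (simp add: \<alpha>_def one_form_in_def tangent_of_components[OF P b(1) inv(1)[OF that]] ZP)
  have d\<gamma>: "((\<lambda>z. \<gamma> z v) has_derivative frechet_derivative (\<lambda>z. \<gamma> z v) (at (0, x0))) (at (0, x0))" for v
  proof (rule smooth_on_has_derivative[OF _ S0[OF W(2)]])
    show "smooth_on S (\<lambda>z. \<gamma> z v)"
      unfolding \<gamma>_def
      by (rule smooth_on_has_derivative_apply[OF S(1) smooth_on_compose[OF S(1) W(1) FW \<alpha> S(2)] lin\<alpha> smooth_on_frechet[OF S(2)]])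
        (use FW in auto)
  qed
  define a' where "a' = frechet_derivative (\<lambda>z. \<gamma> z (0, \<xi>)) (at (0, x0)) (1, 0)"
  define m where "m = g_M i0 (fst (piN p)) (fst (dN p \<xi>))"
  have open_t: "open {t. (t, x0) \<in> S}"
    using open_vimage[OF S(1), of "\<lambda>t. (t, x0)"] by (simp add: vimage_def continuous_on_Pair)
  have a': "((\<lambda>t. eta (Psi t p) (mderiv AP AP (Psi t) p \<xi>)) has_vector_derivative a') (at 0)"
    unfolding a'_def
    by (rule has_vector_derivative_transform_within_open[OF has_vector_derivative_partial_fst[OF d\<gamma>] open_t])
      (use S0[OF W(2)] \<gamma>1 in auto)
  \<comment> \<open>At time 0 the \<open>dt\<close>-component of the pulled-back form is
    \<open>eta (ZP) = f_H\<close>, so its derivative along \<open>\<xi>\<close> is the differential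
    of \<open>f_H\<close>.\<close>
  have "frechet_derivative (\<lambda>z. \<gamma> z (1, 0)) (at (0, x0)) (0, \<xi>) = m"
  proof -
    have "((\<lambda>x. \<gamma> (0, x) (1, 0)) has_derivative (\<lambda>h. frechet_derivative (\<lambda>z. \<gamma> z (1, 0)) (at (0, x0)) (0, h))) (at x0)"
      by (rule has_derivative_partial_snd[OF d\<gamma>])
    then have 1: "((\<lambda>x. f_H i0 c (piN (chart_inv ?b x))) has_derivative (\<lambda>h. frechet_derivative (\<lambda>z. \<gamma> z (1, 0)) (at (0, x0)) (0, h))) (at x0)"
      by (rule has_derivative_transform_within_open[OF _ W]) (rule \<gamma>2)
    have "((\<lambda>x. piN (chart_inv ?b x)) has_derivative dN p) (at x0)"
      using chart_D_works[OF P FN piN_smooth b N_chart] piN_mem[of p]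
      by (simp add: o_def x0_def mderiv_eq)
    from diff_chain_at[OF this f_H_has_derivative]
    have "((\<lambda>x. f_H i0 c (piN (chart_inv ?b x))) has_derivative (\<lambda>h. g_M i0 (fst (piN p)) (fst (dN p h)))) (at x0)"
      by (simp add: o_def ip)
    from has_derivative_unique[OF 1 this] show ?thesis unfolding m_def by meson
  qed
  then have "ext_d \<gamma> (0, x0) (1, 0) (0, \<xi>) = a' - m"
    unfolding ext_d_def a'_def by simp
  \<comment> \<open>Naturality evaluates the same exterior derivative as
    \<open>d\<eta>(Z_P, \<xi>)\<close>, and the curvature turns it into \<open>omega_H\<close> of
    \<open>Z\<close> and the projection of \<open>\<xi>\<close>. Comparison with
    \<open>a' - m\<close> leaves \<open>a' = 0\<close>.\<close>
  moreover have "ext_d \<gamma> (0, x0) (1, 0) (0, \<xi>) = - m"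
  proof -
    have "ext_d \<gamma> (0, x0) (1, 0) (0, \<xi>) = ext_d \<alpha> (F (0, x0)) (frechet_derivative F (at (0, x0)) (1, 0)) (frechet_derivative F (at (0, x0)) (0, \<xi>))"
      unfolding \<gamma>_def by (rule ext_d_pullback[OF S(1) S0[OF W(2)] W(1) FW S(2) lin\<alpha> \<alpha>])
    also have "frechet_derivative F (at (0, x0)) (1, 0) = ZP p"
      unfolding F_fst[OF W(2)] ip by (rule components_preferred[OF P UNIV_I])
    also have "frechet_derivative F (at (0, x0)) (0, \<xi>) = \<xi>"
    proof -
      have "((\<lambda>x. F (0, x)) has_derivative (\<lambda>h. frechet_derivative F (at (0, x0)) (0, h))) (at x0)"
        by (rule has_derivative_partial_snd[OF dF[OF S0[OF W(2)]]])
      then have "((\<lambda>x. x) has_derivative (\<lambda>h. frechet_derivative F (at (0, x0)) (0, h))) (at x0)"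
        by (rule has_derivative_transform_within_open[OF _ W]) (rule F0)
      from has_derivative_unique[OF this has_derivative_ident] show ?thesis by meson
    qed
    also have "ext_d \<alpha> (F (0, x0)) (ZP p) \<xi> = mext_d AP eta p (ZP p) \<xi>"
      using F0[OF W(2)] by (simp add: mext_d_def \<alpha>_def x0_def)
    also have "\<dots> = omega_H i0 (piN p) (Z_field (piN p)) (dN p \<xi>)"
      by (simp add: mext_d_eta ZP)
    also have "\<dots> = - m"
      by (simp add: omega_H_eq m_def g_N_eq I_hat_def Z_field_def c_map_linear_simps g_M_linear_simps)
    finally show ?thesis .
  qed
  ultimately have "a' = 0" by simp
  then show ?thesis using a' by simp
qed

lemma Psi_add: "Psi (s + t) p = Psi s (Psi t p)" and Psi_0: "Psi 0 p = p"
  using Psi(1) unfolding smooth_flow_def by auto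

text \<open>The group law moves the vanishing derivative from time 0 at \<open>Psi t p\<close> to
  time \<open>t\<close> at \<open>p\<close>, so the function of time is constant.\<close>

lemma eta_Psi: "eta (Psi t p) (mderiv AP AP (Psi t) p \<xi>) = eta p \<xi>"
proof -
  let ?a = "\<lambda>t. eta (Psi t p) (mderiv AP AP (Psi t) p \<xi>)"
  have "(?a has_vector_derivative 0) (at t)" for t
  proof (rule has_vector_derivative_shift_0)
    have "mderiv AP AP (Psi (t + h)) p \<xi> = mderiv AP AP (Psi h) (Psi t p) (mderiv AP AP (Psi t) p \<xi>)" for h
      by (rule mderiv_compose[OF P P P flow_smooth_map[OF P Psi(1)] flow_smooth_map[OF P Psi(1)]])
        (simp_all add: Psi_add[symmetric] add.commute)
    moreover have "Psi (t + h) p = Psi h (Psi t p)" for h by (simp add: Psi_add[symmetric] add.commute)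
    ultimately show "((\<lambda>h. ?a (t + h)) has_vector_derivative 0) (at 0)"
      using eta_Psi_derivative_0[of "Psi t p" "mderiv AP AP (Psi t) p \<xi>"] by simp
  qed
  from has_vector_derivative_zero_imp_const[OF this, of t 0]
  have "?a t = ?a 0" .
  also have "mderiv AP AP (Psi 0) p \<xi> = \<xi>"
  proof -
    have "Psi 0 = (\<lambda>q. q)" by (rule ext) (rule Psi_0)
    then show ?thesis using mderiv_ident[OF P UNIV_I] by simp
  qed
  finally show ?thesis by (simp add: Psi_0)
qed

text \<open>The flow map sends horizontal lifts to horizontal lifts, because it preserves
  \<open>eta\<close> and covers the rotation; and \<open>piQ\<close> is constant along it.\<close>

lemma T_Psi: "T (Psi t p) (rotation t u) = T p u"
proof -
  have "lift (Psi t p) (rotation t u) = mderiv AP AP (Psi t) p (lift p u)"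
    by (rule lift_eqI) (simp_all add: eta_Psi dN_Psi lift)
  moreover have "dQ p \<xi> = dQ (Psi t p) (mderiv AP AP (Psi t) p \<xi>)" for \<xi>
    by (rule mderiv_compose[OF P P Q flow_smooth_map[OF P Psi(1)] piQ_smooth])
      (use piQ_fibre in auto)
  ultimately show ?thesis by (simp add: twist_map_def)
qed

text \<open>The choice of \<open>p\<close> in its fibre is irrelevant by \<open>T_Psi\<close>.\<close>

definition J_hat :: "'q \<Rightarrow> 'n R4n \<Rightarrow> 'n R4n" where
  "J_hat q u = (let p = SOME p. piQ p = q in T p (I_hat (inv (T p) u)))"

text \<open>The chosen point of the fibre is some \<open>Psi t p\<close>, for which the inverse
  twist differs by \<open>rotation t\<close>. As a linear map commuting with \<open>I_hat\<close>,
  the rotation cancels.\<close>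

lemma J_hat_T: "J_hat (piQ p) (T p u) = T p (I_hat u)"
proof -
  define p' where "p' = (SOME p'. piQ p' = piQ p)"
  have "piQ p' = piQ p" unfolding p'_def by (rule someI[of _ p]) simp
  then obtain t where t: "p' = Psi t p" using piQ_fibre[of p p'] by auto
  have "inv (T p') (T p u) = rotation t u"
    unfolding t using T_Psi[of t p u] inj_T[of "Psi t p"] by (metis inv_f_f)
  then have "J_hat (piQ p) (T p u) = T (Psi t p) (rotation t (I_hat u))"
    unfolding J_hat_def p'_def[symmetric] Let_def by (simp add: rotation_I_hat t)
  then show ?thesis by (simp add: T_Psi)
qed

lemma linear_J_hat: "linear (J_hat q)"
proof -
  obtain p where q: "q = piQ p" using surj_piQ by (metis surjD)
  have "\<exists>u. \<xi> = T p u" for \<xi> using surj_T by (metis surjD)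
  show ?thesis unfolding q
  proof (rule linearI)
    fix a b :: "'n R4n" and r :: real
    obtain u v where uv: "a = T p u" "b = T p v" using surj_T by (metis surjD)
    show "J_hat (piQ p) (a + b) = J_hat (piQ p) a + J_hat (piQ p) b"
      unfolding uv linear_add[OF linear_T, symmetric] J_hat_T
      by (simp add: linear_add[OF linear_T] linear_add[OF linear_I_hat])
    show "J_hat (piQ p) (r *\<^sub>R a) = r *\<^sub>R J_hat (piQ p) a"
      unfolding uv linear_scale[OF linear_T, symmetric] J_hat_T
      by (simp add: linear_scale[OF linear_T] linear_scale[OF linear_I_hat])
  qed
qed

lemma J_hat_J_hat: "J_hat q (J_hat q u) = - u"
proof -
  obtain p where q: "q = piQ p" using surj_piQ by (metis surjD)
  obtain v where u: "u = T p v" using surj_T by (metis surjD)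
  show ?thesis unfolding q u J_hat_T by (simp add: linear_neg[OF linear_T])
qed

end

section \<open>Local sections of the quotient and the coframe\<close>

context c_map_twist
begin

text \<open>The section lands in the preferred chart of \<open>p0\<close> and passes through
  \<open>p0\<close>, since this is the only place where the curvature hypothesis can be read in that
  chart.\<close>

lemma local_section:
  assumes d: "d \<in> AQ" "piQ p0 \<in> fst d"
  defines "b \<equiv> chart_at AP p0"
  obtains V \<sigma> where "open V" "snd d (piQ p0) \<in> V" "V \<subseteq> snd d ` fst d" "smooth_on V \<sigma>"
    "\<sigma> ` V \<subseteq> snd b ` fst b" "\<sigma> (snd d (piQ p0)) = snd b p0"
    "\<And>y. y \<in> V \<Longrightarrow> piQ (chart_inv b (\<sigma> y)) \<in> fst d"
    "\<And>y. y \<in> V \<Longrightarrow> snd d (piQ (chart_inv b (\<sigma> y))) = y"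
proof -
  have b: "b \<in> AP" "p0 \<in> fst b" unfolding b_def using preferred_chart[OF P] by auto
  note bc = manifold_chart[OF P b(1)] and dc = manifold_chart[OF Q d(1)]
  define W where "W = snd b ` (fst b \<inter> piQ -` fst d)"
  have W: "open W" "smooth_on W (snd d \<circ> piQ \<circ> chart_inv b)"
    unfolding W_def by (rule smooth_map_rep[OF P Q piQ_smooth b(1) d(1)])+
  have x0: "snd b p0 \<in> W" unfolding W_def using b d by auto
  have D: "frechet_derivative (snd d \<circ> piQ \<circ> chart_inv b) (at (snd b p0)) u = components AQ d (piQ p0) (dQ p0 u)" for u
    using chart_D_eq[OF P Q piQ_smooth b d, of u] tangent_of_preferred[OF P UNIV_I, of p0 u]
    by (simp add: chart_D_def b_def)
  have "surj (frechet_derivative (snd d \<circ> piQ \<circ> chart_inv b) (at (snd b p0)))"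
  proof (rule surjI[where f = "\<lambda>\<xi>. inv (dQ p0) (tangent_of AQ d (piQ p0) \<xi>)"])
    show "frechet_derivative (snd d \<circ> piQ \<circ> chart_inv b) (at (snd b p0)) (inv (dQ p0) (tangent_of AQ d (piQ p0) \<xi>)) = \<xi>" for \<xi>
      unfolding D by (simp add: surj_f_inv_f[OF surj_dQ] components_tangent_of[OF Q d])
  qed
  from smooth_local_section[OF W(1) x0 W(2) this]
  obtain V \<sigma> where V: "open V" "(snd d \<circ> piQ \<circ> chart_inv b) (snd b p0) \<in> V" "smooth_on V \<sigma>" "\<sigma> ` V \<subseteq> W"
    "\<sigma> ((snd d \<circ> piQ \<circ> chart_inv b) (snd b p0)) = snd b p0"
    "\<And>y. y \<in> V \<Longrightarrow> (snd d \<circ> piQ \<circ> chart_inv b) (\<sigma> y) = y" by blast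
  have f0: "(snd d \<circ> piQ \<circ> chart_inv b) (snd b p0) = snd d (piQ p0)"
    by (simp add: chart_inv_left[OF bc b(2)])
  have m: "piQ (chart_inv b (\<sigma> y)) \<in> fst d" if "y \<in> V" for y
  proof -
    have "\<sigma> y \<in> W" using V(4) that by blast
    then obtain q where "q \<in> fst b" "piQ q \<in> fst d" "\<sigma> y = snd b q" unfolding W_def by auto
    then show ?thesis by (simp add: chart_inv_left[OF bc])
  qed
  show ?thesis
  proof (rule that[OF V(1) _ _ V(3)])
    show "V \<subseteq> snd d ` fst d"
    proof
      fix y assume y: "y \<in> V"
      then have "y = snd d (piQ (chart_inv b (\<sigma> y)))" using V(6)[OF y] by simp
      then show "y \<in> snd d ` fst d" using m[OF y] by blast
    qed
    show "\<sigma> ` V \<subseteq> snd b ` fst b" using V(4) unfolding W_def by auto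
  qed (use V f0 m in simp_all)
qed

text \<open>For a local section \<open>\<sigma>\<close> of \<open>piQ\<close>, \<open>pr\<close> is \<open>piN \<circ> \<sigma>\<close>, \<open>\<beta>\<close> is
  \<open>\<sigma>\<^sup>*\<eta>\<close> and \<open>S\<close> is the inverse of the twist map along \<open>\<sigma>\<close>. The curvature identity is
  claimed at the centre only, because the exterior derivative on \<open>P\<close> is taken in the preferred
  chart of that one point.\<close>

lemma local_frame:
  assumes d: "d \<in> AQ" "q0 \<in> fst d"
  obtains V S \<beta> pr where "open V" "snd d q0 \<in> V" "V \<subseteq> snd d ` fst d"
    "smooth_on V pr" "\<And>y. y \<in> V \<Longrightarrow> pr y \<in> N" "\<And>\<xi>. smooth_on V (\<lambda>y. \<beta> y \<xi> :: real)"
    "\<And>y \<xi>. S y \<xi> = frechet_derivative pr (at y) \<xi> - (\<beta> y \<xi> / f_H i0 c (pr y)) *\<^sub>R Z_field (pr y)"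
    "\<And>y. y \<in> V \<Longrightarrow> linear (S y)" "\<And>y. y \<in> V \<Longrightarrow> inj (S y)"
    "\<And>y \<xi>. y \<in> V \<Longrightarrow> S y (endo_in AQ d J_hat y \<xi>) = I_hat (S y \<xi>)"
    "\<And>\<xi> \<zeta>. ext_d \<beta> (snd d q0) \<xi> \<zeta> = omega_H i0 (pr (snd d q0))
       (frechet_derivative pr (at (snd d q0)) \<xi>) (frechet_derivative pr (at (snd d q0)) \<zeta>)"
proof -
  obtain p0 where q0: "q0 = piQ p0" using surj_piQ by (metis surjD)
  define b where "b = chart_at AP p0"
  have b: "b \<in> AP" "p0 \<in> fst b" unfolding b_def using preferred_chart[OF P] by auto
  note bc = manifold_chart[OF P b(1)] and dc = manifold_chart[OF Q d(1)]
  obtain V \<sigma> where V: "open V" "snd d (piQ p0) \<in> V" "V \<subseteq> snd d ` fst d" "smooth_on V \<sigma>"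
    "\<sigma> ` V \<subseteq> snd b ` fst b" "\<sigma> (snd d (piQ p0)) = snd b p0"
    and sd: "\<And>y. y \<in> V \<Longrightarrow> piQ (chart_inv b (\<sigma> y)) \<in> fst d"
    and sid: "\<And>y. y \<in> V \<Longrightarrow> snd d (piQ (chart_inv b (\<sigma> y))) = y"
    using local_section[OF d(1), of p0] d(2) unfolding q0 b_def by blast
  define W where "W = snd b ` fst b"
  define pl where "pl x = piN (chart_inv b x)" for x
  define pr where "pr y = pl (\<sigma> y)" for y
  define \<alpha> where "\<alpha> = one_form_in AP b eta"
  define \<beta> where "\<beta> y \<xi> = \<alpha> (\<sigma> y) (frechet_derivative \<sigma> (at y) \<xi>)" for y \<xi>
  define S where "S y \<xi> = frechet_derivative pr (at y) \<xi> - (\<beta> y \<xi> / f_H i0 c (pr y)) *\<^sub>R Z_field (pr y)" for y \<xi>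
  define pp where "pp y = chart_inv b (\<sigma> y)" for y
  have W: "open W" "\<sigma> ` V \<subseteq> W" unfolding W_def using chart_open(2)[OF bc] V(5) by auto
  have pp: "pp y \<in> fst b" "snd b (pp y) = \<sigma> y" if "y \<in> V" for y
    using that V(5) chart_inv_mem[of "\<sigma> y" b] chart_inv_right[of "\<sigma> y" b] unfolding pp_def by auto
  have pl: "smooth_on W pl"
  proof -
    have "fst b \<inter> piN -` fst (N, \<lambda>x. x) = fst b" using piN_mem by auto
    then show ?thesis
      using smooth_map_rep(2)[OF P FN piN_smooth b(1) N_chart] unfolding W_def pl_def by (simp add: o_def)
  qed
  have pr: "smooth_on V pr"
    unfolding pr_def by (rule smooth_on_compose[OF V(1) W(1) W(2) pl V(4)])
  have \<alpha>: "smooth_on W (\<lambda>x. \<alpha> x u)" for u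
    using eta_smooth b(1) unfolding smooth_one_form_def \<alpha>_def W_def by blast
  have lin\<alpha>: "linear (\<alpha> x)" if "x \<in> W" for x
    unfolding \<alpha>_def one_form_in_def
    using linear_compose[OF linear_tangent_of[OF P b(1) chart_inv_mem] linear_eta] that by (simp add: o_def W_def)
  have \<beta>: "smooth_on V (\<lambda>y. \<beta> y \<xi>)" for \<xi>
    unfolding \<beta>_def
    by (rule smooth_on_has_derivative_apply[OF V(1) smooth_on_compose[OF V(1) W(1) W(2) \<alpha> V(4)] lin\<alpha> smooth_on_frechet[OF V(4)]])
      (use W in auto)
  have d\<sigma>: "(\<sigma> has_derivative frechet_derivative \<sigma> (at y)) (at y)" if "y \<in> V" for y
    by (rule smooth_on_has_derivative[OF V(4) that])
  have dpr: "frechet_derivative pr (at y) \<xi> = dN (pp y) (tangent_of AP b (pp y) (frechet_derivative \<sigma> (at y) \<xi>))"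
    if y: "y \<in> V" for y \<xi>
  proof -
    have "(pl has_derivative chart_D b (N, \<lambda>x. x) piN (pp y)) (at (\<sigma> y))"
      using chart_D_works[OF P FN piN_smooth b(1) pp(1)[OF y] N_chart] piN_mem[of "pp y"]
      unfolding pp(2)[OF y] by (simp add: pl_def[abs_def] o_def)
    note e = frechet_derivative_at[OF diff_chain_at[OF d\<sigma>[OF y] this]]
    have "pl \<circ> \<sigma> = pr" by (simp add: fun_eq_iff pr_def)
    with e have "frechet_derivative pr (at y) = chart_D b (N, \<lambda>x. x) piN (pp y) \<circ> frechet_derivative \<sigma> (at y)"
      by (simp only:)
    then have "frechet_derivative pr (at y) \<xi> = chart_D b (N, \<lambda>x. x) piN (pp y) (frechet_derivative \<sigma> (at y) \<xi>)"
      by simp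
    also have "\<dots> = tangent_of (flat_atlas N) (N, \<lambda>x. x) (piN (pp y)) \<dots>"
      using tangent_of_preferred[OF FN piN_mem, of "pp y"] piN_mem[of "pp y"] by simp
    also have "\<dots> = dN (pp y) (tangent_of AP b (pp y) (frechet_derivative \<sigma> (at y) \<xi>))"
      by (rule tangent_of_chart_D[OF P FN piN_smooth b(1) pp(1)[OF y] N_chart]) (simp add: piN_mem)
    finally show ?thesis .
  qed
  \<comment> \<open>This is \<open>T_eq\<close> for the image of \<open>\<xi>\<close> under the
    differential of the section, which projects back to \<open>\<xi>\<close>. So \<open>S\<close>
    inverts the twist map, and its relation to \<open>J_hat\<close> and its injectivity
    follow.\<close>
  have T_S: "T (pp y) (S y \<xi>) = tangent_of AQ d (piQ (pp y)) \<xi>" if y: "y \<in> V" for y \<xi>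
  proof -
    let ?\<zeta> = "tangent_of AP b (pp y) (frechet_derivative \<sigma> (at y) \<xi>)"
    have "\<beta> y \<xi> = eta (pp y) ?\<zeta>"
      unfolding \<beta>_def \<alpha>_def one_form_in_def pp_def ..
    then have "T (pp y) (S y \<xi>) = dQ (pp y) ?\<zeta>"
      unfolding T_eq[symmetric] S_def dpr[OF y] by (simp add: pr_def pl_def pp_def)
    also have "\<dots> = tangent_of AQ d (piQ (pp y)) (chart_D b d piQ (pp y) (frechet_derivative \<sigma> (at y) \<xi>))"
      by (rule tangent_of_chart_D[OF P Q piQ_smooth b(1) pp(1)[OF y] d(1), symmetric]) (use sd[OF y] in \<open>simp add: pp_def\<close>)
    also have "chart_D b d piQ (pp y) (frechet_derivative \<sigma> (at y) \<xi>) = \<xi>"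
    proof -
      have "(snd d \<circ> piQ \<circ> chart_inv b has_derivative chart_D b d piQ (pp y)) (at (\<sigma> y))"
        using chart_D_works[OF P Q piQ_smooth b(1) pp(1)[OF y] d(1)] sd[OF y]
        unfolding pp(2)[OF y] by (simp add: pp_def)
      from diff_chain_at[OF d\<sigma>[OF y] this]
      have "((\<lambda>y. y) has_derivative chart_D b d piQ (pp y) \<circ> frechet_derivative \<sigma> (at y)) (at y)"
        by (rule has_derivative_transform_within_open[OF _ V(1) y]) (simp add: sid)
      from has_derivative_unique[OF this has_derivative_ident] show ?thesis by (metis comp_apply)
    qed
    finally show ?thesis .
  qed
  have piQ_pp: "chart_inv d y = piQ (pp y)" if "y \<in> V" for y
    using chart_inv_left[OF dc sd[OF that]] sid[OF that] by (simp add: pp_def)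
  have dpp: "piQ (pp y) \<in> fst d" if "y \<in> V" for y using sd[OF that] by (simp add: pp_def)
  have linS: "linear (S y)" if y: "y \<in> V" for y
  proof -
    have "\<sigma> y \<in> W" using W(2) y by auto
    from linear_compose[OF has_derivative_linear[OF d\<sigma>[OF y]] lin\<alpha>[OF this]]
    have "linear (\<beta> y)" by (simp add: \<beta>_def[abs_def] o_def)
    then show ?thesis using smooth_on_linear_frechet[OF pr y] unfolding S_def
      by (intro linearI) (simp_all add: linear_add linear_scale algebra_simps add_divide_distrib scaleR_add_left)
  qed
  have rel: "S y (endo_in AQ d J_hat y \<xi>) = I_hat (S y \<xi>)" if y: "y \<in> V" for y \<xi>
  proof -
    have "T (pp y) (S y (endo_in AQ d J_hat y \<xi>)) = J_hat (piQ (pp y)) (T (pp y) (S y \<xi>))"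
      unfolding T_S[OF y] endo_in_def piQ_pp[OF y] tangent_of_components[OF Q d(1) dpp[OF y]] ..
    also have "\<dots> = T (pp y) (I_hat (S y \<xi>))" by (rule J_hat_T)
    finally show ?thesis by (rule injD[OF inj_T])
  qed
  have injS: "inj (S y)" if y: "y \<in> V" for y
  proof (rule injI)
    fix \<xi> \<zeta> assume "S y \<xi> = S y \<zeta>"
    then have "tangent_of AQ d (piQ (pp y)) \<xi> = tangent_of AQ d (piQ (pp y)) \<zeta>"
      using T_S[OF y, of \<xi>] T_S[OF y, of \<zeta>] by simp
    then show "\<xi> = \<zeta>" using components_tangent_of[OF Q d(1) dpp[OF y]] by metis
  qed
  have y0: "snd d q0 \<in> V" using V(2) by (simp add: q0)
  have pp0: "pp (snd d q0) = p0" unfolding pp_def q0 V(6) by (rule chart_inv_left[OF bc b(2)])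
  have curv: "ext_d \<beta> (snd d q0) \<xi> \<zeta> = omega_H i0 (pr (snd d q0))
       (frechet_derivative pr (at (snd d q0)) \<xi>) (frechet_derivative pr (at (snd d q0)) \<zeta>)" for \<xi> \<zeta>
  proof -
    let ?D = "frechet_derivative \<sigma> (at (snd d q0))"
    have "ext_d \<beta> (snd d q0) \<xi> \<zeta> = ext_d \<alpha> (\<sigma> (snd d q0)) (?D \<xi>) (?D \<zeta>)"
      unfolding \<beta>_def by (rule ext_d_pullback[OF V(1) y0 W(1) W(2) V(4) lin\<alpha> \<alpha>])
    also have "\<dots> = mext_d AP eta p0 (?D \<xi>) (?D \<zeta>)"
      unfolding mext_d_def \<alpha>_def b_def[symmetric] using V(6) by (simp add: q0)
    also have "\<dots> = omega_H i0 (piN p0) (dN p0 (?D \<xi>)) (dN p0 (?D \<zeta>))"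
      by (rule mext_d_eta)
    also have "\<dots> = omega_H i0 (pr (snd d q0))
       (frechet_derivative pr (at (snd d q0)) \<xi>) (frechet_derivative pr (at (snd d q0)) \<zeta>)"
      unfolding dpr[OF y0] pp0 using tangent_of_preferred[OF P UNIV_I, of p0] pp0
      by (simp add: b_def[symmetric] pr_def pl_def pp_def)
    finally show ?thesis .
  qed
  have prN: "pr y \<in> N" for y unfolding pr_def pl_def by (rule piN_mem)
  show ?thesis
    by (rule that[OF V(1) y0 V(3) pr prN \<beta> S_def linS injS rel curv])
qed

end

lemma g_N_I_hat_left: "g_N i0 (I_hat u) v = - g_N i0 u (I_hat v)"
  using g_N_I_hat[of i0 u "I_hat v"] by (simp add: g_N_linear_simps)

lemma Ck_on_f_H:
  assumes "open V" "Ck_on k V pr"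
  shows "Ck_on k V (\<lambda>y. f_H i0 c (pr y))"
proof -
  have bb: "bounded_bilinear (g_M i0)"
    using bilinear_g_M by (simp add: bilinear_conv_bounded_bilinear)
  have C: "Ck_on k V (\<lambda>y. fst (pr y))"
    by (rule Ck_on_bounded_linear[OF assms(1) bounded_linear_fst assms(2)])
  show ?thesis
    unfolding f_H_eq
    by (rule Ck_on_divide[OF assms(1) _ Ck_on_diff[OF assms(1) Ck_on_bilinear[OF assms(1) bb C C]
          Ck_on_const[OF assms(1)]] Ck_on_const[OF assms(1)]]) simp
qed

lemma I_hat_Z_field: "I_hat (Z_field x) = (fst x, 0)"
  by (simp add: I_hat_def Z_field_def c_map_linear_simps)

text \<open>Transfers opposite signs on one reference basis to arbitrary adapted bases:
  \<open>k\<close> and \<open>-k\<close> stand for the determinants of two complex structures on a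
  common basis.\<close>

lemma sign_product_nonpos:
  fixes k A B :: real
  assumes "k * A \<ge> 0" "- k * B \<ge> 0" "k \<noteq> 0"
  shows "A * B \<le> 0"
proof -
  have "(k * A) * (- k * B) \<ge> 0" using assms(1,2) by (rule mult_nonneg_nonneg)
  then have "k\<^sup>2 * (A * B) \<le> 0" by (simp add: power2_eq_square algebra_simps)
  then show ?thesis using assms(3) by (simp add: mult_le_0_iff)
qed

section \<open>Smoothness and integrability of the twisted structure\<close>

context c_map_twist
begin

lemma frame_Ck:
  assumes V: "open V" and pr: "smooth_on V pr" "\<And>y. y \<in> V \<Longrightarrow> pr y \<in> N"
    and \<beta>: "\<And>\<xi>. smooth_on V (\<lambda>y. \<beta> y \<xi> :: real)"
    and S: "\<And>y \<xi>. S y \<xi> = frechet_derivative pr (at y) \<xi> - (\<beta> y \<xi> / f_H i0 c (pr y)) *\<^sub>R Z_field (pr y)"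
  shows "Ck_on k V (\<lambda>y. S y \<xi>)"
proof -
  have Z: "bounded_linear (Z_field :: 'n TM_dual \<Rightarrow> 'n TM_dual)"
    using linear_Z_field by (simp add: linear_conv_bounded_linear)
  have C: "Ck_on k V pr" "Ck_on k V (\<lambda>y. \<beta> y \<xi>)" "Ck_on k V (\<lambda>y. frechet_derivative pr (at y) \<xi>)"
    using pr(1) \<beta> smooth_on_frechet[OF pr(1)] by (simp_all add: smooth_on_def)
  show ?thesis unfolding S
  proof (intro Ck_on_diff[OF V C(3)] Ck_on_scaleR[OF V] Ck_on_divide[OF V _ C(2)])
    show "Ck_on k V (\<lambda>y. f_H i0 c (pr y))" by (rule Ck_on_f_H[OF V C(1)])
    show "Ck_on k V (\<lambda>y. Z_field (pr y))" by (rule Ck_on_bounded_linear[OF V Z C(1)])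
    show "f_H i0 c (pr y) \<noteq> 0" if "y \<in> V" for y
      using N_dom_f_H[OF pr(2)[OF that] c] by simp
  qed
qed

lemma smooth_J_hat:
  assumes d: "d \<in> AQ"
  shows "smooth_on (snd d ` fst d) (\<lambda>y. endo_in AQ d J_hat y u)"
  unfolding smooth_on_def
proof (intro allI Ck_on_local)
  fix k y assume "y \<in> snd d ` fst d"
  then obtain q0 where q0: "q0 \<in> fst d" "y = snd d q0" by auto
  obtain V S \<beta> pr where V: "open V" "snd d q0 \<in> V" "V \<subseteq> snd d ` fst d"
    and pr: "smooth_on V pr" "\<And>y. y \<in> V \<Longrightarrow> pr y \<in> N" and \<beta>: "\<And>\<xi>. smooth_on V (\<lambda>y. \<beta> y \<xi> :: real)"
    and S: "\<And>y \<xi>. S y \<xi> = frechet_derivative pr (at y) \<xi> - (\<beta> y \<xi> / f_H i0 c (pr y)) *\<^sub>R Z_field (pr y)"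
    and linS: "\<And>y. y \<in> V \<Longrightarrow> linear (S y)" and injS: "\<And>y. y \<in> V \<Longrightarrow> inj (S y)"
    and rel: "\<And>y \<xi>. y \<in> V \<Longrightarrow> S y (endo_in AQ d J_hat y \<xi>) = I_hat (S y \<xi>)"
    by (rule local_frame[OF d q0(1)]) blast
  note CS = frame_Ck[OF V(1) pr \<beta> S, of k]
  \<comment> \<open>The linear system takes values in \<open>'n TM_dual\<close>, while Cramer's rule
    needs a square matrix. Any fixed linear isomorphism will do, and the twist map at an arbitrary
    point is one.\<close>
  define L where "L = T (SOME p. True)"
  have L: "linear L" "inj L" unfolding L_def by (rule linear_T inj_T)+
  have bL: "bounded_linear L" using L(1) by (simp add: linear_conv_bounded_linear)
  have bI: "bounded_linear (I_hat :: 'n TM_dual \<Rightarrow> 'n TM_dual)"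
    using linear_I_hat by (simp add: linear_conv_bounded_linear)
  have "Ck_on k V (\<lambda>y. endo_in AQ d J_hat y u)"
  proof (rule Ck_on_solve[OF V(1), where A = "\<lambda>y \<xi>. L (S y \<xi>)" and w = "\<lambda>y. L (I_hat (S y u))"])
    show "Ck_on k V (\<lambda>y. L (S y \<xi>))" for \<xi> by (rule Ck_on_bounded_linear[OF V(1) bL CS])
    show "Ck_on k V (\<lambda>y. L (I_hat (S y u)))"
      by (rule Ck_on_bounded_linear[OF V(1) bL Ck_on_bounded_linear[OF V(1) bI CS]])
    show "linear (\<lambda>\<xi>. L (S y \<xi>))" if "y \<in> V" for y
      using linear_compose[OF linS[OF that] L(1)] by (simp add: o_def)
    show "inj (\<lambda>\<xi>. L (S y \<xi>))" if "y \<in> V" for y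
      using inj_compose[OF L(2) injS[OF that]] by (simp add: o_def)
    show "L (S y (endo_in AQ d J_hat y u)) = L (I_hat (S y u))" if "y \<in> V" for y
      by (simp add: rel[OF that])
  qed
  then show "\<exists>U. open U \<and> y \<in> U \<and> Ck_on k U (\<lambda>y. endo_in AQ d J_hat y u)"
    using V q0 by blast
qed

lemma nijenhuis_J_hat: "nijenhuis AQ J_hat q u v = 0"
proof -
  define d where "d = chart_at AQ q"
  have d: "d \<in> AQ" "q \<in> fst d" unfolding d_def using preferred_chart[OF Q] by auto
  note dc = manifold_chart[OF Q d(1)]
  define y where "y = snd d q"
  define K where "K = endo_in AQ d J_hat"
  obtain V S \<beta> pr where V: "open V" "snd d q \<in> V" "V \<subseteq> snd d ` fst d"
    and pr: "smooth_on V pr" "\<And>y. y \<in> V \<Longrightarrow> pr y \<in> N" and \<beta>: "\<And>\<xi>. smooth_on V (\<lambda>y. \<beta> y \<xi> :: real)"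
    and S: "\<And>y \<xi>. S y \<xi> = frechet_derivative pr (at y) \<xi> - (\<beta> y \<xi> / f_H i0 c (pr y)) *\<^sub>R Z_field (pr y)"
    and linS: "\<And>y. y \<in> V \<Longrightarrow> linear (S y)" and injS: "\<And>y. y \<in> V \<Longrightarrow> inj (S y)"
    and rel: "\<And>y \<xi>. y \<in> V \<Longrightarrow> S y (endo_in AQ d J_hat y \<xi>) = I_hat (S y \<xi>)"
    and curv: "\<And>\<xi> \<zeta>. ext_d \<beta> (snd d q) \<xi> \<zeta> = omega_H i0 (pr (snd d q))
       (frechet_derivative pr (at (snd d q)) \<xi>) (frechet_derivative pr (at (snd d q)) \<zeta>)"
    by (rule local_frame[OF d]) blast
  note yV = V(2)[folded y_def] and curv = curv[folded y_def] and rel = rel[folded K_def]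
  define r where "r = inverse (f_H i0 c (pr y))"
  define z where "z = Z_field (pr y)"
  define pr' where "pr' \<xi> = frechet_derivative pr (at y) \<xi>" for \<xi>
  define m where "m w = g_M i0 (fst (pr y)) (fst w)" for w :: "'n TM_dual"
  define E where "E \<xi> \<zeta> = frechet_derivative (\<lambda>y. S y \<zeta>) (at y) \<xi> - frechet_derivative (\<lambda>y. S y \<xi>) (at y) \<zeta>" for \<xi> \<zeta>
  have fnz: "f_H i0 c (pr y) \<noteq> 0" using N_dom_f_H[OF pr(2)[OF yV] c] by simp
  have dpr: "(pr has_derivative pr') (at y)"
    unfolding pr'_def[abs_def] by (rule smooth_on_has_derivative[OF pr(1) yV])
  define Y' where "Y' h = r *\<^sub>R Z_field (pr' h) + (- (r * m (pr' h) * r)) *\<^sub>R z" for h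
  have dY: "((\<lambda>y. inverse (f_H i0 c (pr y)) *\<^sub>R Z_field (pr y)) has_derivative Y') (at y)"
  proof -
    have 1: "((\<lambda>y. f_H i0 c (pr y)) has_derivative (\<lambda>h. m (pr' h))) (at y)"
      using diff_chain_at[OF dpr f_H_has_derivative] by (simp add: o_def m_def)
    have 2: "((\<lambda>y. Z_field (pr y)) has_derivative (\<lambda>h. Z_field (pr' h))) (at y)"
      using diff_chain_at[OF dpr linear_imp_has_derivative[OF linear_Z_field]] by (simp add: o_def)
    show ?thesis
      using bounded_bilinear.FDERIV[OF bounded_bilinear_scaleR Deriv.has_derivative_inverse[OF fnz 1] 2]
      by (simp only: Y'_def[abs_def] r_def z_def)
  qed
  have dS: "frechet_derivative (\<lambda>y. S y \<zeta>) (at y) \<xi> = frechet_derivative (\<lambda>y. frechet_derivative pr (at y) \<zeta>) (at y) \<xi>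
     - (\<beta> y \<zeta> *\<^sub>R Y' \<xi> + frechet_derivative (\<lambda>y. \<beta> y \<zeta>) (at y) \<xi> *\<^sub>R r *\<^sub>R z)" for \<xi> \<zeta>
  proof -
    have "((\<lambda>y. frechet_derivative pr (at y) \<zeta> - \<beta> y \<zeta> *\<^sub>R (inverse (f_H i0 c (pr y)) *\<^sub>R Z_field (pr y))) has_derivative
      (\<lambda>\<xi>. frechet_derivative (\<lambda>y. frechet_derivative pr (at y) \<zeta>) (at y) \<xi>
     - (\<beta> y \<zeta> *\<^sub>R Y' \<xi> + frechet_derivative (\<lambda>y. \<beta> y \<zeta>) (at y) \<xi> *\<^sub>R r *\<^sub>R z))) (at y)"
      unfolding r_def z_def
      by (intro has_derivative_diff bounded_bilinear.FDERIV[OF bounded_bilinear_scaleR] dY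
          smooth_on_has_derivative[OF \<beta> yV] smooth_on_has_derivative[OF smooth_on_frechet[OF pr(1)] yV])
    moreover have "(\<lambda>y. frechet_derivative pr (at y) \<zeta> - \<beta> y \<zeta> *\<^sub>R (inverse (f_H i0 c (pr y)) *\<^sub>R Z_field (pr y))) = (\<lambda>y. S y \<zeta>)"
      by (rule ext) (simp add: S divide_inverse)
    ultimately have "((\<lambda>y. S y \<zeta>) has_derivative (\<lambda>\<xi>. frechet_derivative (\<lambda>y. frechet_derivative pr (at y) \<zeta>) (at y) \<xi>
     - (\<beta> y \<zeta> *\<^sub>R Y' \<xi> + frechet_derivative (\<lambda>y. \<beta> y \<zeta>) (at y) \<xi> *\<^sub>R r *\<^sub>R z))) (at y)" by (simp only:)
    from fun_cong[OF frechet_derivative_at[OF this], of \<xi>] show ?thesis by (rule sym)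
  qed
  \<comment> \<open>The differential of the projection is rewritten in terms of the coframe, since
    the final identity involves \<open>S\<close> alone. As \<open>f_H\<close> is constant along
    \<open>Z\<close>, the correction is invisible to \<open>m\<close>.\<close>
  have pr'_S: "pr' \<xi> = S y \<xi> + (\<beta> y \<xi> * r) *\<^sub>R z" for \<xi>
    by (simp add: S pr'_def r_def z_def divide_inverse)
  have mz: "m z = 0" by (simp add: m_def z_def Z_field_def g_M_linear_simps)
  have m_pr': "m (pr' \<xi>) = m (S y \<xi>)" for \<xi>
    using mz unfolding pr'_S by (simp add: m_def g_M_linear_simps)
  have Iz: "g_N i0 (I_hat z) w = m w" for w
    by (simp add: z_def I_hat_Z_field g_N_eq m_def g_M_linear_simps)
  have curv': "ext_d \<beta> y \<xi> \<zeta> = - g_N i0 (I_hat (S y \<xi>)) (S y \<zeta>) + \<beta> y \<zeta> * r * m (S y \<xi>) - \<beta> y \<xi> * r * m (S y \<zeta>)" for \<xi> \<zeta>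
  proof -
    have "ext_d \<beta> y \<xi> \<zeta> = - g_N i0 (I_hat (pr' \<xi>)) (pr' \<zeta>)"
      unfolding curv omega_H_eq pr'_def ..
    moreover have "g_N i0 (I_hat (S y \<xi>)) z = - m (S y \<xi>)"
      unfolding g_N_I_hat_left[of i0 _ z] g_N_commute[of i0 "S y \<xi>"] Iz ..
    ultimately show ?thesis unfolding pr'_S
      by (simp add: linear_add[OF linear_I_hat] linear_scale[OF linear_I_hat] g_N_linear_simps Iz mz algebra_simps)
  qed
  \<comment> \<open>The second derivatives of \<open>pr\<close> cancel by symmetry. The terms with
    \<open>m\<close> from differentiating \<open>1/f_H\<close> cancel those which the curvature
    acquires when it is expressed through \<open>S\<close>.\<close>
  have E: "E \<xi> \<zeta> = (r * g_N i0 (I_hat (S y \<xi>)) (S y \<zeta>)) *\<^sub>R z - (\<beta> y \<zeta> * r) *\<^sub>R Z_field (S y \<xi>) + (\<beta> y \<xi> * r) *\<^sub>R Z_field (S y \<zeta>)" for \<xi> \<zeta>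
  proof -
    have "E \<xi> \<zeta> = \<beta> y \<xi> *\<^sub>R Y' \<zeta> - \<beta> y \<zeta> *\<^sub>R Y' \<xi> - ext_d \<beta> y \<xi> \<zeta> *\<^sub>R r *\<^sub>R z"
      unfolding E_def dS ext_d_def second_derivative_symmetric[OF V(1) yV pr(1), of \<xi> \<zeta>]
      by (simp add: algebra_simps)
    also have "\<dots> = (r * g_N i0 (I_hat (S y \<xi>)) (S y \<zeta>)) *\<^sub>R z - (\<beta> y \<zeta> * r) *\<^sub>R Z_field (S y \<xi>) + (\<beta> y \<xi> * r) *\<^sub>R Z_field (S y \<zeta>)"
      unfolding curv' Y'_def m_pr' unfolding pr'_S linear_add[OF linear_Z_field] linear_scale[OF linear_Z_field]
      by (simp add: algebra_simps)
    finally show ?thesis .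
  qed
  \<comment> \<open>The terms with \<open>\<beta>\<close> cancel in pairs because
    \<open>Z_field\<close> commutes with \<open>I_hat\<close>; the terms along \<open>z\<close>
    cancel because \<open>I_hat\<close> is skew and orthogonal for \<open>g_N\<close>.\<close>
  have E0: "E (K y u) (K y v) - I_hat (E (K y u) v) - I_hat (E u (K y v)) - E u v = 0"
    unfolding E rel[OF yV] Z_field_I_hat
    using g_N_I_hat_left[of i0 "S y u" "S y v"]
    by (simp add: linear_add[OF linear_I_hat] linear_diff[OF linear_I_hat] linear_scale[OF linear_I_hat]
        linear_neg[OF linear_I_hat] g_N_linear_simps algebra_simps)
  have inv: "chart_inv d y = q" unfolding y_def by (rule chart_inv_left[OF dc d(2)])
  have "lie_bracket (\<lambda>y. K y u) (\<lambda>y. K y v) y - K y (lie_bracket (\<lambda>y. K y u) (\<lambda>_. v) y)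
    - K y (lie_bracket (\<lambda>_. u) (\<lambda>y. K y v) y) + K y (K y (lie_bracket (\<lambda>_. u) (\<lambda>_. v) y)) = 0"
  proof (rule frame_torsion[OF V(1) yV linS injS[OF yV] _ _ _ linear_I_hat I_hat_I_hat rel E_def E0])
    show "(\<lambda>y. S y \<xi>) differentiable (at y)" for \<xi>
      using frame_Ck[OF V(1) pr \<beta> S, of "Suc 0" \<xi>] yV by simp
    show "(\<lambda>y. K y \<xi>) differentiable (at y)" for \<xi>
      unfolding K_def by (rule differentiableI[OF smooth_on_has_derivative[OF smooth_J_hat[OF d(1)]]])
        (use yV V(3) in auto)
    show "linear (K y)"
    proof -
      have "K y = components AQ d q \<circ> (J_hat q \<circ> tangent_of AQ d q)"
        by (rule ext) (simp add: K_def endo_in_def inv)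
      then show ?thesis
        by (simp add: linear_compose linear_J_hat linear_tangent_of[OF Q d] linear_components[OF Q d])
    qed
  qed
  then show ?thesis unfolding nijenhuis_def Let_def K_def d_def y_def .
qed

lemma complex_structure_J_hat: "complex_structure AQ J_hat"
  unfolding complex_structure_def smooth_endo_def
  using smooth_J_hat linear_J_hat J_hat_J_hat nijenhuis_J_hat by blast

lemma N_fst_nonzero: "fst (piN p) $ i0 \<noteq> 0"
proof -
  have "fst (piN p) \<in> M_dom i0" using piN_mem[of p] by (simp add: N_dom_def)
  then have "(\<Sum>j\<in>-{i0}. (cmod (fst (piN p) $ j))\<^sup>2) < (cmod (fst (piN p) $ i0))\<^sup>2" by (simp add: M_dom_def)
  moreover have "0 \<le> (\<Sum>j\<in>-{i0}. (cmod (fst (piN p) $ j))\<^sup>2)" by (intro sum_nonneg) simp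
  ultimately show ?thesis by auto
qed

lemma T_injD: "T p u = T p v \<Longrightarrow> u = v"
  using inj_T by (rule injD)

lemma T_surjE: obtains u where "\<xi> = T p u"
  using surj_T by (metis surjD)

lemma piQ_surjE: obtains p where "q = piQ p"
  using surj_piQ by (metis surjD)

section \<open>Comparison with the twisted metric, \<open>J1\<close> and
  \<open>J_tilde\<close>\<close>

context
  fixes g :: "'q \<Rightarrow> 'n R4n \<Rightarrow> 'n R4n \<Rightarrow> real" and J1 :: "'q \<Rightarrow> 'n R4n \<Rightarrow> 'n R4n" and X :: "'q \<Rightarrow> 'n R4n"
  assumes g: "is_twist_bilinear piN piQ T (g_H i0 c) g"
    and J1: "is_twist_endo piN piQ T (\<lambda>_. I_1) J1"
    and X: "\<And>p. X (piQ p) = dQ p (XP p)"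
begin

lemma g_T: "g (piQ p) (T p u) (T p v) = g_H i0 c (piN p) u v"
  by (rule g[unfolded is_twist_bilinear_def, rule_format])

lemma J1_T: "J1 (piQ p) (T p u) = T p (I_1 u)"
  by (rule J1[unfolded is_twist_endo_def, rule_format])

lemma piN_nondegenerate: "g_M i0 (fst (piN p)) (fst (piN p)) \<noteq> 0"
  using N_dom_g_M[OF piN_mem[of p]] by simp

lemma hermitian_J_hat: "hermitian_structure AQ g J_hat"
  unfolding hermitian_structure_def
proof (intro conjI ballI allI complex_structure_J_hat)
  fix q u v
  obtain p where q: "q = piQ p" by (rule piQ_surjE)
  obtain a where a: "u = T p a" by (rule T_surjE)
  obtain b where b: "v = T p b" by (rule T_surjE)
  show "g q (J_hat q u) (J_hat q v) = g q u v"
    unfolding q a b J_hat_T g_T by (rule g_H_I_hat[OF piN_nondegenerate])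
qed

text \<open>\<open>g\<close> is prescribed only on values of the twist map; surjectivity of
  \<open>T p\<close> transfers bilinearity to all tangent vectors.\<close>

lemma bilinear_g: "bilinear (g (piQ p))"
proof -
  note l = linear_add[OF linear_T, symmetric] linear_scale[OF linear_T, symmetric]
  note b = bilinear_g_H[OF piN_nondegenerate, of c p]
  have "g (piQ p) x (y + z) = g (piQ p) x y + g (piQ p) x z"
    "g (piQ p) (y + z) x = g (piQ p) y x + g (piQ p) z x"
    "g (piQ p) x (k *\<^sub>R y) = k *\<^sub>R g (piQ p) x y" "g (piQ p) (k *\<^sub>R y) x = k *\<^sub>R g (piQ p) y x" for x y z k
  proof -
    obtain x' y' z' where "x = T p x'" "y = T p y'" "z = T p z'" by (metis T_surjE)
    then show "g (piQ p) x (y + z) = g (piQ p) x y + g (piQ p) x z"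
      "g (piQ p) (y + z) x = g (piQ p) y x + g (piQ p) z x"
      "g (piQ p) x (k *\<^sub>R y) = k *\<^sub>R g (piQ p) x y" "g (piQ p) (k *\<^sub>R y) x = k *\<^sub>R g (piQ p) y x"
      by (simp_all only: l g_T bilinear_ladd[OF b] bilinear_radd[OF b] bilinear_lmul[OF b] bilinear_rmul[OF b])
  qed
  then show ?thesis unfolding bilinear_def by (intro conjI allI linearI)
qed

text \<open>The plane spanned by \<open>X\<close> and its image under \<open>J1\<close> is the twist
  of the complex line through the horizontal vector \<open>fst (piN p)\<close>. Only membership of
  the correction in this line matters below, so its coefficients stay unspecified.\<close>

lemma J_tilde_T:
  obtains a b where "J_tilde g X J1 (piQ p) (T p u) =
    T p (I_1 u - 2 *\<^sub>R I_1 (a *\<^sub>R fst (piN p) + b *\<^sub>R J_M (fst (piN p)), 0))"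
proof -
  let ?x = "piN p"
  define k where "k = - inverse (f_H i0 c ?x)"
  have k: "k \<noteq> 0" using f_H_piN[of p] by (simp add: k_def)
  have X_eq: "X (piQ p) = T p (k *\<^sub>R Z_field ?x)"
    by (simp add: X dQ_XP k_def linear_scale[OF linear_T] linear_neg[OF linear_T])
  have JX_eq: "J1 (piQ p) (X (piQ p)) = T p (k *\<^sub>R I_1 (Z_field ?x))"
    unfolding X_eq J1_T by (simp add: linear_scale[OF linear_I_1])
  let ?S = "{X (piQ p), J1 (piQ p) (X (piQ p))}"
  note b = bilinear_g_H[OF piN_nondegenerate, of c p]
  note lr = bilinear_lmul[OF b] bilinear_rmul[OF b] g_H_Z[OF piN_nondegenerate]
  have f: "f_H i0 c ?x \<noteq> 0" "f_Z i0 c ?x \<noteq> 0" "g_M i0 (fst ?x) (fst ?x) \<noteq> 0"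
    using f_H_piN[of p] N_dom_f_Z[OF piN_mem[of p]] piN_nondegenerate[of p] by auto
  have "orth_part (g (piQ p)) ?S (T p u) \<in> span ?S"
  proof -
    have orth: "g (piQ p) b b' = 0" if "b \<in> ?S" "b' \<in> ?S" "b \<noteq> b'" for b b'
      using that unfolding JX_eq unfolding X_eq by (auto simp: g_T lr)
    have nz: "g (piQ p) b b \<noteq> 0" if "b \<in> ?S" for b
      using that k f unfolding JX_eq unfolding X_eq by (auto simp: g_T lr)
    have fin: "finite ?S" by simp
    have "orth_part (g (piQ p)) ?S (T p u) = (\<Sum>b\<in>?S. (g (piQ p) (T p u) b / g (piQ p) b b) *\<^sub>R b)"
      by (rule orth_part_expansion(4)[OF bilinear_g fin orth nz]) blast
    moreover have "(\<Sum>b\<in>?S. (g (piQ p) (T p u) b / g (piQ p) b b) *\<^sub>R b) \<in> span ?S"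
      by (rule orth_part_expansion(1)[OF bilinear_g fin orth nz]) blast
    ultimately show ?thesis by (simp only:)
  qed
  then obtain s t where v: "orth_part (g (piQ p)) ?S (T p u) = s *\<^sub>R X (piQ p) + t *\<^sub>R J1 (piQ p) (X (piQ p))"
    unfolding span_insert by (auto simp: algebra_simps)
  define w where "w = (s * k) *\<^sub>R Z_field ?x + (t * k) *\<^sub>R I_1 (Z_field ?x)"
  have w: "orth_part (g (piQ p)) ?S (T p u) = T p w"
    unfolding v unfolding JX_eq unfolding X_eq w_def by (simp add: linear_add[OF linear_T] linear_scale[OF linear_T])
  have "w = ((t * k) *\<^sub>R fst ?x + (- s * k) *\<^sub>R J_M (fst ?x), 0)"
    by (simp add: w_def Z_field_def I_1_eq c_map_linear_simps)
  moreover have "J_tilde g X J1 (piQ p) (T p u) = T p (I_1 u - 2 *\<^sub>R I_1 w)"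
    unfolding J_tilde_def Let_def w linear_diff[OF linear_T, symmetric] J1_T
    by (simp add: linear_diff[OF linear_I_1] scaleR_2 diff_diff_eq)
  ultimately show ?thesis using that by blast
qed

text \<open>A vertical vector separates \<open>J_hat\<close> from \<open>J1\<close> and from
  \<open>J_tilde\<close>, whose correction is horizontal; a horizontal one separates it from
  \<open>- J1\<close>. For \<open>- J_tilde\<close> a horizontal vector outside the corrected
  complex line is needed.\<close>

lemma J_hat_distinct:
  assumes n: "CARD('n) \<ge> 2"
  shows "J_hat \<noteq> J1" "J_hat \<noteq> - J1" "J_hat \<noteq> J_tilde g X J1" "J_hat \<noteq> - J_tilde g X J1"
proof -
  define p where "p = (SOME p::'p. True)"
  define w where "w = (axis i0 1 :: 'n cvec)"
  have wi: "w $ i0 = 1" by (simp add: w_def axis_def)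
  have J0: "J_M v = 0 \<Longrightarrow> v = 0" for v :: "'n cvec" using J_M_J_M[of v] by (simp add: J_M_linear_simps)
  have two: "v = - v \<Longrightarrow> v = 0" for v :: "'n cvec" by (simp add: vec_eq_iff)
  have Jw: "J_M w \<noteq> - J_M w" using two J0 wi by (metis zero_index zero_neq_one)
  show "J_hat \<noteq> J1"
  proof
    assume "J_hat = J1"
    then have "T p (I_hat (0, w)) = T p (I_1 (0, w))" using J_hat_T J1_T by metis
    then show False using Jw by (auto dest!: T_injD simp: I_hat_def I_1_eq)
  qed
  show "J_hat \<noteq> - J1"
  proof
    assume "J_hat = - J1"
    then have "J_hat (piQ p) (T p (w, 0)) = - J1 (piQ p) (T p (w, 0))" by simp
    then have "T p (I_hat (w, 0)) = T p (- I_1 (w, 0))" by (simp only: J_hat_T J1_T linear_neg[OF linear_T])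
    then show False using Jw by (auto dest!: T_injD simp: I_hat_def I_1_eq)
  qed
  show "J_hat \<noteq> J_tilde g X J1"
  proof
    assume eq: "J_hat = J_tilde g X J1"
    obtain a b where "J_tilde g X J1 (piQ p) (T p (0, w)) =
      T p (I_1 (0, w) - 2 *\<^sub>R I_1 (a *\<^sub>R fst (piN p) + b *\<^sub>R J_M (fst (piN p)), 0))" by (rule J_tilde_T)
    then have "T p (I_hat (0, w)) = T p (I_1 (0, w) - 2 *\<^sub>R I_1 (a *\<^sub>R fst (piN p) + b *\<^sub>R J_M (fst (piN p)), 0))"
      using J_hat_T[of p "(0, w)"] eq by simp
    from arg_cong[OF T_injD[OF this], of snd] show False
      using Jw by (simp add: I_hat_def I_1_eq c_map_linear_simps)
  qed
  show "J_hat \<noteq> - J_tilde g X J1"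
  proof
    assume eq: "J_hat = - J_tilde g X J1"
    \<comment> \<open>With one coordinate only, the line would be the whole horizontal half. A
      second coordinate vector is not a complex multiple of \<open>fst (piN p)\<close>, whose
      \<open>i0\<close>-component is nonzero.\<close>
    have "\<exists>j. j \<noteq> i0"
    proof (rule ccontr)
      assume "\<nexists>j. j \<noteq> i0"
      then have "(UNIV :: 'n set) = {i0}" by auto
      then have "CARD('n) = card {i0}" by (rule arg_cong)
      then show False using n by simp
    qed
    then obtain j where j: "j \<noteq> i0" ..
    define y where "y = (axis j 1 :: 'n cvec)"
    obtain a b where "J_tilde g X J1 (piQ p) (T p (y, 0)) =
      T p (I_1 (y, 0) - 2 *\<^sub>R I_1 (a *\<^sub>R fst (piN p) + b *\<^sub>R J_M (fst (piN p)), 0))" by (rule J_tilde_T)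
    moreover have "J_hat (piQ p) (T p (y, 0)) = - J_tilde g X J1 (piQ p) (T p (y, 0))" using eq by simp
    ultimately have "T p (I_hat (y, 0)) = T p (- (I_1 (y, 0) - 2 *\<^sub>R I_1 (a *\<^sub>R fst (piN p) + b *\<^sub>R J_M (fst (piN p)), 0)))"
      by (simp only: J_hat_T linear_neg[OF linear_T])
    from arg_cong[OF T_injD[OF this], of fst]
    have "J_M y = - J_M y + 2 *\<^sub>R J_M (a *\<^sub>R fst (piN p) + b *\<^sub>R J_M (fst (piN p)))"
      by (simp add: I_hat_def I_1_eq)
    then have "2 *\<^sub>R J_M y = 2 *\<^sub>R J_M (a *\<^sub>R fst (piN p) + b *\<^sub>R J_M (fst (piN p)))"
      unfolding scaleR_2[of "J_M y"] by (metis add.commute add_minus_cancel)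
    then have "J_M (y - (a *\<^sub>R fst (piN p) + b *\<^sub>R J_M (fst (piN p)))) = 0"
      by (simp add: linear_diff[OF linear_J_M])
    then have y: "y = a *\<^sub>R fst (piN p) + b *\<^sub>R J_M (fst (piN p))" using J0 by fastforce
    have "Complex a b * (fst (piN p) $ i0) = y $ i0"
      unfolding y by (simp add: J_M_def complex_eq_iff)
    also have "y $ i0 = 0" using j by (simp add: y_def axis_def)
    finally have "Complex a b = 0" using N_fst_nonzero[of p] by simp
    then have "a = 0" "b = 0" by (simp_all add: complex_eq_iff)
    then have "y = 0" using y by simp
    then have "y $ j = 0" by simp
    then show False by (simp add: y_def axis_def)
  qed
qed

text \<open>Conjugation by \<open>R\<close> turns \<open>J\<close> into \<open>I_1\<close> and fixes
  \<open>I_hat\<close>, so both structures are images of the model pair under one linear isomorphism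
  \<open>L\<close>. On the same basis the two determinants are then equal and nonzero.\<close>

lemma orientation_even:
  assumes n: "even CARD('n)" and J: "J \<in> Q_bundle i0 piQ T q" "\<And>u. J (J u) = - u"
  shows "same_orientation (J_hat q) J"
proof -
  define I' where "I' a b d u = a *\<^sub>R I_1 u + b *\<^sub>R I_2 i0 u + d *\<^sub>R I_3 i0 u" for a b d u
  obtain p a b d where q: "piQ p = q" and JT: "\<And>u. J (T p u) = T p (I' a b d u)"
    using J(1) unfolding Q_bundle_def I'_def by blast
  have sq: "I' a b d (I' a b d u) = - u" for u
    by (rule T_injD[of p]) (simp add: JT[symmetric] J(2) linear_neg[OF linear_T])
  obtain R :: "'n TM_dual \<Rightarrow> 'n TM_dual" where R: "linear R" "inj R"
    "\<And>u. R (I_1 u) = I' a b d (R u)" "\<And>u. R (I_hat u) = I_hat (R u)"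
    using imaginary_unit_conjugate[OF sq[unfolded I'_def]] unfolding I'_def by blast
  define L where "L = T p \<circ> R"
  have L: "linear L" "inj L" unfolding L_def by (rule linear_compose[OF R(1) linear_T], rule inj_compose[OF inj_T R(2)])
  have "J_hat q (L u) = L (I_hat u)" "J (L u) = L (I_1 u)" for u
    unfolding L_def q[symmetric] by (simp_all add: J_hat_T R JT)
  note o = orientation_I_hat_I_1[OF L this]
  have "adapted_basis_det (J_hat q) (L \<circ> flat_basis) * adapted_basis_det J (L \<circ> flat_basis) > 0"
    using o n by (simp add: zero_less_mult_iff linorder_neq_iff disj_commute)
  then show ?thesis unfolding same_orientation_def by blast
qed

text \<open>\<open>same_orientation\<close> is existential in both bases, so refuting it for
  \<open>J1\<close> needs the sign on every adapted basis, and not only the comparison on the model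
  basis.\<close>

lemma orientation_odd:
  assumes n: "odd CARD('n)"
  shows "\<exists>q. \<exists>J\<in>Q_bundle i0 piQ T q. (\<forall>u. J (J u) = - u) \<and> \<not> same_orientation (J_hat q) J"
proof -
  define p where "p = (SOME p::'p. True)"
  let ?q = "piQ p" and ?J = "J1 (piQ p)"
  have "?J \<in> Q_bundle i0 piQ T ?q"
    unfolding Q_bundle_def
    by (rule CollectI, rule exI[of _ p], rule exI[of _ 1], rule exI[of _ 0], rule exI[of _ 0]) (simp add: J1_T)
  moreover have JJ: "?J (?J u) = - u" for u
    by (rule T_surjE[of u p]) (simp add: J1_T linear_neg[OF linear_T])
  moreover have "\<not> same_orientation (J_hat ?q) ?J"
  proof
    assume "same_orientation (J_hat ?q) ?J"
    then obtain e e' where e: "adapted_basis_det (J_hat ?q) e * adapted_basis_det ?J e' > 0"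
      unfolding same_orientation_def by blast
    have linJ: "linear ?J"
    proof (rule linearI)
      fix a b :: "'n R4n" and r :: real
      obtain u where u: "a = T p u" by (rule T_surjE)
      obtain v where v: "b = T p v" by (rule T_surjE)
      show "?J (a + b) = ?J a + ?J b"
        unfolding u v linear_add[OF linear_T, symmetric] J1_T by (simp add: linear_add[OF linear_I_1] linear_add[OF linear_T])
      show "?J (r *\<^sub>R a) = r *\<^sub>R ?J a"
        unfolding u linear_scale[OF linear_T, symmetric] J1_T by (simp add: linear_scale[OF linear_I_1] linear_scale[OF linear_T])
    qed
    note o = orientation_I_hat_I_1[OF linear_T inj_T J_hat_T[of p] J1_T[of p]]
    let ?e0 = "T p \<circ> flat_basis"
    have "adapted_basis_det (J_hat ?q) e * adapted_basis_det ?J e' \<le> 0"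
    proof (rule sign_product_nonpos)
      show "adapted_basis_det (J_hat ?q) ?e0 * adapted_basis_det (J_hat ?q) e \<ge> 0"
        by (rule adapted_basis_det_mult_nonneg[OF linear_J_hat J_hat_J_hat])
      show "- adapted_basis_det (J_hat ?q) ?e0 * adapted_basis_det ?J e' \<ge> 0"
        using adapted_basis_det_mult_nonneg[OF linJ JJ, of ?e0 e'] o(1) n by simp
    qed (rule o(2))
    then show False using e by simp
  qed
  ultimately show ?thesis by blast
qed

end

end

theorem theorem4p2:
  fixes i0 :: "'n::finite" and c :: real
    and AP :: "('p::{t2_space,second_countable_topology}, 'n R4n \<times> real) chart set"
    and piN :: "'p \<Rightarrow> 'n TM_dual"
    and rot :: "real \<Rightarrow> 'p \<Rightarrow> 'p"
    and eta :: "'p \<Rightarrow> 'n R4n \<times> real \<Rightarrow> real"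
    and XP :: "'p \<Rightarrow> 'n R4n \<times> real"
    and Psi :: "real \<Rightarrow> 'p \<Rightarrow> 'p"
    and AQ :: "('q::{t2_space,second_countable_topology}, 'n R4n) chart set"
    and piQ :: "'p \<Rightarrow> 'q"
    and tw :: "'p \<Rightarrow> 'n TM_dual \<Rightarrow> 'n R4n"
    and g :: "'q \<Rightarrow> 'n R4n \<Rightarrow> 'n R4n \<Rightarrow> real"
    and X :: "'q \<Rightarrow> 'n R4n"
    and J1 :: "'q \<Rightarrow> 'n R4n \<Rightarrow> 'n R4n"
  assumes n: "CARD('n) \<ge> 2" and c: "c \<ge> 0"
    and P: "smooth_manifold UNIV AP"
    and P_bundle: "principal_circle_bundle AP (N_dom i0 c) piN rot"
    and connection: "principal_connection AP rot eta"
    and curvature: "has_curvature AP (N_dom i0 c) piN eta (omega_H i0)"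
    and XP: "XP = generator AP rot"
    and Psi: "smooth_flow AP Psi" "generator AP Psi = Z_P i0 c AP piN eta XP"
    and Psi_action: "acts_freely_properly Psi"
    and Q: "smooth_manifold UNIV AQ"
    and Q_quotient: "is_orbit_space AP Psi AQ piQ"
    and tw: "tw = twist_map AP (N_dom i0 c) piN eta AQ piQ"
    and g: "is_twist_bilinear piN piQ tw (g_H i0 c) g"
    and X: "\<And>p. X (piQ p) = mderiv AP AQ piQ p (XP p)"
    and J1: "is_twist_endo piN piQ tw (\<lambda>_. I_1) J1"
  shows "\<exists>Jhat.
      hermitian_structure AQ g Jhat \<and>
      Jhat \<noteq> J1 \<and> Jhat \<noteq> - J1 \<and> Jhat \<noteq> J_tilde g X J1 \<and> Jhat \<noteq> - J_tilde g X J1 \<and>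
      ((\<forall>q. \<forall>J\<in>Q_bundle i0 piQ tw q. (\<forall>u. J (J u) = - u) \<longrightarrow> same_orientation (Jhat q) J)
         \<longleftrightarrow> even CARD('n))"
proof -
  interpret c_map_twist i0 c AP piN rot eta Psi AQ piQ
    using c P P_bundle connection curvature Psi Q Q_quotient unfolding XP by unfold_locales
  note hyps = g[unfolded tw] J1[unfolded tw] X[unfolded XP]
  have "(\<forall>q. \<forall>J\<in>Q_bundle i0 piQ tw q. (\<forall>u. J (J u) = - u) \<longrightarrow> same_orientation (J_hat q) J) \<longleftrightarrow> even CARD('n)"
    unfolding tw using orientation_even[OF hyps] orientation_odd[OF hyps] by blast
  then show ?thesis
    using hermitian_J_hat[OF hyps] J_hat_distinct[OF hyps n] by blast
qed

end
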